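(* Let $M^2$ be a Riemann surface (not necessarily simply connected), and let $G$ and $G_*$ be non-constant meromorphic functions on $M^2$ such that $G$ is not identically equal to $G_*$. Assume that (i) all poles of the $1$-form $\dfrac{dG}{G-G_*}$ are of order $1$, and (ii) $\displaystyle\int_{\gamma}\frac{dG}{G-G_*}\in \pi i\,\mathbf{Z}$ for each loop $\gamma$ on $M^2$ (not passing through poles of this $1$-form). Set $$\xi(z) := c\,\exp\int_{z_0}^{z}\frac{dG}{G-G_*},$$ where $z_0\in M^2$ is a base point (not a pole of the $1$-form) and $c\in\mathbf{C}\setminus\{0\}$ is an arbitrary constant. Then $$E := \begin{pmatrix} G/\xi & \xi G_*/(G-G_* )\\ 1/\xi & \xi/(G-G_* )\end{pmatrix}$$ is a non-constant meromorphic Legendrian curve in $\mathrm{PSL}(2,\mathbf{C})$ defined on $M^2$ whose hyperbolic Gauss maps are $G$ and $G_*$. The canonical form $\omega$ of $E$ is $$\omega=-\frac{dG}{\xi^2}.$$ Moreover, a point $p\in M^2$ is a pole of $E$ if and only if $G(p)=G_*(p)$. Conversely, any meromorphic Legendrian curve in $\mathrm{PSL}(2,\mathbf{C})$ defined on $M^2$ with non-constant hyperbolic Gauss maps $G$ and $G_*$ is obtained in this way (that is, $G\not\equiv G_*$, conditions (i) and (ii) hold, and $$E=\begin{pmatrix} G/\xi & \xi G_*/(G-G_* )\\ 1/\xi & \xi/(G-G_* )\end{pmatrix}\qquad\text{with}\qquad \xi(z)=c\,\exp\int_{z_0}^{z}\frac{dG}{G-G_*}$$ for some $c\in\mathbf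{C}\setminus\{0\}$).
   Context: $\mathrm{PSL}(2,\mathbf{C})=\mathrm{SL}(2,\mathbf{C})/\{\pm\mathrm{id}\}$. Meromorphic functions on $M^2$ are regarded as having values in $\mathbf{C}\cup\{\infty\}$. A meromorphic map $E$ from $M^2$ into $\mathrm{PSL}(2,\mathbf{C})$ is a map represented as $$E=\begin{pmatrix}A&B\\C&D\end{pmatrix}=\sqrt{h}\begin{pmatrix}\hat A&\hat B\\ \hat C&\hat D\end{pmatrix},\qquad AD-BC=1,$$ where $\hat A,\hat B,\hat C,\hat D$ and $h$ are meromorphic functions on $M^2$; $\sqrt h$ may be multi-valued, but $E$ is well-defined as a $\mathrm{PSL}(2,\mathbf{C})$-valued map (changing the branch of $\sqrt h$ multiplies all of $A,B,C,D$ by $-1$). A pole of $E$ is a point at which $E$ is not holomorphic as a $\mathrm{PSL}(2,\mathbf{C})$-valued map. A meromorphic map $E=\begin{pmatrix}A&B\\C&D\end{pmatrix}$ from $M^2$ into $\mathrm{PSL}(2,\mathbf{C})$ is a (meromorphic) Legendrian curve if $D\,dA-B\,dC=0$ identically on $M^2$. Its hyperbolic Gauss maps are the functions $G=A/C$ and $G_*=B/D$ (with values in $\mathbf{C}\cup\{\infty\}$). For a Legendrian curve $E$ one has $$E^{-1}dE=\begin{pmatrix}0&\theta\\ \omega&0\end{pmatrix}$$ with meromorphic $1$-forms $\omega,\theta$ on $M^2$, and $\omega$ is called the canonical form of $E$. *)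

theory Defs
  imports "HOL-Complex_Analysis.Complex_Analysis"
begin

section \<open>Riemann surfaces\<close>

text \<open>The surface is the whole Hausdorff type \<open>'a\<close> with a holomorphic atlas.  A chart is a pair of
  an open set and a coordinate, whose values off that set are irrelevant.\<close>

type_synonym 'a chart = "'a set \<times> ('a \<Rightarrow> complex)"

definition riemann_surface :: "('a::t2_space) chart set \<Rightarrow> bool" where
  "riemann_surface \<A> \<longleftrightarrow>
     connected (UNIV :: 'a set) \<and>
     (\<Union>(U, \<phi>)\<in>\<A>. U) = UNIV \<and>
     (\<forall>(U, \<phi>)\<in>\<A>. open U \<and> open (\<phi> ` U) \<and> homeomorphism U (\<phi> ` U) \<phi> (inv_into U \<phi>)) \<and>
     (\<forall>(U, \<phi>)\<in>\<A>. \<forall>(V, \<psi>)\<in>\<A>. (\<psi> \<circ> inv_into U \<phi>) holomorphic_on (\<phi> ` (U \<inter> V)))"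


section \<open>Meromorphic functions with values in the Riemann sphere\<close>

datatype riemann_sphere = Fin complex | Infty

text \<open>The library's convention that a nicely meromorphic function vanishes at its poles is the
  reason for sending the point at infinity to 0; the poles are recorded by \<open>Infty\<close>.\<close>

primrec finite_part :: "riemann_sphere \<Rightarrow> complex" where
  "finite_part (Fin z) = z"
| "finite_part Infty = 0"

definition sphere_quotient :: "complex \<Rightarrow> complex \<Rightarrow> riemann_sphere" where
  "sphere_quotient a b = (if b = 0 then Infty else Fin (a / b))"

definition in_chart :: "('a \<Rightarrow> riemann_sphere) \<Rightarrow> 'a chart \<Rightarrow> complex \<Rightarrow> complex" where
  "in_chart G = (\<lambda>(U, \<phi>) z. finite_part (G (inv_into U \<phi> z)))"

definition meromorphic_function :: "('a::t2_space) chart set \<Rightarrow> ('a \<Rightarrow> riemann_sphere) \<Rightarrow> bool" where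
  "meromorphic_function \<A> G \<longleftrightarrow>
     (\<forall>(U, \<phi>)\<in>\<A>. in_chart G (U, \<phi>) nicely_meromorphic_on (\<phi> ` U) \<and>
        (\<forall>p\<in>U. G p = Infty \<longleftrightarrow> is_pole (in_chart G (U, \<phi>)) (\<phi> p)))"

text \<open>A holomorphic map from a connected surface to the sphere is a meromorphic function or the
  constant \<open>Infty\<close>.\<close>

definition holomorphic_sphere_map :: "('a::t2_space) chart set \<Rightarrow> ('a \<Rightarrow> riemann_sphere) \<Rightarrow> bool" where
  "holomorphic_sphere_map \<A> G \<longleftrightarrow> meromorphic_function \<A> G \<or> (\<forall>p. G p = Infty)"


section \<open>Meromorphic 1-forms\<close>

text \<open>A 1-form is given by its coefficients \<open>f\<close> in the expressions \<open>f dz\<close>, one for each chart with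
  coordinate \<open>z\<close>.  The coefficient is a function of the coordinate.\<close>

type_synonym 'a one_form = "'a chart \<Rightarrow> complex \<Rightarrow> complex"

definition meromorphic_form :: "('a::t2_space) chart set \<Rightarrow> 'a one_form \<Rightarrow> bool" where
  "meromorphic_form \<A> \<eta> \<longleftrightarrow>
     (\<forall>(U, \<phi>)\<in>\<A>. \<eta> (U, \<phi>) nicely_meromorphic_on (\<phi> ` U)) \<and>
     (\<forall>(U, \<phi>)\<in>\<A>. \<forall>(V, \<psi>)\<in>\<A>. \<forall>p\<in>U \<inter> V.
        \<eta> (U, \<phi>) (\<phi> p) = \<eta> (V, \<psi>) (\<psi> p) * deriv (\<psi> \<circ> inv_into U \<phi>) (\<phi> p))"

definition form_pole :: "('a::t2_space) chart set \<Rightarrow> 'a one_form \<Rightarrow> 'a \<Rightarrow> bool" where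
  "form_pole \<A> \<eta> p \<longleftrightarrow> (\<exists>(U, \<phi>)\<in>\<A>. p \<in> U \<and> is_pole (\<eta> (U, \<phi>)) (\<phi> p))"

text \<open>The library's \<open>zorder\<close> is negative at poles.\<close>

definition only_simple_poles :: "('a::t2_space) chart set \<Rightarrow> 'a one_form \<Rightarrow> bool" where
  "only_simple_poles \<A> \<eta> \<longleftrightarrow>
     (\<forall>(U, \<phi>)\<in>\<A>. \<forall>p\<in>U. is_pole (\<eta> (U, \<phi>)) (\<phi> p) \<longrightarrow> zorder (\<eta> (U, \<phi>)) (\<phi> p) = -1)"

definition differential :: "('a \<Rightarrow> riemann_sphere) \<Rightarrow> 'a one_form" where
  "differential G = (\<lambda>ch. remove_sings (deriv (in_chart G ch)))"

text \<open>The form \<open>dG / (G - G\<^sub>*)\<close>; its removable singularities are filled in, so that only its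
  genuine poles count as poles.\<close>

definition gauss_form :: "('a \<Rightarrow> riemann_sphere) \<Rightarrow> ('a \<Rightarrow> riemann_sphere) \<Rightarrow> 'a one_form" where
  "gauss_form G Gs = (\<lambda>ch. remove_sings
     (\<lambda>z. differential G ch z / (in_chart G ch z - in_chart Gs ch z)))"


section \<open>Integration along piecewise continuously differentiable paths\<close>

definition surface_path :: "('a::t2_space) chart set \<Rightarrow> (real \<Rightarrow> 'a) \<Rightarrow> bool" where
  "surface_path \<A> \<gamma> \<longleftrightarrow> path \<gamma> \<and>
     (\<exists>S. finite S \<and>
        (\<forall>(U, \<phi>)\<in>\<A>. (\<phi> \<circ> \<gamma>) C1_differentiable_on {t \<in> {0..1} - S. \<gamma> t \<in> U}))"

definition pole_free_path :: "('a::t2_space) chart set \<Rightarrow> 'a one_form \<Rightarrow> (real \<Rightarrow> 'a) \<Rightarrow> bool" where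
  "pole_free_path \<A> \<eta> \<gamma> \<longleftrightarrow> surface_path \<A> \<gamma> \<and> (\<forall>p\<in>path_image \<gamma>. \<not> form_pole \<A> \<eta> p)"

text \<open>The integral of the pullback \<open>g dt\<close> of the form, where \<open>g\<close> has to agree with the expression
  of the pullback in every chart around \<open>\<gamma> t\<close>, with finitely many \<open>t\<close> excepted.\<close>

definition has_form_integral ::
    "('a::t2_space) chart set \<Rightarrow> 'a one_form \<Rightarrow> (real \<Rightarrow> 'a) \<Rightarrow> complex \<Rightarrow> bool" where
  "has_form_integral \<A> \<eta> \<gamma> I \<longleftrightarrow>
     (\<exists>g S. (g has_integral I) {0..1} \<and> finite S \<and>
        (\<forall>t\<in>{0..1} - S. \<forall>(U, \<phi>)\<in>\<A>. \<gamma> t \<in> U \<longrightarrow>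
           g t = \<eta> (U, \<phi>) (\<phi> (\<gamma> t)) * vector_derivative (\<phi> \<circ> \<gamma>) (at t)))"

definition periods_in_pi_i_Z :: "('a::t2_space) chart set \<Rightarrow> 'a one_form \<Rightarrow> bool" where
  "periods_in_pi_i_Z \<A> \<eta> \<longleftrightarrow>
     (\<forall>\<gamma>. pole_free_path \<A> \<eta> \<gamma> \<and> pathfinish \<gamma> = pathstart \<gamma> \<longrightarrow>
        (\<exists>k::int. has_form_integral \<A> \<eta> \<gamma> (of_int k * (of_real pi * \<i>))))"

text \<open>All values at \<open>p\<close> of the possibly multi-valued function \<open>c exp \<integral> \<eta>\<close>, where the integral runs
  from \<open>z0\<close> to \<open>p\<close>; there is none if \<open>p\<close> is a pole of \<open>\<eta>\<close>.\<close>

definition xi_values ::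
    "('a::t2_space) chart set \<Rightarrow> 'a one_form \<Rightarrow> complex \<Rightarrow> 'a \<Rightarrow> 'a \<Rightarrow> complex set" where
  "xi_values \<A> \<eta> c z0 p =
     {c * exp I |I \<gamma>. pole_free_path \<A> \<eta> \<gamma> \<and> pathstart \<gamma> = z0 \<and> pathfinish \<gamma> = p \<and>
        has_form_integral \<A> \<eta> \<gamma> I}"


section \<open>Meromorphic maps into PSL(2,C)\<close>

type_synonym matrix2 = "complex^2^2"

definition mat22 :: "complex \<Rightarrow> complex \<Rightarrow> complex \<Rightarrow> complex \<Rightarrow> matrix2" where
  "mat22 a b c d = vector [vector [a, b], vector [c, d]]"

definition pm_class :: "matrix2 \<Rightarrow> matrix2 set" where
  "pm_class X = {X, - X}"

definition PSL2 :: "matrix2 set set" where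
  "PSL2 = pm_class ` {X. det X = 1}"

text \<open>Maps into PSL(2,C) are identified when they agree off a closed discrete set (the filter
  \<open>cosparse UNIV\<close>), as is usual for meromorphic objects.  Their values at such
  exceptional points are irrelevant for all notions below.\<close>

definition meromorphic_PSL2 :: "('a::t2_space) chart set \<Rightarrow> ('a \<Rightarrow> matrix2 set) \<Rightarrow> bool" where
  "meromorphic_PSL2 \<A> E \<longleftrightarrow>
     (\<exists>h a b c d. meromorphic_function \<A> h \<and>
        meromorphic_function \<A> a \<and> meromorphic_function \<A> b \<and>
        meromorphic_function \<A> c \<and> meromorphic_function \<A> d \<and>
        (\<forall>\<^sub>\<approx>p. E p \<in> PSL2 \<and>
           (\<exists>s. s^2 = finite_part (h p) \<and>
              E p = pm_class (mat22 (s * finite_part (a p)) (s * finite_part (b p))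
                                    (s * finite_part (c p)) (s * finite_part (d p))))))"

definition constant_PSL2 :: "(('a::t2_space) \<Rightarrow> matrix2 set) \<Rightarrow> bool" where
  "constant_PSL2 E \<longleftrightarrow> (\<exists>P. \<forall>\<^sub>\<approx>p. E p = P)"

text \<open>\<open>X\<close> is a holomorphic lift of \<open>E\<close> to SL(2,C) on the open subset \<open>W\<close> of the chart image.
  Since SL(2,C) is a holomorphic double covering of PSL(2,C), a map into PSL(2,C) is holomorphic
  iff it has such lifts locally.\<close>

definition holomorphic_lift ::
    "('a \<Rightarrow> matrix2 set) \<Rightarrow> 'a chart \<Rightarrow> complex set \<Rightarrow> (complex \<Rightarrow> matrix2) \<Rightarrow> bool" where
  "holomorphic_lift E = (\<lambda>(U, \<phi>) W X.
     open W \<and> W \<subseteq> \<phi> ` U \<and>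
     (\<forall>i j. (\<lambda>z. X z $ i $ j) holomorphic_on W) \<and>
     (\<forall>z\<in>W. det (X z) = 1 \<and> E (inv_into U \<phi> z) = pm_class (X z)))"

definition holomorphic_at_PSL2 :: "('a::t2_space) chart set \<Rightarrow> ('a \<Rightarrow> matrix2 set) \<Rightarrow> 'a \<Rightarrow> bool" where
  "holomorphic_at_PSL2 \<A> E p \<longleftrightarrow>
     (\<exists>(U, \<phi>)\<in>\<A>. p \<in> U \<and>
        (\<exists>P W X. \<phi> p \<in> W \<and> holomorphic_lift (E(p := P)) (U, \<phi>) W X))"

definition pole_PSL2 :: "('a::t2_space) chart set \<Rightarrow> ('a \<Rightarrow> matrix2 set) \<Rightarrow> 'a \<Rightarrow> bool" where
  "pole_PSL2 \<A> E p \<longleftrightarrow> \<not> holomorphic_at_PSL2 \<A> E p"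


section \<open>Legendrian curves\<close>

definition matrix_deriv :: "(complex \<Rightarrow> matrix2) \<Rightarrow> complex \<Rightarrow> matrix2" where
  "matrix_deriv X z = (\<chi> i j. deriv (\<lambda>w. X w $ i $ j) z)"

text \<open>The equation \<open>D dA - B dC = 0\<close> does not depend on the sign of the lift.\<close>

definition legendrian :: "('a::t2_space) chart set \<Rightarrow> ('a \<Rightarrow> matrix2 set) \<Rightarrow> bool" where
  "legendrian \<A> E \<longleftrightarrow> meromorphic_PSL2 \<A> E \<and>
     (\<forall>ch\<in>\<A>. \<forall>W X. holomorphic_lift E ch W X \<longrightarrow>
        (\<forall>z\<in>W. X z $ 2 $ 2 * matrix_deriv X z $ 1 $ 1 - X z $ 1 $ 2 * matrix_deriv X z $ 2 $ 1 = 0))"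

definition hyperbolic_gauss_maps ::
    "('a::t2_space) chart set \<Rightarrow> ('a \<Rightarrow> matrix2 set) \<Rightarrow> ('a \<Rightarrow> riemann_sphere) \<Rightarrow>
       ('a \<Rightarrow> riemann_sphere) \<Rightarrow> bool" where
  "hyperbolic_gauss_maps \<A> E G Gs \<longleftrightarrow>
     holomorphic_sphere_map \<A> G \<and> holomorphic_sphere_map \<A> Gs \<and>
     (\<forall>\<^sub>\<approx>p. \<forall>X\<in>E p. G p = sphere_quotient (X $ 1 $ 1) (X $ 2 $ 1) \<and>
                      Gs p = sphere_quotient (X $ 1 $ 2) (X $ 2 $ 2))"

definition canonical_form :: "('a::t2_space) chart set \<Rightarrow> ('a \<Rightarrow> matrix2 set) \<Rightarrow> 'a one_form \<Rightarrow> bool" where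
  "canonical_form \<A> E \<omega> \<longleftrightarrow> meromorphic_form \<A> \<omega> \<and>
     (\<exists>\<theta>. meromorphic_form \<A> \<theta> \<and>
        (\<forall>ch\<in>\<A>. \<forall>W X. holomorphic_lift E ch W X \<longrightarrow>
           (\<forall>z\<in>W. matrix_inv (X z) ** matrix_deriv X z = mat22 0 (\<theta> ch z) (\<omega> ch z) 0)))"


section \<open>The representation formula\<close>

definition representation_matrix :: "complex \<Rightarrow> complex \<Rightarrow> complex \<Rightarrow> matrix2" where
  "representation_matrix g gs x = mat22 (g / x) (x * gs / (g - gs)) (1 / x) (x / (g - gs))"

text \<open>All values of the multi-valued \<open>\<xi>\<close> are used, so a value of this map is in \<open>PSL2\<close> only
  if the matrices for the different values of \<open>\<xi>\<close> agree up to sign.\<close>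

definition representation_curve ::
    "('a::t2_space) chart set \<Rightarrow> ('a \<Rightarrow> riemann_sphere) \<Rightarrow> ('a \<Rightarrow> riemann_sphere) \<Rightarrow>
       complex \<Rightarrow> 'a \<Rightarrow> 'a \<Rightarrow> matrix2 set" where
  "representation_curve \<A> G Gs c z0 p =
     (\<Union>x\<in>xi_values \<A> (gauss_form G Gs) c z0 p.
        pm_class (representation_matrix (finite_part (G p)) (finite_part (Gs p)) x))"

end

theory Submission
  imports Defs
begin

text \<open>
  Let \<open>\<eta> = dG / (G - G\<^sub>*)\<close>.  Both directions rest on a single-valued meromorphic function \<open>v\<close> with
  \<open>dv = 2 \<eta> v\<close>, a square of \<open>\<xi>\<close>.  The entries of \<open>E\<close> satisfy \<open>A = G C\<close>, \<open>B = G\<^sub>* D\<close>,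
  \<open>C\<^sup>2 v = 1\<close> and \<open>C D (G - G\<^sub>*) = 1\<close>, none of which depends on the sign of the lift, and given
  the first two, \<open>D dA - B dC = D (C dG + (G - G\<^sub>*) dC)\<close>, so the Legendrian condition says exactly that
  \<open>dC = - \<eta> C\<close>.

  If \<open>\<xi>\<close> is given, the periods in \<open>\<pi> \<i> \<int>\<close> make \<open>v = \<xi>\<^sup>2\<close> single-valued, and the period of a small circle
  shows that the residues of \<open>\<eta>\<close> are half-integers, so that \<open>v\<close> is meromorphic at the simple poles of \<open>\<eta>\<close>.
  If \<open>E\<close> is given, then \<open>v = 1 / C\<^sup>2\<close> is meromorphic, and \<open>2 \<eta>\<close> is its logarithmic derivative; so \<open>\<eta>\<close>
  has only simple poles, and a continuous logarithm of \<open>v\<close> along a loop computes the period.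

  At a point where \<open>G = G\<^sub>*\<close> a holomorphic lift is excluded by \<open>C D (G - G\<^sub>*) = 1\<close>, or, if the common
  value is infinite, by \<open>C = A / G\<close> and \<open>D = B / G\<^sub>*\<close>, which would force the determinant to vanish.  Where
  \<open>G \<noteq> G\<^sub>*\<close> a lift is built from \<open>\<xi>\<close>, or, if \<open>G = \<infinity>\<close>, from \<open>\<xi> / G\<close>, whose logarithmic derivative is
  holomorphic there.
\<close>

section \<open>Logarithmic derivatives\<close>

text \<open>The function xi is determined only up to sign along loops, so a branch is chosen only
  locally, where a lift is wanted. The other obstacle is the exceptional points: finite parts carry
  the default 0 at poles, quotients are meaningless where \<open>G\<close> and \<open>Gs\<close>
  agree, and a curve is specified only off a discrete set. Computations are therefore made in
  punctured neighbourhoods, with the filter \<open>at p\<close>, and carried to the centre by the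
  fact that a nicely meromorphic function is determined by its germ off the point. Differentiating a
  relation needs a full neighbourhood; a relation that holds off \<open>p\<close> provides one at
  every nearby point, which is the reason for the lemma below. The passage from xi to xi/G at a pole
  of \<open>G\<close> with \<open>Gs\<close> finite has this origin: if the pole has order m, then
  \<eta> has residue -m, xi grows like G, and the quotient is a unit. At points where
  \<open>G\<close> is finite and different from \<open>Gs\<close>, the form \<eta> is regular and xi
  needs no correction.\<close>

lemma eventually_at_eventually_nhds:
  fixes z :: "'a::t1_space"
  assumes "eventually P (at z)"
  shows "\<forall>\<^sub>F w in at z. eventually P (nhds w)"
proof -
  obtain S where S: "open S" "z \<in> S" "\<And>x. x \<in> S \<Longrightarrow> x \<noteq> z \<Longrightarrow> P x"
    using assms by (auto simp: eventually_at_topological)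
  have "eventually P (nhds w)" if "w \<in> S" "w \<noteq> z" for w
    using S that by (auto simp: eventually_nhds intro!: exI[of _ "S - {z}"])
  with S show ?thesis
    by (auto simp: eventually_at_topological)
qed

lemma holomorphic_onI_analytic_at:
  "(\<And>z. z \<in> S \<Longrightarrow> f analytic_on {z}) \<Longrightarrow> f holomorphic_on S"
  using analytic_imp_holomorphic analytic_on_analytic_at by blast

lemma nicely_meromorphic_on_remove_sings_eq:
  assumes "f nicely_meromorphic_on A" "z \<in> A"
  shows "remove_sings f z = f z"
  using assms unfolding nicely_meromorphic_on_def by (metis remove_sings_at_pole remove_sings_eqI)

text \<open>Carries identities from a punctured neighbourhood to its centre: the value of a nicely
  meromorphic function there is its limit or, at a pole, the default 0.\<close>

lemma nicely_meromorphic_eqI: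
  assumes "f nicely_meromorphic_on A" "g nicely_meromorphic_on B" "z \<in> A" "z \<in> B"
    and "\<forall>\<^sub>F w in at z. f w = g w"
  shows "f z = g z"
  using nicely_meromorphic_on_remove_sings_eq[OF assms(1,3)]
    nicely_meromorphic_on_remove_sings_eq[OF assms(2,4)] remove_sings_cong[OF assms(5) refl]
  by metis

lemma eventually_remove_sings_eq_meromorphic:
  assumes "f meromorphic_on A" "z \<in> A"
  shows "\<forall>\<^sub>F w in at z. remove_sings f w = f w"
  using assms by (intro eventually_remove_sings_eq_at) (auto simp: meromorphic_on_altdef)

lemma meromorphic_on_imp_eventually_analytic:
  assumes "f meromorphic_on A" "z \<in> A"
  shows "\<forall>\<^sub>F w in at z. f analytic_on {w}"
  using meromorphic_on_imp_analytic_cosparse[OF assms(1)] eventually_cosparse_imp_eventually_at assms(2)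
  by blast

lemma meromorphic_on_eventually_zero_or_nonzero:
  assumes "f meromorphic_on A" "z \<in> A"
  shows "(\<forall>\<^sub>F w in at z. f w = 0) \<or> (\<forall>\<^sub>F w in at z. f w \<noteq> 0)"
  using assms not_essential_frequently_0_imp_eventually_0[of f z]
  by (auto simp: meromorphic_on_altdef frequently_def)

text \<open>The power is kept as a common factor so that it can be cancelled against the same factor
  of \<open>f\<close> when the logarithmic derivative is read off.\<close>

lemma deriv_mult_powi:
  fixes g :: "complex \<Rightarrow> complex"
  assumes "(g has_field_derivative g') (at w)" "w \<noteq> z"
    "\<forall>\<^sub>F x in nhds w. f x = g x * (x - z) powi n"
  shows "(f has_field_derivative (g' + g w * of_int n / (w - z)) * (w - z) powi n) (at w)"
proof -
  have "((\<lambda>x. g x * (x - z) powi n) has_field_derivative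
          (g' + g w * of_int n / (w - z)) * (w - z) powi n) (at w)"
    using assms(2)
    by (auto intro!: derivative_eq_intros assms(1) simp: field_simps power_int_diff)
  thus ?thesis
    using assms(3) by (subst DERIV_cong_ev[OF refl _ refl])
qed

text \<open>Writing \<open>f\<close> as \<open>g w * (w - z) powi n\<close> with
  \<open>g z \<noteq> 0\<close> gives \<eta> = g'/(2g) + n/(2(w - z)). So \<open>\<eta>\<close> has
  a simple pole or, for n = 0, none at all, and then \<open>g\<close> is the wanted unit. The factor
  2 appears because \<open>f\<close> stands for the square of xi.\<close>

lemma logarithmic_derivative_at:
  assumes f: "f meromorphic_on {z}" and nz: "\<forall>\<^sub>F w in at z. f w \<noteq> 0"
    and eq: "\<forall>\<^sub>F w in at z. deriv f w = 2 * \<eta> w * f w"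
  shows "is_pole \<eta> z \<Longrightarrow> zorder \<eta> z = -1"
    and "\<not> is_pole \<eta> z \<Longrightarrow> \<exists>g. g analytic_on {z} \<and> g z \<noteq> 0 \<and> (\<forall>\<^sub>F w in at z. f w = g w)"
proof -
  define n where "n = zorder f z"
  define g where "g = zor_poly f z"
  have "isolated_singularity_at f z" "not_essential f z" "\<exists>\<^sub>F w in at z. f w \<noteq> 0"
    using f nz by (auto simp: meromorphic_on_altdef intro!: eventually_frequently)
  from zorder_exist[OF this, folded n_def g_def] obtain r where g0: "g z \<noteq> 0" and r: "r > 0"
    "g holomorphic_on cball z r"
    and fg: "\<And>w. w \<in> cball z r - {z} \<Longrightarrow> f w = g w * (w - z) powi n \<and> g w \<noteq> 0"
    by blast
  have ghol: "g holomorphic_on ball z r"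
    using r(2) by (rule holomorphic_on_subset) auto
  obtain e where e: "e > 0" "e \<le> r" "\<And>w. w \<in> ball z e - {z} \<Longrightarrow> deriv f w = 2 * \<eta> w * f w"
  proof -
    obtain d where "d > 0" "\<And>w. w \<noteq> z \<Longrightarrow> dist w z < d \<Longrightarrow> deriv f w = 2 * \<eta> w * f w"
      using eq by (auto simp: eventually_at)
    thus ?thesis
      using r by (intro that[of "min d r"]) (auto simp: dist_commute)
  qed
  have eta: "\<eta> w = deriv g w / (2 * g w) + of_int n / (2 * (w - z))" if w: "w \<in> ball z e - {z}" for w
  proof -
    have "w \<in> ball z r" "w \<noteq> z" using w e by auto
    have "(g has_field_derivative deriv g w) (at w)"
      using ghol \<open>w \<in> ball z r\<close> by (auto intro: holomorphic_derivI)
    moreover have "\<forall>\<^sub>F x in nhds w. f x = g x * (x - z) powi n"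
    proof (rule eventually_mono)
      show "\<forall>\<^sub>F x in nhds w. x \<in> ball z r - {z}"
        using w e by (intro eventually_nhds_in_open) auto
    qed (use fg in auto)
    ultimately have "deriv f w = (deriv g w + g w * of_int n / (w - z)) * (w - z) powi n"
      using w by (intro DERIV_imp_deriv deriv_mult_powi) auto
    moreover have "f w = g w * (w - z) powi n" "g w \<noteq> 0"
      using fg[of w] w e(2) by auto
    ultimately have "2 * \<eta> w * g w * (w - z) powi n =
        (deriv g w + g w * of_int n / (w - z)) * (w - z) powi n"
      using e(3)[OF w] by (simp only: mult.assoc)
    moreover have "(w - z) powi n \<noteq> 0"
      using \<open>w \<noteq> z\<close> by simp
    ultimately have "2 * \<eta> w * g w = deriv g w + g w * of_int n / (w - z)"
      by (metis mult_right_cancel)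
    hence "2 * \<eta> w * g w / (2 * g w) = (deriv g w + g w * of_int n / (w - z)) / (2 * g w)"
      by simp
    thus ?thesis
      using \<open>g w \<noteq> 0\<close> by (simp add: add_divide_distrib)
  qed
  have ev: "\<forall>\<^sub>F w in at z. w \<in> ball z e - {z}"
    using e(1) by (intro eventually_at_in_open) auto
  have gnz: "g w \<noteq> 0" if "w \<in> ball z e" for w
    using g0 fg[of w] that e(2) by (cases "w = z") auto
  have holg: "g holomorphic_on ball z e" "deriv g holomorphic_on ball z e"
    using ghol e(2) by (auto intro!: holomorphic_deriv intro: holomorphic_on_subset)
  have simple: "is_pole \<eta> z \<and> zorder \<eta> z = -1" if "n \<noteq> 0"
  proof -
    \<comment> \<open>\<open>K\<close> is (w - z) times \<open>\<eta>\<close>, extended over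
      \<open>z\<close>; its value n/2 there is the residue.\<close>
    define K where "K = (\<lambda>w. deriv g w / (2 * g w) * (w - z) + of_int n / 2)"
    have "zorder \<eta> z = -1"
    proof (rule zorder_eqI[of "ball z e" z K])
      show "K holomorphic_on ball z e"
        unfolding K_def using holg gnz by (auto intro!: holomorphic_intros)
      show "K z \<noteq> 0" using that by (simp add: K_def)
      show "\<eta> w = K w * (w - z) powi -1" if "w \<in> ball z e" "w \<noteq> z" for w
        using that eta[of w] by (simp add: K_def field_simps power_int_minus)
    qed (use e in auto)
    moreover have "is_pole \<eta> z"
    proof -
      have "is_pole (\<lambda>w. K w / (w - z)) z"
      proof (rule is_pole_divide)
        have "K holomorphic_on ball z e"
          unfolding K_def using holg gnz by (auto intro!: holomorphic_intros)
        thus "isCont K z"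
          using e(1) by (metis analytic_at_imp_isCont centre_in_ball holomorphic_on_imp_analytic_at open_ball)
        show "filterlim (\<lambda>w. w - z) (at 0) (at z)"
          by (intro filterlim_atI tendsto_eq_intros) (auto simp: eventually_at intro!: exI[of _ 1])
        show "K z \<noteq> 0" using that by (simp add: K_def)
      qed
      moreover have "\<forall>\<^sub>F w in at z. K w / (w - z) = \<eta> w"
        using ev by eventually_elim (use eta in \<open>auto simp: K_def field_simps\<close>)
      ultimately show ?thesis by (rule is_pole_transform) auto
    qed
    ultimately show ?thesis by blast
  qed
  show "is_pole \<eta> z \<Longrightarrow> zorder \<eta> z = -1"
  proof (cases "n = 0")
    \<comment> \<open>For n = 0 the coefficient has a finite limit at \<open>z\<close>, which
      contradicts the pole assumed further down.\<close>
    case True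
    have "isCont (\<lambda>w. deriv g w / (2 * g w)) z"
    proof -
      have "(\<lambda>w. deriv g w / (2 * g w)) holomorphic_on ball z e"
        using holg gnz by (auto intro!: holomorphic_intros)
      thus ?thesis
        using e(1) by (metis analytic_at_imp_isCont centre_in_ball holomorphic_on_imp_analytic_at open_ball)
    qed
    moreover have "\<forall>\<^sub>F w in at z. deriv g w / (2 * g w) = \<eta> w"
      using ev by eventually_elim (use eta True in auto)
    ultimately have "\<eta> \<midarrow>z\<rightarrow> deriv g z / (2 * g z)"
      unfolding isCont_def by (rule Lim_transform_eventually)
    moreover assume "is_pole \<eta> z"
    ultimately show ?thesis
      unfolding is_pole_def using not_tendsto_and_filterlim_at_infinity at_neq_bot by blast
  qed (use simple in blast)
  assume "\<not> is_pole \<eta> z"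
  hence "n = 0" using simple by blast
  moreover have "g analytic_on {z}"
    using holg(1) e(1) by (intro holomorphic_on_imp_analytic_at[of g "ball z e"]) auto
  moreover have "\<forall>\<^sub>F w in at z. f w = g w"
    using ev by eventually_elim (use \<open>n = 0\<close> fg e(2) in auto)
  ultimately show "\<exists>g. g analytic_on {z} \<and> g z \<noteq> 0 \<and> (\<forall>\<^sub>F w in at z. f w = g w)"
    using g0 by blast
qed

text \<open>The equation f' = 2 \<eta> f has a regular singular point at \<open>z\<close>. Splitting
  off the principal part (k/2)/(w - z) of \<open>\<eta>\<close> leaves a holomorphic coefficient
  with primitive \<open>H\<close>, and \<open>f\<close> must be a constant times
  \<open>(w - z) powi k * exp (2 * H w)\<close>. Integrality of \<open>k\<close> makes the power
  meromorphic.\<close>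

lemma meromorphic_at_if_half_integer_residue:
  assumes r: "r > 0"
    and f: "\<And>w. w \<in> ball z r - {z} \<Longrightarrow> (f has_field_derivative 2 * \<eta> w * f w) (at w)"
    and eta: "\<eta> meromorphic_on {z}" "is_pole \<eta> z" "zorder \<eta> z = -1"
    and res: "2 * residue \<eta> z = of_int k"
  shows "f meromorphic_on {z}"
proof -
  define g where "g = zor_poly \<eta> z"
  have iso: "isolated_singularity_at \<eta> z" "not_essential \<eta> z"
    using eta(1) by (auto simp: meromorphic_on_altdef)
  have "\<exists>\<^sub>F w in at z. \<eta> w \<noteq> 0"
    using non_zero_neighbour_pole[OF eta(2)] by (intro eventually_frequently) auto
  from zorder_exist[OF iso this, folded g_def] eta(3) obtain e0 where g0: "g z \<noteq> 0" "e0 > 0"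
    "g holomorphic_on cball z e0" "\<And>w. w \<in> cball z e0 - {z} \<Longrightarrow> \<eta> w = g w * (w - z) powi -1"
    by auto
  define e where "e = min e0 r"
  have e: "e > 0" "e \<le> r" "g holomorphic_on ball z e" 
    "\<And>w. w \<in> ball z e - {z} \<Longrightarrow> \<eta> w = g w / (w - z)"
    using g0 r by (auto simp: e_def power_int_minus divide_inverse intro: holomorphic_on_subset)
  have gz: "2 * g z = of_int k"
    using res residue_simple_pole[OF iso(1) eta(2,3)] by (simp add: g_def)
  \<comment> \<open>The regular part of \<open>\<eta>\<close>: what remains after subtracting the
    residue \<open>g z\<close> in the numerator, with its limit \<open>deriv g z\<close> as value at
    the centre.\<close>
  define h where "h = (\<lambda>w. if w = z then deriv g z else (g w - g z) / (w - z))"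
  have "h holomorphic_on ball z e"
    unfolding h_def using e by (intro pole_lemma) auto
  then obtain H where H: "\<And>w. w \<in> ball z e \<Longrightarrow> (H has_field_derivative h w) (at w)"
    using holomorphic_convex_primitive'[of "ball z e" h]
    by (metis at_within_open convex_ball open_ball)
  \<comment> \<open>\<open>f\<close> divided by the expected solution; it has to be constant on the
    punctured disc, which is connected.\<close>
  define q where "q = (\<lambda>w. f w * (w - z) powi (-k) * exp (-2 * H w))"
  have dq: "(q has_field_derivative 0) (at w)" if w: "w \<in> ball z e - {z}" for w
  proof -
    have wz: "w \<noteq> z" using w by auto
    have f': "(f has_field_derivative 2 * \<eta> w * f w) (at w)" using w e(2) by (intro f) auto
    have p': "((\<lambda>w. (w - z) powi (-k)) has_field_derivative of_int (-k) * (w - z) powi (-k-1)) (at w)"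
      using wz by (auto intro!: derivative_eq_intros)
    have "(q has_field_derivative
       (2 * \<eta> w * f w * (w - z) powi (-k) + of_int (-k) * (w - z) powi (-k-1) * f w) * exp (-2 * H w) +
       exp (-2 * H w) * (-2 * h w) * (f w * (w - z) powi (-k))) (at w)"
      unfolding q_def using w
      by (intro DERIV_mult[OF DERIV_mult[OF f' p']] DERIV_chain2[OF DERIV_exp] DERIV_cmult H) auto
    moreover have "(2 * \<eta> w * f w * (w - z) powi (-k) + of_int (-k) * (w - z) powi (-k-1) * f w) * exp (-2 * H w) +
       exp (-2 * H w) * (-2 * h w) * (f w * (w - z) powi (-k)) = 0"
    proof -
      have "(w - z) powi (-k-1) = (w - z) powi (-k) / (w - z)"
        using wz by (simp add: power_int_diff)
      moreover have "2 * \<eta> w - of_int k / (w - z) - 2 * h w = 0"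
        using e(4)[OF w] wz by (simp add: h_def gz[symmetric] diff_divide_distrib)
      moreover have "(2 * \<eta> w * f w * P + of_int (-k) * (P / (w - z)) * f w) * E +
           E * (-2 * h w) * (f w * P) = (2 * \<eta> w - of_int k / (w - z) - 2 * h w) * (f w * P * E)" for P E
        by (simp add: algebra_simps)
      ultimately show ?thesis by (metis mult_zero_left)
    qed
    ultimately show ?thesis by simp
  qed
  have "connected (ball z e - {z})"
    using connected_punctured_ball[of z e] by (simp add: DIM_complex) 
  moreover have "open (ball z e - {z})" by auto
  ultimately obtain c where c: "\<And>w. w \<in> ball z e - {z} \<Longrightarrow> q w = c"
    using DERIV_zero_connected_constant[of "ball z e - {z}" "{}" q] dq
      DERIV_isCont by (metis Diff_empty continuous_at_imp_continuous_on finite.emptyI)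
  have "\<forall>\<^sub>F w in at z. w \<in> ball z e - {z}"
    using e(1) by (intro eventually_at_in_open) auto
  hence "\<forall>\<^sub>F w in at z. f w = c * (w - z) powi k * exp (2 * H w)"
  proof eventually_elim
    case (elim w)
    thus ?case using c[OF elim]
      by (auto simp: q_def power_int_minus exp_minus field_simps)
  qed
  moreover have "(\<lambda>w. c * (w - z) powi k * exp (2 * H w)) meromorphic_on {z}"
  proof -
    have "H analytic_on {z}"
    proof (rule holomorphic_on_imp_analytic_at[of _ "ball z e"])
      show "H holomorphic_on ball z e"
        using H by (meson holomorphic_on_open open_ball)
    qed (use e in auto)
    hence "(\<lambda>w. exp (2 * H w)) meromorphic_on {z}"
      by (intro analytic_on_imp_meromorphic_on analytic_intros)
    thus ?thesis
      by (intro meromorphic_intros)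
  qed
  ultimately show ?thesis
    by (subst meromorphic_on_cong[where g = "\<lambda>w. c * (w - z) powi k * exp (2 * H w)" and B = "{z}"]) auto
qed

section \<open>Charts and meromorphic functions\<close>

locale surface =
  fixes \<A> :: "('a::t2_space) chart set"
  assumes riemann_surface: "riemann_surface \<A>"
begin

lemma chart_open: "(U, \<phi>) \<in> \<A> \<Longrightarrow> open U"
  and chart_open_image: "(U, \<phi>) \<in> \<A> \<Longrightarrow> open (\<phi> ` U)"
  and chart_homeomorphism: "(U, \<phi>) \<in> \<A> \<Longrightarrow> homeomorphism U (\<phi> ` U) \<phi> (inv_into U \<phi>)"
  using riemann_surface unfolding riemann_surface_def by blast+

lemma connected_surface: "connected (UNIV :: 'a set)"
  using riemann_surface unfolding riemann_surface_def by blast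

lemma obtain_chart:
  obtains U \<phi> where "(U, \<phi>) \<in> \<A>" "p \<in> U"
proof -
  have "p \<in> (\<Union>(U, \<phi>)\<in>\<A>. U)"
    using riemann_surface unfolding riemann_surface_def by simp
  thus ?thesis using that by auto
qed

lemma chart_inv: "(U, \<phi>) \<in> \<A> \<Longrightarrow> p \<in> U \<Longrightarrow> inv_into U \<phi> (\<phi> p) = p"
  using chart_homeomorphism unfolding homeomorphism_def by blast

lemma chart_inv_in: "z \<in> \<phi> ` U \<Longrightarrow> inv_into U \<phi> z \<in> U"
  by (rule inv_into_into)

lemma chart_of_inv: "z \<in> \<phi> ` U \<Longrightarrow> \<phi> (inv_into U \<phi> z) = z"
  by (rule f_inv_into_f)

lemma chart_continuous: "(U, \<phi>) \<in> \<A> \<Longrightarrow> continuous_on U \<phi>"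
  and chart_inv_continuous: "(U, \<phi>) \<in> \<A> \<Longrightarrow> continuous_on (\<phi> ` U) (inv_into U \<phi>)"
  using chart_homeomorphism unfolding homeomorphism_def by blast+

lemma chart_inj: "(U, \<phi>) \<in> \<A> \<Longrightarrow> inj_on \<phi> U"
  using chart_inv by (metis inj_onI)

lemma open_chart_image:
  assumes "(U, \<phi>) \<in> \<A>" "open S" "S \<subseteq> U"
  shows "open (\<phi> ` S)"
proof -
  have "openin (top_of_set (\<phi> ` U)) (\<phi> ` S)"
    using assms(2,3) by (intro homeomorphism_imp_open_map[OF chart_homeomorphism[OF assms(1)]])
      (auto simp: openin_open)
  thus ?thesis
    using chart_open_image[OF assms(1)] openin_open_eq by blast
qed

lemma open_chart_vimage:
  assumes "(U, \<phi>) \<in> \<A>" "open S"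
  shows "open (\<phi> -` S \<inter> U)"
  using assms chart_open chart_continuous continuous_on_open_vimage by blast

text \<open>A chart is open, continuous and injective, so it carries punctured neighbourhoods to
  punctured neighbourhoods; limits, poles and generic statements can then be moved freely between
  the surface and a coordinate.\<close>

lemma filtermap_chart:
  assumes ch: "(U, \<phi>) \<in> \<A>" "p \<in> U"
  shows "filtermap \<phi> (at p) = at (\<phi> p)"
proof (rule filter_eqI)
  fix P
  show "eventually P (filtermap \<phi> (at p)) \<longleftrightarrow> eventually P (at (\<phi> p))"
  proof
    assume "eventually P (filtermap \<phi> (at p))"
    then obtain S where S: "open S" "p \<in> S" "\<And>q. q \<in> S \<Longrightarrow> q \<noteq> p \<Longrightarrow> P (\<phi> q)"
      by (auto simp: eventually_filtermap eventually_at_topological)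
    have "open (\<phi> ` (S \<inter> U))"
      using S(1) ch chart_open by (intro open_chart_image) auto
    moreover have "\<phi> p \<in> \<phi> ` (S \<inter> U)" using S(2) ch(2) by auto
    ultimately show "eventually P (at (\<phi> p))"
      unfolding eventually_at_topological using S(3) by blast
  next
    assume "eventually P (at (\<phi> p))"
    then obtain S where S: "open S" "\<phi> p \<in> S" "\<And>w. w \<in> S \<Longrightarrow> w \<noteq> \<phi> p \<Longrightarrow> P w"
      by (auto simp: eventually_at_topological)
    have "open (\<phi> -` S \<inter> U)" "p \<in> \<phi> -` S \<inter> U"
      using open_chart_vimage[OF ch(1) S(1)] S(2) ch(2) by auto
    moreover have "P (\<phi> q)" if "q \<in> \<phi> -` S \<inter> U" "q \<noteq> p" for q
      using that S(3) ch chart_inj by (auto dest: inj_onD)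
    ultimately show "eventually P (filtermap \<phi> (at p))"
      unfolding eventually_filtermap eventually_at_topological by blast
  qed
qed

lemma eventually_in_chart: "(U, \<phi>) \<in> \<A> \<Longrightarrow> p \<in> U \<Longrightarrow> \<forall>\<^sub>F q in at p. q \<in> U"
  using chart_open eventually_at_in_open' by blast

lemma filtermap_chart_inv:
  assumes ch: "(U, \<phi>) \<in> \<A>" "p \<in> U"
  shows "filtermap (inv_into U \<phi>) (at (\<phi> p)) = at p"
proof -
  have "filtermap (inv_into U \<phi>) (at (\<phi> p)) = filtermap (inv_into U \<phi> \<circ> \<phi>) (at p)"
    by (simp add: filtermap_chart[OF ch, symmetric] filtermap_compose)
  also have "\<dots> = at p"
  proof (rule filter_eqI)
    fix P :: "'a \<Rightarrow> bool"
    have "\<forall>\<^sub>F q in at p. P ((inv_into U \<phi> \<circ> \<phi>) q) = P q"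
      using eventually_in_chart[OF ch] by eventually_elim (use chart_inv ch in simp)
    thus "eventually P (filtermap (inv_into U \<phi> \<circ> \<phi>) (at p)) = eventually P (at p)"
      unfolding eventually_filtermap by (rule eventually_cong)
  qed
  finally show ?thesis .
qed

lemma eventually_chart_inv:
  "(U, \<phi>) \<in> \<A> \<Longrightarrow> p \<in> U \<Longrightarrow>
     (\<forall>\<^sub>F z in at (\<phi> p). P (inv_into U \<phi> z)) \<longleftrightarrow> (\<forall>\<^sub>F q in at p. P q)"
  using filtermap_chart_inv[of U \<phi> p] by (metis eventually_filtermap)

lemma eventually_chart:
  "(U, \<phi>) \<in> \<A> \<Longrightarrow> p \<in> U \<Longrightarrow> (\<forall>\<^sub>F q in at p. P (\<phi> q)) \<longleftrightarrow> (\<forall>\<^sub>F z in at (\<phi> p). P z)"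
  using filtermap_chart[of U \<phi> p] by (metis eventually_filtermap)

lemma tendsto_chart_inv:
  "(U, \<phi>) \<in> \<A> \<Longrightarrow> p \<in> U \<Longrightarrow>
     filterlim (\<lambda>z. f (inv_into U \<phi> z)) F (at (\<phi> p)) \<longleftrightarrow> filterlim f F (at p)"
  by (simp add: filtermap_chart_inv[symmetric] filterlim_filtermap)

lemma eventually_in_chart_image:
  "(U, \<phi>) \<in> \<A> \<Longrightarrow> z \<in> \<phi> ` U \<Longrightarrow> \<forall>\<^sub>F w in at z. w \<in> \<phi> ` U"
  "(U, \<phi>) \<in> \<A> \<Longrightarrow> z \<in> \<phi> ` U \<Longrightarrow> \<forall>\<^sub>F w in nhds z. w \<in> \<phi> ` U"
  using chart_open_image eventually_at_in_open' eventually_nhds_in_open by blast+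

text \<open>Points of a surface are not isolated, as a chart shows; hence generic statements have
  witnesses and limits are unique.\<close>

lemma at_surface_neq_bot [simp]: "at (p :: 'a) \<noteq> bot"
proof -
  obtain U \<phi> where "(U, \<phi>) \<in> \<A>" "p \<in> U" by (rule obtain_chart)
  thus ?thesis
    using filtermap_chart[of U \<phi> p] by (metis at_neq_bot filtermap_bot)
qed

lemma eventually_cosparse_UNIV:
  "eventually P (cosparse (UNIV :: 'a set)) \<longleftrightarrow> (\<forall>p. eventually P (at p))"
  by (simp add: eventually_cosparse_open_eq)

lemma transition_holomorphic:
  "(U, \<phi>) \<in> \<A> \<Longrightarrow> (V, \<psi>) \<in> \<A> \<Longrightarrow> (\<psi> \<circ> inv_into U \<phi>) holomorphic_on \<phi> ` (U \<inter> V)"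
  using riemann_surface unfolding riemann_surface_def by blast

lemma transition_analytic:
  assumes "(U, \<phi>) \<in> \<A>" "(V, \<psi>) \<in> \<A>" "p \<in> U" "p \<in> V"
  shows "(\<psi> \<circ> inv_into U \<phi>) analytic_on {\<phi> p}"
  using transition_holomorphic[OF assms(1,2)] open_chart_image[OF assms(1), of "U \<inter> V"] assms
    chart_open by (auto intro!: holomorphic_on_imp_analytic_at[of _ "\<phi> ` (U \<inter> V)"])

lemma transition_has_derivative:
  assumes "(U, \<phi>) \<in> \<A>" "(V, \<psi>) \<in> \<A>" "p \<in> U" "p \<in> V"
  shows "((\<psi> \<circ> inv_into U \<phi>) has_field_derivative deriv (\<psi> \<circ> inv_into U \<phi>) (\<phi> p)) (at (\<phi> p))"
  using transition_analytic[OF assms] analytic_on_imp_differentiable_at DERIV_deriv_iff_field_differentiable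
  by blast

text \<open>Values at isolated points are left free here, unlike in
  \<open>meromorphic_function\<close>; this makes the notion closed under pointwise arithmetic,
  including division with its value 0 at zeros of the denominator.\<close>

definition surface_meromorphic :: "('a \<Rightarrow> complex) \<Rightarrow> bool" where
  "surface_meromorphic f \<longleftrightarrow> (\<forall>(U, \<phi>)\<in>\<A>. (\<lambda>z. f (inv_into U \<phi> z)) meromorphic_on (\<phi> ` U))"

lemma surface_meromorphicD:
  "surface_meromorphic f \<Longrightarrow> (U, \<phi>) \<in> \<A> \<Longrightarrow> (\<lambda>z. f (inv_into U \<phi> z)) meromorphic_on (\<phi> ` U)"
  by (auto simp: surface_meromorphic_def)

lemma surface_meromorphic_const: "surface_meromorphic (\<lambda>_. c)"
  and surface_meromorphic_diff:
    "surface_meromorphic f \<Longrightarrow> surface_meromorphic g \<Longrightarrow> surface_meromorphic (\<lambda>p. f p - g p)"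
  and surface_meromorphic_mult:
    "surface_meromorphic f \<Longrightarrow> surface_meromorphic g \<Longrightarrow> surface_meromorphic (\<lambda>p. f p * g p)"
  and surface_meromorphic_divide:
    "surface_meromorphic f \<Longrightarrow> surface_meromorphic g \<Longrightarrow> surface_meromorphic (\<lambda>p. f p / g p)"
  by (auto simp: surface_meromorphic_def intro!: meromorphic_intros)

text \<open>The identity theorem: \<open>Z\<close> and \<open>N\<close> cover the surface because
  zeros are locally isolated or fill a punctured neighbourhood; both sets are open, they are
  disjoint, and the surface is connected.\<close>

lemma surface_meromorphic_zero_or_nonzero:
  assumes "surface_meromorphic f"
  shows "(\<forall>p. \<forall>\<^sub>F q in at p. f q = 0) \<or> (\<forall>p. \<forall>\<^sub>F q in at p. f q \<noteq> 0)"
proof -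
  define Z where "Z = {p. \<forall>\<^sub>F q in at p. f q = 0}"
  define N where "N = {p. \<forall>\<^sub>F q in at p. f q \<noteq> 0}"
  have "p \<in> Z \<or> p \<in> N" for p
  proof -
    obtain U \<phi> where ch: "(U, \<phi>) \<in> \<A>" "p \<in> U" by (rule obtain_chart)
    show ?thesis
      using meromorphic_on_eventually_zero_or_nonzero[OF surface_meromorphicD[OF assms ch(1)], of "\<phi> p"]
        eventually_chart_inv[OF ch, of "\<lambda>q. f q = 0"] eventually_chart_inv[OF ch, of "\<lambda>q. f q \<noteq> 0"] ch(2)
      by (auto simp: Z_def N_def)
  qed
  \<comment> \<open>If \<open>P\<close> holds near \<open>p\<close> off \<open>p\<close>, it holds
    in a full neighbourhood of every nearby point different from \<open>p\<close>.\<close>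
  moreover have "open {p :: 'a. eventually P (at p)}" for P
  proof (subst open_subopen, safe)
    fix p :: 'a assume "eventually P (at p)"
    from eventually_at_eventually_nhds[OF this] obtain S where
      S: "open S" "p \<in> S" "\<And>q. q \<in> S \<Longrightarrow> q \<noteq> p \<Longrightarrow> eventually P (nhds q)"
      unfolding eventually_at_topological by blast
    have "eventually P (at q)" if "q \<in> S" for q
      using that S(3) \<open>eventually P (at p)\<close> by (cases "q = p") (auto simp: eventually_nhds_conv_at)
    thus "\<exists>T. open T \<and> p \<in> T \<and> T \<subseteq> {p. eventually P (at p)}"
      using S by blast
  qed
  hence "open Z" "open N" unfolding Z_def N_def by auto
  moreover have "Z \<inter> N = {}"
  proof -
    have "\<forall>\<^sub>F q in at p. False" if "\<forall>\<^sub>F q in at p. f q = 0" "\<forall>\<^sub>F q in at p. f q \<noteq> 0" for p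
      using that by eventually_elim auto
    thus ?thesis by (auto simp: Z_def N_def)
  qed
  ultimately have "Z = {} \<or> N = {}"
    using connected_surface unfolding connected_def by blast
  with \<open>\<And>p. p \<in> Z \<or> p \<in> N\<close> show ?thesis
    by (auto simp: Z_def N_def)
qed

section \<open>Sphere-valued meromorphic functions and their generic finite parts\<close>

lemma in_chart_eq: "in_chart G (U, \<phi>) = (\<lambda>z. finite_part (G (inv_into U \<phi> z)))"
  by (simp add: in_chart_def fun_eq_iff)

lemma meromorphic_function_finite_part:
  "meromorphic_function \<A> G \<Longrightarrow> surface_meromorphic (\<lambda>p. finite_part (G p))"
  by (auto simp: meromorphic_function_def surface_meromorphic_def in_chart_eq nicely_meromorphic_on_def)

lemma meromorphic_function_eventually_finite:
  assumes "meromorphic_function \<A> G"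
  shows "\<forall>\<^sub>F q in at p. G q \<noteq> Infty"
proof -
  obtain U \<phi> where ch: "(U, \<phi>) \<in> \<A>" "p \<in> U" by (rule obtain_chart)
  have G: "in_chart G (U, \<phi>) meromorphic_on \<phi> ` U"
    "\<And>q. q \<in> U \<Longrightarrow> G q = Infty \<longleftrightarrow> is_pole (in_chart G (U, \<phi>)) (\<phi> q)"
    using assms ch by (auto simp: meromorphic_function_def nicely_meromorphic_on_def)
  have "\<forall>\<^sub>F w in at (\<phi> p). in_chart G (U, \<phi>) analytic_on {w}"
    using meromorphic_on_imp_eventually_analytic[OF G(1)] ch by auto
  hence "\<forall>\<^sub>F q in at p. in_chart G (U, \<phi>) analytic_on {\<phi> q}"
    using eventually_chart[OF ch, of "\<lambda>w. in_chart G (U, \<phi>) analytic_on {w}"] by simp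
  thus ?thesis
    using eventually_in_chart[OF ch] by eventually_elim (use G(2) analytic_at_imp_no_pole in blast)
qed

text \<open>Both the finite part at a point and the presence of a pole are determined by the germ
  off the point, so a generic comparison of finite parts decides equality everywhere.\<close>

lemma meromorphic_function_eqI:
  assumes "meromorphic_function \<A> G" "meromorphic_function \<A> H"
    and "\<And>p. \<forall>\<^sub>F q in at p. finite_part (G q) = finite_part (H q)"
  shows "G = H"
proof
  fix p
  obtain U \<phi> where ch: "(U, \<phi>) \<in> \<A>" "p \<in> U" by (rule obtain_chart)
  have nice: "in_chart G (U, \<phi>) nicely_meromorphic_on \<phi> ` U" "in_chart H (U, \<phi>) nicely_meromorphic_on \<phi> ` U"
    and inf: "G p = Infty \<longleftrightarrow> is_pole (in_chart G (U, \<phi>)) (\<phi> p)"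
      "H p = Infty \<longleftrightarrow> is_pole (in_chart H (U, \<phi>)) (\<phi> p)"
    using assms ch by (auto simp: meromorphic_function_def)
  have ev: "\<forall>\<^sub>F w in at (\<phi> p). in_chart G (U, \<phi>) w = in_chart H (U, \<phi>) w"
    unfolding in_chart_eq using assms(3)[of p]
      eventually_chart_inv[OF ch, of "\<lambda>q. finite_part (G q) = finite_part (H q)"] by simp
  have "in_chart G (U, \<phi>) (\<phi> p) = in_chart H (U, \<phi>) (\<phi> p)"
    using nicely_meromorphic_eqI[OF nice _ _ ev] ch by auto
  hence "finite_part (G p) = finite_part (H p)"
    using chart_inv[OF ch] by (simp add: in_chart_eq)
  moreover have "G p = Infty \<longleftrightarrow> H p = Infty"
    using inf is_pole_cong[OF ev refl] by simp
  ultimately show "G p = H p"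
    by (cases "G p"; cases "H p") auto
qed

lemma meromorphic_function_neqD:
  assumes "meromorphic_function \<A> G" "meromorphic_function \<A> H" "G \<noteq> H"
  shows "\<forall>\<^sub>F q in at p. finite_part (G q) \<noteq> finite_part (H q)"
  using surface_meromorphic_zero_or_nonzero[OF surface_meromorphic_diff[OF
      meromorphic_function_finite_part[OF assms(1)] meromorphic_function_finite_part[OF assms(2)]]]
    meromorphic_function_eqI[OF assms(1,2)] assms(3) by auto

lemma meromorphic_function_const: "meromorphic_function \<A> (\<lambda>_. Fin c)"
  by (auto simp: meromorphic_function_def in_chart_eq)

text \<open>Repairs the values of a \<open>surface_meromorphic\<close> function. For such a function
  the absence of a finite limit means a pole, because essential singularities are excluded.\<close>

definition sphere_extension :: "('a \<Rightarrow> complex) \<Rightarrow> 'a \<Rightarrow> riemann_sphere" where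
  "sphere_extension f p = (if \<exists>l. (f \<longlongrightarrow> l) (at p) then Fin (Lim (at p) f) else Infty)"

lemma
  assumes "surface_meromorphic f"
  shows meromorphic_function_sphere_extension: "meromorphic_function \<A> (sphere_extension f)"
    and eventually_sphere_extension: "\<forall>\<^sub>F q in at p. finite_part (sphere_extension f q) = f q"
proof -
  have eq: "finite_part (sphere_extension f q) = remove_sings (\<lambda>z. f (inv_into U \<phi> z)) (\<phi> q)"
    and inf: "sphere_extension f q = Infty \<longleftrightarrow> is_pole (\<lambda>z. f (inv_into U \<phi> z)) (\<phi> q)"
    if ch: "(U, \<phi>) \<in> \<A>" "q \<in> U" for U \<phi> q
  proof -
    have tend: "(\<lambda>z. f (inv_into U \<phi> z)) \<midarrow>\<phi> q\<rightarrow> l \<longleftrightarrow> (f \<longlongrightarrow> l) (at q)" for l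
      by (rule tendsto_chart_inv[OF ch])
    have "not_essential (\<lambda>z. f (inv_into U \<phi> z)) (\<phi> q)"
      using surface_meromorphicD[OF assms ch(1)] ch(2) by (auto simp: meromorphic_on_altdef)
    hence "(\<exists>l. (f \<longlongrightarrow> l) (at q)) \<longleftrightarrow> \<not> is_pole (\<lambda>z. f (inv_into U \<phi> z)) (\<phi> q)"
      unfolding not_essential_def is_pole_def tend
      using not_tendsto_and_filterlim_at_infinity tend at_neq_bot by metis
    thus "sphere_extension f q = Infty \<longleftrightarrow> is_pole (\<lambda>z. f (inv_into U \<phi> z)) (\<phi> q)"
      by (auto simp: sphere_extension_def)
    show "finite_part (sphere_extension f q) = remove_sings (\<lambda>z. f (inv_into U \<phi> z)) (\<phi> q)"
    proof (cases "\<exists>l. (f \<longlongrightarrow> l) (at q)")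
      case True
      then obtain l where l: "(f \<longlongrightarrow> l) (at q)" by blast
      hence "Lim (at q) f = l" by (intro tendsto_Lim) auto
      thus ?thesis
        using l tend by (auto simp: sphere_extension_def remove_sings_eqI)
    qed (use tend in \<open>auto simp: sphere_extension_def remove_sings_def\<close>)
  qed
  have icx: "in_chart (sphere_extension f) (U, \<phi>) w = remove_sings (\<lambda>z. f (inv_into U \<phi> z)) w"
    if "(U, \<phi>) \<in> \<A>" "w \<in> \<phi> ` U" for U \<phi> w
    using eq[OF that(1) chart_inv_in[OF that(2)]] chart_of_inv[OF that(2)] by (simp add: in_chart_eq)
  show "meromorphic_function \<A> (sphere_extension f)"
    unfolding meromorphic_function_def
  proof (intro ballI, clarify, intro conjI ballI)
    fix U \<phi> assume ch: "(U, \<phi>) \<in> \<A>"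
    define F where "F = (\<lambda>z. f (inv_into U \<phi> z))"
    have F: "F meromorphic_on \<phi> ` U"
      unfolding F_def by (rule surface_meromorphicD[OF assms ch])
    have ev: "\<forall>\<^sub>F w in at z. remove_sings F w = in_chart (sphere_extension f) (U, \<phi>) w" if "z \<in> \<phi> ` U" for z
      using eventually_in_chart_image(1)[OF ch that] by eventually_elim (use icx ch in \<open>auto simp: F_def\<close>)
    show "in_chart (sphere_extension f) (U, \<phi>) nicely_meromorphic_on \<phi> ` U"
      unfolding nicely_meromorphic_on_def
    proof (intro conjI ballI)
      show "in_chart (sphere_extension f) (U, \<phi>) meromorphic_on \<phi> ` U"
        using remove_sings_meromorphic[OF F] meromorphic_on_cong[OF ev refl] by blast
      fix z assume z: "z \<in> \<phi> ` U"
      have "is_pole (remove_sings F) z \<and> remove_sings F z = 0 \<or> remove_sings F \<midarrow>z\<rightarrow> remove_sings F z"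
        using remove_sings_nicely_meromorphic[OF F] z by (auto simp: nicely_meromorphic_on_def)
      moreover have "remove_sings F z = in_chart (sphere_extension f) (U, \<phi>) z"
        using icx[OF ch z] by (simp add: F_def)
      ultimately show "is_pole (in_chart (sphere_extension f) (U, \<phi>)) z \<and> in_chart (sphere_extension f) (U, \<phi>) z = 0
          \<or> in_chart (sphere_extension f) (U, \<phi>) \<midarrow>z\<rightarrow> in_chart (sphere_extension f) (U, \<phi>) z"
        using is_pole_cong[OF ev[OF z] refl] tendsto_cong[OF ev[OF z]] by auto
    qed
    fix p assume p: "p \<in> U"
    have "is_pole (in_chart (sphere_extension f) (U, \<phi>)) (\<phi> p) \<longleftrightarrow> is_pole (remove_sings F) (\<phi> p)"
      using is_pole_cong[OF ev refl, of "\<phi> p"] p by auto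
    also have "\<dots> \<longleftrightarrow> is_pole F (\<phi> p)"
      using F p by (intro is_pole_remove_sings_iff) (auto simp: meromorphic_on_altdef)
    finally show "sphere_extension f p = Infty \<longleftrightarrow> is_pole (in_chart (sphere_extension f) (U, \<phi>)) (\<phi> p)"
      using inf[OF ch p] by (simp add: F_def)
  qed
  obtain U \<phi> where ch: "(U, \<phi>) \<in> \<A>" "p \<in> U" by (rule obtain_chart)
  have "\<forall>\<^sub>F z in at (\<phi> p). remove_sings (\<lambda>z. f (inv_into U \<phi> z)) z = f (inv_into U \<phi> z)"
    using eventually_remove_sings_eq_meromorphic[OF surface_meromorphicD[OF assms ch(1)]] ch(2) by auto
  hence "\<forall>\<^sub>F q in at p. remove_sings (\<lambda>z. f (inv_into U \<phi> z)) (\<phi> q) = f (inv_into U \<phi> (\<phi> q))"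
    by (subst eventually_chart[OF ch])
  thus "\<forall>\<^sub>F q in at p. finite_part (sphere_extension f q) = f q"
    using eventually_in_chart[OF ch]
    by eventually_elim (use eq ch chart_inv in auto)
qed

end

section \<open>Meromorphic 1-forms\<close>

context surface
begin

lemma eventually_nhds_in_overlap:
  assumes "(U, \<phi>) \<in> \<A>" "(V, \<psi>) \<in> \<A>" "p \<in> U" "p \<in> V"
  shows "\<forall>\<^sub>F z in nhds (\<phi> p). z \<in> \<phi> ` (U \<inter> V)"
  using open_chart_image[OF assms(1), of "U \<inter> V"] assms chart_open
  by (intro eventually_nhds_in_open) auto

lemma transition_deriv_inverse:
  assumes "(U, \<phi>) \<in> \<A>" "(V, \<psi>) \<in> \<A>" "p \<in> U" "p \<in> V"
  shows "deriv (\<phi> \<circ> inv_into V \<psi>) (\<psi> p) * deriv (\<psi> \<circ> inv_into U \<phi>) (\<phi> p) = 1"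
proof -
  have eq: "(\<psi> \<circ> inv_into U \<phi>) (\<phi> p) = \<psi> p"
    using chart_inv assms by simp
  have "((\<phi> \<circ> inv_into V \<psi>) \<circ> (\<psi> \<circ> inv_into U \<phi>) has_field_derivative
          deriv (\<phi> \<circ> inv_into V \<psi>) (\<psi> p) * deriv (\<psi> \<circ> inv_into U \<phi>) (\<phi> p)) (at (\<phi> p))"
    using DERIV_chain[of "\<phi> \<circ> inv_into V \<psi>", OF _ transition_has_derivative[OF assms]]
      transition_has_derivative[OF assms(2,1,4,3)] eq by simp
  moreover have "\<forall>\<^sub>F z in nhds (\<phi> p). ((\<phi> \<circ> inv_into V \<psi>) \<circ> (\<psi> \<circ> inv_into U \<phi>)) z = z"
    using eventually_nhds_in_overlap[OF assms]
    by eventually_elim (use assms chart_inv in auto)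
  ultimately have "((\<lambda>z. z) has_field_derivative
          deriv (\<phi> \<circ> inv_into V \<psi>) (\<psi> p) * deriv (\<psi> \<circ> inv_into U \<phi>) (\<phi> p)) (at (\<phi> p))"
    by (subst (asm) DERIV_cong_ev[OF refl _ refl]) auto
  thus ?thesis
    using DERIV_ident DERIV_unique by blast
qed

text \<open>A pre-form obeys the transformation law only off a discrete set; \<open>remove_sings\<close> turns it into
  a form.\<close>

definition pre_form :: "'a one_form \<Rightarrow> bool" where
  "pre_form \<zeta> \<longleftrightarrow>
     (\<forall>(U, \<phi>)\<in>\<A>. \<zeta> (U, \<phi>) meromorphic_on (\<phi> ` U)) \<and>
     (\<forall>(U, \<phi>)\<in>\<A>. \<forall>(V, \<psi>)\<in>\<A>. \<forall>p\<in>U \<inter> V. \<forall>\<^sub>F q in at p.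
        \<zeta> (U, \<phi>) (\<phi> q) = \<zeta> (V, \<psi>) (\<psi> q) * deriv (\<psi> \<circ> inv_into U \<phi>) (\<phi> q))"

lemma pre_form_meromorphic: "pre_form \<zeta> \<Longrightarrow> (U, \<phi>) \<in> \<A> \<Longrightarrow> \<zeta> (U, \<phi>) meromorphic_on (\<phi> ` U)"
  by (auto simp: pre_form_def)

lemma pre_form_transform:
  "pre_form \<zeta> \<Longrightarrow> (U, \<phi>) \<in> \<A> \<Longrightarrow> (V, \<psi>) \<in> \<A> \<Longrightarrow> p \<in> U \<Longrightarrow> p \<in> V \<Longrightarrow>
     \<forall>\<^sub>F q in at p. \<zeta> (U, \<phi>) (\<phi> q) = \<zeta> (V, \<psi>) (\<psi> q) * deriv (\<psi> \<circ> inv_into U \<phi>) (\<phi> q)"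
  unfolding pre_form_def by fast

lemma pre_formI:
  assumes "\<And>U \<phi>. (U, \<phi>) \<in> \<A> \<Longrightarrow> \<zeta> (U, \<phi>) meromorphic_on (\<phi> ` U)"
    and "\<And>U \<phi> V \<psi> p. (U, \<phi>) \<in> \<A> \<Longrightarrow> (V, \<psi>) \<in> \<A> \<Longrightarrow> p \<in> U \<Longrightarrow> p \<in> V \<Longrightarrow>
      \<forall>\<^sub>F q in at p. \<zeta> (U, \<phi>) (\<phi> q) = \<zeta> (V, \<psi>) (\<psi> q) * deriv (\<psi> \<circ> inv_into U \<phi>) (\<phi> q)"
  shows "pre_form \<zeta>"
  using assms unfolding pre_form_def by blast

lemma transition_comp_analytic:
  assumes "(U, \<phi>) \<in> \<A>" "(V, \<psi>) \<in> \<A>" "p \<in> U" "p \<in> V" "f analytic_on {\<psi> p}"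
  shows "(\<lambda>z. f ((\<psi> \<circ> inv_into U \<phi>) z)) analytic_on {\<phi> p}"
proof -
  have "f \<circ> (\<psi> \<circ> inv_into U \<phi>) analytic_on {\<phi> p}"
    using assms chart_inv[OF assms(1,3)]
    by (intro analytic_on_compose transition_analytic[OF assms(1,2)]) auto
  thus ?thesis by (simp add: o_def)
qed

lemma transition_deriv_analytic:
  assumes "(U, \<phi>) \<in> \<A>" "(V, \<psi>) \<in> \<A>" "p \<in> U" "p \<in> V"
  shows "deriv (\<psi> \<circ> inv_into U \<phi>) analytic_on {\<phi> p}"
  using transition_analytic[OF assms] by (rule analytic_deriv)

text \<open>Where one of the two coefficients has no pole, the transformed coefficient is analytic
  and the generic law extends by comparing germs. If both have poles, the law reads 0 = 0 by the
  default value at poles.\<close>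

lemma meromorphic_form_remove_sings:
  assumes "pre_form \<zeta>"
  shows "meromorphic_form \<A> (\<lambda>ch. remove_sings (\<zeta> ch))"
proof -
  have nice: "remove_sings (\<zeta> (U, \<phi>)) nicely_meromorphic_on (\<phi> ` U)" if "(U, \<phi>) \<in> \<A>" for U \<phi>
    using remove_sings_nicely_meromorphic pre_form_meromorphic[OF assms that] by blast
  have ev_rs: "\<forall>\<^sub>F q in at p. remove_sings (\<zeta> (U, \<phi>)) (\<phi> q) = \<zeta> (U, \<phi>) (\<phi> q)"
    if "(U, \<phi>) \<in> \<A>" "p \<in> U" for U \<phi> p
    using eventually_remove_sings_eq_meromorphic[OF pre_form_meromorphic[OF assms that(1)]] that
      eventually_chart[OF that, of "\<lambda>z. remove_sings (\<zeta> (U, \<phi>)) z = \<zeta> (U, \<phi>) z"] by auto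
  have law: "remove_sings (\<zeta> (U, \<phi>)) (\<phi> p) =
      remove_sings (\<zeta> (V, \<psi>)) (\<psi> p) * deriv (\<psi> \<circ> inv_into U \<phi>) (\<phi> p)"
    if ch: "(U, \<phi>) \<in> \<A>" "(V, \<psi>) \<in> \<A>" "p \<in> U" "p \<in> V"
      and np: "\<not> is_pole (remove_sings (\<zeta> (V, \<psi>))) (\<psi> p)" for U \<phi> V \<psi> p
  proof -
    define R where "R = (\<lambda>z. remove_sings (\<zeta> (V, \<psi>)) ((\<psi> \<circ> inv_into U \<phi>) z)
        * deriv (\<psi> \<circ> inv_into U \<phi>) z)"
    have "remove_sings (\<zeta> (V, \<psi>)) analytic_on {\<psi> p}"
      using nicely_meromorphic_on_imp_analytic_at[OF nice[OF ch(2)] _ np] ch by auto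
    hence "R analytic_on {\<phi> p}"
      unfolding R_def using ch
      by (intro analytic_on_mult transition_comp_analytic transition_deriv_analytic)
    hence nR: "R nicely_meromorphic_on {\<phi> p}"
      by (rule analytic_on_imp_nicely_meromorphic_on)
    have "\<forall>\<^sub>F q in at p. remove_sings (\<zeta> (U, \<phi>)) (\<phi> q) = R (\<phi> q)"
      using ev_rs[OF ch(1,3)] ev_rs[OF ch(2,4)] pre_form_transform[OF assms ch] eventually_in_chart[OF ch(1,3)]
      by eventually_elim (simp add: R_def chart_inv[OF ch(1)])
    hence "\<forall>\<^sub>F z in at (\<phi> p). remove_sings (\<zeta> (U, \<phi>)) z = R z"
      using eventually_chart[OF ch(1,3), of "\<lambda>z. remove_sings (\<zeta> (U, \<phi>)) z = R z"] by simp
    hence "remove_sings (\<zeta> (U, \<phi>)) (\<phi> p) = R (\<phi> p)"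
      using nicely_meromorphic_eqI[OF nice[OF ch(1)] nR] ch by auto
    thus ?thesis
      using chart_inv[OF ch(1,3)] by (simp add: R_def)
  qed
  have "remove_sings (\<zeta> (U, \<phi>)) (\<phi> p) =
      remove_sings (\<zeta> (V, \<psi>)) (\<psi> p) * deriv (\<psi> \<circ> inv_into U \<phi>) (\<phi> p)"
    if ch: "(U, \<phi>) \<in> \<A>" "(V, \<psi>) \<in> \<A>" "p \<in> U" "p \<in> V" for U \<phi> V \<psi> p
  proof -
    consider "\<not> is_pole (remove_sings (\<zeta> (V, \<psi>))) (\<psi> p)" | "\<not> is_pole (remove_sings (\<zeta> (U, \<phi>))) (\<phi> p)"
      | "is_pole (remove_sings (\<zeta> (V, \<psi>))) (\<psi> p)" "is_pole (remove_sings (\<zeta> (U, \<phi>))) (\<phi> p)"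
      by blast
    thus ?thesis
    proof cases
      \<comment> \<open>Only the coefficient for \<open>U\<close> is known to be regular, so the law
        is applied to the inverse transition.\<close>
      case 2
      have "remove_sings (\<zeta> (V, \<psi>)) (\<psi> p) * deriv (\<psi> \<circ> inv_into U \<phi>) (\<phi> p) =
        remove_sings (\<zeta> (U, \<phi>)) (\<phi> p) *
          (deriv (\<phi> \<circ> inv_into V \<psi>) (\<psi> p) * deriv (\<psi> \<circ> inv_into U \<phi>) (\<phi> p))"
        using law[OF ch(2,1,4,3) 2] by (simp add: mult.assoc)
      thus ?thesis
        using transition_deriv_inverse[OF ch] by simp
    next
      case 3
      have "remove_sings (\<zeta> (V, \<psi>)) (\<psi> p) = 0" "remove_sings (\<zeta> (U, \<phi>)) (\<phi> p) = 0"
        using 3 nicely_meromorphic_on_remove_sings_eq[OF nice[OF ch(1)], of "\<phi> p"]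
          nicely_meromorphic_on_remove_sings_eq[OF nice[OF ch(2)], of "\<psi> p"] ch
          remove_sings_at_pole by auto
      thus ?thesis by simp
    qed (use law ch in blast)
  qed
  with nice show ?thesis
    unfolding meromorphic_form_def by blast
qed

lemma meromorphic_form_nicely:
  "meromorphic_form \<A> \<eta> \<Longrightarrow> (U, \<phi>) \<in> \<A> \<Longrightarrow> \<eta> (U, \<phi>) nicely_meromorphic_on (\<phi> ` U)"
  by (auto simp: meromorphic_form_def)

lemma meromorphic_form_meromorphic:
  "meromorphic_form \<A> \<eta> \<Longrightarrow> (U, \<phi>) \<in> \<A> \<Longrightarrow> \<eta> (U, \<phi>) meromorphic_on (\<phi> ` U)"
  using meromorphic_form_nicely by (auto simp: nicely_meromorphic_on_def)

lemma meromorphic_form_transform: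
  "meromorphic_form \<A> \<eta> \<Longrightarrow> (U, \<phi>) \<in> \<A> \<Longrightarrow> (V, \<psi>) \<in> \<A> \<Longrightarrow> p \<in> U \<Longrightarrow> p \<in> V \<Longrightarrow>
     \<eta> (U, \<phi>) (\<phi> p) = \<eta> (V, \<psi>) (\<psi> p) * deriv (\<psi> \<circ> inv_into U \<phi>) (\<phi> p)"
  unfolding meromorphic_form_def by fast

lemma meromorphic_form_imp_pre_form:
  assumes "meromorphic_form \<A> \<eta>"
  shows "pre_form \<eta>"
proof (rule pre_formI)
  fix U \<phi> V \<psi> p assume ch: "(U, \<phi>) \<in> \<A>" "(V, \<psi>) \<in> \<A>" "p \<in> U" "p \<in> V"
  show "\<forall>\<^sub>F q in at p. \<eta> (U, \<phi>) (\<phi> q) = \<eta> (V, \<psi>) (\<psi> q) * deriv (\<psi> \<circ> inv_into U \<phi>) (\<phi> q)"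
    using eventually_in_chart[OF ch(1,3)] eventually_in_chart[OF ch(2,4)]
    by eventually_elim (use meromorphic_form_transform[OF assms ch(1,2)] in auto)
qed (use meromorphic_form_meromorphic assms in blast)

text \<open>Changing the chart composes the coefficient with a holomorphic map and multiplies it by
  an analytic derivative, which cannot create a pole. Hence any chart decides, although
  \<open>form_pole\<close> only asks for some chart.\<close>

lemma form_pole_iff:
  assumes "meromorphic_form \<A> \<eta>" "(U, \<phi>) \<in> \<A>" "p \<in> U"
  shows "form_pole \<A> \<eta> p \<longleftrightarrow> is_pole (\<eta> (U, \<phi>)) (\<phi> p)"
proof -
  have "\<not> is_pole (\<eta> (V, \<psi>)) (\<psi> p)"
    if np: "\<not> is_pole (\<eta> (U, \<phi>)) (\<phi> p)" and ch: "(V, \<psi>) \<in> \<A>" "p \<in> V" for V \<psi>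
  proof -
    have "\<eta> (U, \<phi>) analytic_on {\<phi> p}"
      using nicely_meromorphic_on_imp_analytic_at[OF meromorphic_form_nicely[OF assms(1,2)] _ np] assms
      by auto
    hence "(\<lambda>z. \<eta> (U, \<phi>) ((\<phi> \<circ> inv_into V \<psi>) z) * deriv (\<phi> \<circ> inv_into V \<psi>) z) analytic_on {\<psi> p}"
      using ch assms
      by (intro analytic_on_mult transition_comp_analytic transition_deriv_analytic)
    hence no_pole: "\<not> is_pole (\<lambda>z. \<eta> (U, \<phi>) ((\<phi> \<circ> inv_into V \<psi>) z) * deriv (\<phi> \<circ> inv_into V \<psi>) z) (\<psi> p)"
      by (rule analytic_at_imp_no_pole)
    have "\<forall>\<^sub>F z in at (\<psi> p).
        \<eta> (V, \<psi>) z = \<eta> (U, \<phi>) ((\<phi> \<circ> inv_into V \<psi>) z) * deriv (\<phi> \<circ> inv_into V \<psi>) z"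
      using eventually_nhds_in_overlap[OF ch(1) assms(2) ch(2) assms(3), THEN filter_leD[OF at_within_le_nhds]]
      by eventually_elim
        (use meromorphic_form_transform[OF assms(1) ch(1) assms(2)] chart_inv[OF ch(1)] in auto)
    from is_pole_cong[OF this refl] no_pole show ?thesis by simp
  qed
  thus ?thesis
    using assms unfolding form_pole_def by blast
qed

lemma form_analytic_at:
  assumes "meromorphic_form \<A> \<eta>" "(U, \<phi>) \<in> \<A>" "p \<in> U" "\<not> form_pole \<A> \<eta> p"
  shows "\<eta> (U, \<phi>) analytic_on {\<phi> p}"
  using nicely_meromorphic_on_imp_analytic_at[OF meromorphic_form_nicely[OF assms(1,2)]] assms
    form_pole_iff by auto

lemma eventually_not_form_pole:
  assumes "meromorphic_form \<A> \<eta>"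
  shows "\<forall>\<^sub>F q in at p. \<not> form_pole \<A> \<eta> q"
proof -
  obtain U \<phi> where ch: "(U, \<phi>) \<in> \<A>" "p \<in> U" by (rule obtain_chart)
  have "\<forall>\<^sub>F w in at (\<phi> p). \<eta> (U, \<phi>) analytic_on {w}"
    using meromorphic_on_imp_eventually_analytic[OF meromorphic_form_meromorphic[OF assms ch(1)]] ch by auto
  hence "\<forall>\<^sub>F q in at p. \<eta> (U, \<phi>) analytic_on {\<phi> q}"
    using eventually_chart[OF ch, of "\<lambda>w. \<eta> (U, \<phi>) analytic_on {w}"] by simp
  thus ?thesis
    using eventually_in_chart[OF ch]
    by eventually_elim (use form_pole_iff assms ch analytic_at_imp_no_pole in blast)
qed

lemma pole_free_punctured_disc:
  assumes \<eta>: "meromorphic_form \<A> \<eta>" and ch: "(U, \<phi>) \<in> \<A>" "p \<in> U"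
  obtains e where "e > 0" "\<And>z. z \<in> ball (\<phi> p) e - {\<phi> p} \<Longrightarrow> z \<in> \<phi> ` U \<and> \<not> form_pole \<A> \<eta> (inv_into U \<phi> z)"
proof -
  have "\<forall>\<^sub>F z in at (\<phi> p). \<not> form_pole \<A> \<eta> (inv_into U \<phi> z)"
    by (subst eventually_chart_inv[OF ch]) (rule eventually_not_form_pole[OF \<eta>])
  hence "\<forall>\<^sub>F z in at (\<phi> p). z \<in> \<phi> ` U \<and> \<not> form_pole \<A> \<eta> (inv_into U \<phi> z)"
    using eventually_in_chart_image(1)[OF ch(1) imageI[OF ch(2)]] by eventually_elim blast
  thus ?thesis
    using that by (auto simp: eventually_at dist_commute)
qed

lemma form_holomorphic_on:
  assumes "meromorphic_form \<A> \<eta>" "(U, \<phi>) \<in> \<A>"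
    and "\<And>z. z \<in> D \<Longrightarrow> z \<in> \<phi> ` U \<and> \<not> form_pole \<A> \<eta> (inv_into U \<phi> z)"
  shows "\<eta> (U, \<phi>) holomorphic_on D"
proof (rule holomorphic_onI_analytic_at)
  fix z assume "z \<in> D"
  thus "\<eta> (U, \<phi>) analytic_on {z}"
    using form_analytic_at[OF assms(1,2) chart_inv_in[of z \<phi> U]] assms(3)[of z] chart_of_inv[of z \<phi> U] by simp
qed

section \<open>Differentials of meromorphic functions and the Gauss form\<close>

lemma pre_form_deriv:
  assumes "surface_meromorphic f"
  shows "pre_form (\<lambda>(U, \<phi>). deriv (\<lambda>z. f (inv_into U \<phi> z)))"
proof (rule pre_formI)
  fix U \<phi> V \<psi> p assume ch: "(U, \<phi>) \<in> \<A>" "(V, \<psi>) \<in> \<A>" "p \<in> U" "p \<in> V"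
  define F where "F = (\<lambda>z. f (inv_into V \<psi> z))"
  have "\<forall>\<^sub>F w in at (\<psi> p). F analytic_on {w}"
    unfolding F_def
    using meromorphic_on_imp_eventually_analytic[OF surface_meromorphicD[OF assms ch(2)]] ch by auto
  hence "\<forall>\<^sub>F q in at p. F analytic_on {\<psi> q}"
    using eventually_chart[OF ch(2,4), of "\<lambda>w. F analytic_on {w}"] by simp
  thus "\<forall>\<^sub>F q in at p. (case (U, \<phi>) of (U, \<phi>) \<Rightarrow> deriv (\<lambda>z. f (inv_into U \<phi> z))) (\<phi> q) =
      (case (V, \<psi>) of (U, \<phi>) \<Rightarrow> deriv (\<lambda>z. f (inv_into U \<phi> z))) (\<psi> q) * deriv (\<psi> \<circ> inv_into U \<phi>) (\<phi> q)"
    using eventually_in_chart[OF ch(1,3)] eventually_in_chart[OF ch(2,4)]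
  proof eventually_elim
    case (elim q)
    have "(F has_field_derivative deriv F (\<psi> q)) (at (\<psi> q))"
      using elim(1) analytic_on_imp_differentiable_at DERIV_deriv_iff_field_differentiable by blast
    hence "(F \<circ> (\<psi> \<circ> inv_into U \<phi>) has_field_derivative
        deriv F (\<psi> q) * deriv (\<psi> \<circ> inv_into U \<phi>) (\<phi> q)) (at (\<phi> q))"
      using chart_inv[OF ch(1) elim(2)] elim
      by (intro DERIV_chain transition_has_derivative[OF ch(1,2)]) auto
    moreover have "\<forall>\<^sub>F z in nhds (\<phi> q). f (inv_into U \<phi> z) = (F \<circ> (\<psi> \<circ> inv_into U \<phi>)) z"
      using eventually_nhds_in_overlap[OF ch(1,2) elim(2,3)]
      by eventually_elim (auto simp: F_def chart_inv ch)
    ultimately have "((\<lambda>z. f (inv_into U \<phi> z)) has_field_derivative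
        deriv F (\<psi> q) * deriv (\<psi> \<circ> inv_into U \<phi>) (\<phi> q)) (at (\<phi> q))"
      by (subst DERIV_cong_ev[OF refl _ refl])
    thus ?case
      by (simp add: F_def DERIV_imp_deriv)
  qed
qed (auto intro!: meromorphic_intros surface_meromorphicD assms)

lemma pre_form_mult:
  assumes "surface_meromorphic f" "pre_form \<zeta>"
  shows "pre_form (\<lambda>(U, \<phi>) z. f (inv_into U \<phi> z) * \<zeta> (U, \<phi>) z)"
proof (rule pre_formI)
  fix U \<phi> V \<psi> p assume ch: "(U, \<phi>) \<in> \<A>" "(V, \<psi>) \<in> \<A>" "p \<in> U" "p \<in> V"
  show "\<forall>\<^sub>F q in at p. (case (U, \<phi>) of (U, \<phi>) \<Rightarrow> \<lambda>z. f (inv_into U \<phi> z) * \<zeta> (U, \<phi>) z) (\<phi> q) =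
      (case (V, \<psi>) of (U, \<phi>) \<Rightarrow> \<lambda>z. f (inv_into U \<phi> z) * \<zeta> (U, \<phi>) z) (\<psi> q) *
        deriv (\<psi> \<circ> inv_into U \<phi>) (\<phi> q)"
    using eventually_in_chart[OF ch(1,3)] eventually_in_chart[OF ch(2,4)] pre_form_transform[OF assms(2) ch]
    by eventually_elim (simp add: chart_inv ch)
qed (auto intro!: meromorphic_intros surface_meromorphicD[OF assms(1)] pre_form_meromorphic[OF assms(2)])

lemma eventually_remove_sings_pre_form:
  assumes "pre_form \<zeta>" "(U, \<phi>) \<in> \<A>" "p \<in> U"
  shows "\<forall>\<^sub>F z in at (\<phi> p). remove_sings (\<zeta> (U, \<phi>)) z = \<zeta> (U, \<phi>) z"
  using eventually_remove_sings_eq_meromorphic[OF pre_form_meromorphic[OF assms(1,2)]] assms(3) by auto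

lemma differential_eq: "differential G (U, \<phi>) = remove_sings (deriv (\<lambda>z. finite_part (G (inv_into U \<phi> z))))"
  by (simp add: differential_def in_chart_eq)

lemma meromorphic_form_differential:
  assumes "meromorphic_function \<A> G"
  shows "meromorphic_form \<A> (differential G)"
proof -
  have "differential G = (\<lambda>ch. remove_sings ((\<lambda>(U, \<phi>). deriv (\<lambda>z. finite_part (G (inv_into U \<phi> z)))) ch))"
    by (auto simp: fun_eq_iff differential_eq)
  thus ?thesis
    using meromorphic_form_remove_sings[OF pre_form_deriv[OF meromorphic_function_finite_part[OF assms]]]
    by simp
qed

lemma eventually_differential:
  assumes "meromorphic_function \<A> G" "(U, \<phi>) \<in> \<A>" "p \<in> U"
  shows "\<forall>\<^sub>F z in at (\<phi> p). differential G (U, \<phi>) z = deriv (\<lambda>z. finite_part (G (inv_into U \<phi> z))) z"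
  using eventually_remove_sings_pre_form[OF pre_form_deriv[OF meromorphic_function_finite_part[OF assms(1)]] assms(2,3)]
  by (simp add: differential_eq)

context
  fixes G Gs
  assumes G: "meromorphic_function \<A> G" and Gs: "meromorphic_function \<A> Gs"
begin

lemma pre_form_gauss:
  "pre_form (\<lambda>ch z. differential G ch z / (in_chart G ch z - in_chart Gs ch z))"
proof -
  have "surface_meromorphic (\<lambda>p. 1 / (finite_part (G p) - finite_part (Gs p)))"
    using G Gs by (intro surface_meromorphic_divide surface_meromorphic_const surface_meromorphic_diff
        meromorphic_function_finite_part)
  from pre_form_mult[OF this meromorphic_form_imp_pre_form[OF meromorphic_form_differential[OF G]]]
  show ?thesis
    by (simp add: in_chart_eq case_prod_unfold in_chart_def)
qed

lemma meromorphic_form_gauss: "meromorphic_form \<A> (gauss_form G Gs)"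
  unfolding gauss_form_def by (rule meromorphic_form_remove_sings[OF pre_form_gauss])

text \<open>The quotient formula is claimed generically only: at poles of \<open>G\<close> or
  \<open>Gs\<close> the finite part is the default 0, and where the finite parts agree the division
  yields 0.\<close>

lemma eventually_gauss_form:
  assumes "(U, \<phi>) \<in> \<A>" "p \<in> U"
  shows "\<forall>\<^sub>F z in at (\<phi> p). gauss_form G Gs (U, \<phi>) z =
     deriv (\<lambda>z. finite_part (G (inv_into U \<phi> z))) z /
       (finite_part (G (inv_into U \<phi> z)) - finite_part (Gs (inv_into U \<phi> z)))"
  using eventually_remove_sings_pre_form[OF pre_form_gauss assms] eventually_differential[OF G assms]
  by eventually_elim (simp add: gauss_form_def in_chart_eq)

end

end

section \<open>Paths and path integrals\<close>

text \<open>A local form of continuous differentiability: it depends on the germ of \<open>f\<close>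
  only and therefore survives changes of chart and affine reparametrisation. Continuity of the
  derivative is asked at \<open>t\<close> alone.\<close>

definition C1_at :: "(real \<Rightarrow> complex) \<Rightarrow> real \<Rightarrow> bool" where
  "C1_at f t \<longleftrightarrow> (\<exists>D. (\<forall>\<^sub>F s in nhds t. (f has_vector_derivative D s) (at s)) \<and> isCont D t)"

lemma C1_atI:
  assumes "\<forall>\<^sub>F s in nhds t. (f has_vector_derivative D s) (at s)" "isCont D t"
  shows "C1_at f t"
  using assms unfolding C1_at_def by blast

lemma C1_at_has_vector_derivative:
  "C1_at f t \<Longrightarrow> (f has_vector_derivative vector_derivative f (at t)) (at t)"
  unfolding C1_at_def using eventually_nhds_x_imp_x vector_derivative_at by metis

lemma C1_at_cong:
  assumes "\<forall>\<^sub>F s in nhds t. f s = g s"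
  shows "C1_at f t \<longleftrightarrow> C1_at g t"
proof -
  have "C1_at g t" if fg: "\<forall>\<^sub>F s in nhds t. f s = g s" and f: "C1_at f t" for f g
  proof -
    obtain D where D: "\<forall>\<^sub>F s in nhds t. (f has_vector_derivative D s) (at s)" "isCont D t"
      using f by (auto simp: C1_at_def)
    have "\<forall>\<^sub>F s in nhds t. \<forall>\<^sub>F r in nhds s. f r = g r"
      using fg by (simp add: eventually_eventually)
    hence "\<forall>\<^sub>F s in nhds t. (g has_vector_derivative D s) (at s)"
      using D(1)
    proof eventually_elim
      case (elim s)
      thus ?case
        using has_vector_derivative_cong_ev[of UNIV f g s "D s"] eventually_nhds_x_imp_x[of "\<lambda>r. f r = g r" s]
        by simp
    qed
    with D show ?thesis by (auto simp: C1_at_def)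
  qed
  with assms show ?thesis
    by (metis (mono_tags, lifting) eventually_mono)
qed

lemma vector_derivative_cong_nhds:
  fixes f g :: "real \<Rightarrow> complex"
  assumes "\<forall>\<^sub>F s in nhds t. f s = g s"
  shows "vector_derivative f (at t) = vector_derivative g (at t)"
  using assms by (intro vector_derivative_cong_eq) (auto simp: eventually_mono)

text \<open>Covers the two halves of a joined path (\<open>m\<close> = 2) and the reversed path
  (\<open>m\<close> = -1).\<close>

lemma C1_at_affine:
  assumes "C1_at f (m * t + c)"
  shows "C1_at (\<lambda>s. f (m * s + c)) t"
    and "vector_derivative (\<lambda>s. f (m * s + c)) (at t) = m *\<^sub>R vector_derivative f (at (m * t + c))"
proof -
  obtain D where D: "\<forall>\<^sub>F s in nhds (m * t + c). (f has_vector_derivative D s) (at s)" "isCont D (m * t + c)"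
    using assms by (auto simp: C1_at_def)
  have comp: "((\<lambda>s. f (m * s + c)) has_vector_derivative m *\<^sub>R d) (at s)"
    if "(f has_vector_derivative d) (at (m * s + c))" for d s
  proof -
    have "((\<lambda>s. m * s + c) has_vector_derivative m) (at s)"
      by (auto intro!: derivative_eq_intros)
    from vector_diff_chain_at[OF this that] show ?thesis by (simp add: o_def)
  qed
  have "filterlim (\<lambda>s. m * s + c) (nhds (m * t + c)) (nhds t)"
    by (rule tendsto_at_iff_tendsto_nhds[THEN iffD1]) (auto intro!: tendsto_eq_intros)
  hence "\<forall>\<^sub>F s in nhds t. (f has_vector_derivative D (m * s + c)) (at (m * s + c))"
    using D(1) by (auto simp: filterlim_iff)
  hence "\<forall>\<^sub>F s in nhds t. ((\<lambda>s. f (m * s + c)) has_vector_derivative m *\<^sub>R D (m * s + c)) (at s)"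
    by eventually_elim (rule comp)
  moreover have "isCont (\<lambda>s. m *\<^sub>R D (m * s + c)) t"
  proof (intro continuous_intros isCont_o2[of _ "\<lambda>s. m * s + c" D])
    show "isCont D (m * t + c)" by (rule D(2))
  qed
  ultimately show "C1_at (\<lambda>s. f (m * s + c)) t"
    by (rule C1_atI)
  show "vector_derivative (\<lambda>s. f (m * s + c)) (at t) = m *\<^sub>R vector_derivative f (at (m * t + c))"
    by (intro vector_derivative_at comp C1_at_has_vector_derivative assms)
qed

lemma C1_at_holomorphic:
  assumes "C1_at f t" "T analytic_on {f t}"
  shows "C1_at (T \<circ> f) t"
    and "vector_derivative (T \<circ> f) (at t) = vector_derivative f (at t) * deriv T (f t)"
proof -
  obtain D where D: "\<forall>\<^sub>F s in nhds t. (f has_vector_derivative D s) (at s)" "isCont D t"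
    using assms by (auto simp: C1_at_def)
  obtain S where S: "open S" "f t \<in> S" "T holomorphic_on S"
    using assms(2) by (auto simp: analytic_at)
  have cont: "isCont f t"
    using eventually_nhds_x_imp_x[OF D(1)] has_vector_derivative_continuous by blast
  have "\<forall>\<^sub>F s in nhds t. f s \<in> S"
    using cont S tendsto_at_iff_tendsto_nhds[of f t] unfolding isCont_def
    by (metis topological_tendstoD)
  hence "\<forall>\<^sub>F s in nhds t. (T \<circ> f has_vector_derivative D s * deriv T (f s)) (at s)"
    using D(1) by eventually_elim (intro field_vector_diff_chain_at, auto intro: holomorphic_derivI S)
  moreover have "isCont (\<lambda>s. D s * deriv T (f s)) t"
  proof (intro continuous_mult D isCont_o2[of _ f "deriv T"] cont)
    show "isCont (deriv T) (f t)"
      using assms(2) by (intro analytic_at_imp_isCont analytic_deriv)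
  qed
  ultimately show "C1_at (T \<circ> f) t"
    by (rule C1_atI)
  show "vector_derivative (T \<circ> f) (at t) = vector_derivative f (at t) * deriv T (f t)"
    by (intro vector_derivative_at field_vector_diff_chain_at C1_at_has_vector_derivative assms(1)
        holomorphic_derivI[OF S(3,1,2)])
qed

lemma C1_differentiable_on_imp_C1_at:
  assumes "f C1_differentiable_on A" "open B" "B \<subseteq> A" "t \<in> B"
  shows "C1_at f t"
proof -
  obtain D where D: "\<And>s. s \<in> A \<Longrightarrow> (f has_vector_derivative D s) (at s)" "continuous_on A D"
    using assms(1) by (auto simp: C1_differentiable_on_def)
  have "\<forall>\<^sub>F s in nhds t. s \<in> B"
    using assms by (intro eventually_nhds_in_open)
  hence "\<forall>\<^sub>F s in nhds t. (f has_vector_derivative D s) (at s)"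
    by eventually_elim (use D assms in auto)
  moreover have "isCont D t"
    using continuous_on_subset[OF D(2) assms(3)] assms by (simp add: continuous_on_eq_continuous_at)
  ultimately show ?thesis by (rule C1_atI)
qed

lemma C1_at_imp_C1_differentiable_on:
  assumes "\<And>t. t \<in> A \<Longrightarrow> C1_at f t"
  shows "f C1_differentiable_on A"
proof -
  have "isCont (\<lambda>s. vector_derivative f (at s)) t" if "t \<in> A" for t
  proof -
    have "C1_at f t" by (rule assms[OF that])
    then obtain D where D: "\<forall>\<^sub>F s in nhds t. (f has_vector_derivative D s) (at s)" "isCont D t"
      by (auto simp: C1_at_def)
    have "\<forall>\<^sub>F s in nhds t. vector_derivative f (at s) = D s"
      using D(1) by eventually_elim (rule vector_derivative_at)
    from isCont_cong[OF this] D(2) show ?thesis by blast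
  qed
  thus ?thesis
    unfolding C1_differentiable_on_def
    by (intro exI[of _ "\<lambda>s. vector_derivative f (at s)"] conjI ballI continuous_at_imp_continuous_on)
      (auto intro: C1_at_has_vector_derivative assms)
qed

lemma path_isCont:
  assumes "path \<gamma>" "0 < t" "t < 1"
  shows "isCont \<gamma> t"
proof -
  have "continuous_on {0<..<1} \<gamma>"
    using assms(1) unfolding path_def by (rule continuous_on_subset) auto
  thus ?thesis
    using assms by (simp add: continuous_on_eq_continuous_at)
qed

lemma isCont_eventually_nhds:
  assumes "isCont f t" "open S" "f t \<in> S"
  shows "\<forall>\<^sub>F s in nhds t. f s \<in> S"
  using assms tendsto_at_iff_tendsto_nhds[of f t] unfolding isCont_def
  by (metis topological_tendstoD)

section \<open>Paths on the surface and the chart independence of their integrals\<close>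

context surface
begin

text \<open>The factor is the one in the transformation law of forms, so the product of coefficient
  and velocity is the same in every chart around \<open>\<gamma> t\<close>.\<close>

lemma C1_at_chart_change:
  assumes ch: "(U, \<phi>) \<in> \<A>" "(V, \<psi>) \<in> \<A>" and p: "\<gamma> t \<in> U" "\<gamma> t \<in> V" and "isCont \<gamma> t"
    and C1: "C1_at (\<phi> \<circ> \<gamma>) t"
  shows "C1_at (\<psi> \<circ> \<gamma>) t"
    and "vector_derivative (\<psi> \<circ> \<gamma>) (at t) =
           vector_derivative (\<phi> \<circ> \<gamma>) (at t) * deriv (\<psi> \<circ> inv_into U \<phi>) (\<phi> (\<gamma> t))"
proof -
  define T where "T = \<psi> \<circ> inv_into U \<phi>"
  have T: "T analytic_on {(\<phi> \<circ> \<gamma>) t}"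
    using transition_analytic[OF ch p] by (simp add: T_def)
  have "\<forall>\<^sub>F s in nhds t. \<gamma> s \<in> U"
    using assms chart_open by (intro isCont_eventually_nhds) auto
  hence ev: "\<forall>\<^sub>F s in nhds t. (T \<circ> (\<phi> \<circ> \<gamma>)) s = (\<psi> \<circ> \<gamma>) s"
    by eventually_elim (simp add: T_def chart_inv ch)
  show "C1_at (\<psi> \<circ> \<gamma>) t"
    using C1_at_holomorphic(1)[OF C1 T] C1_at_cong[OF ev] by blast
  have "vector_derivative (\<psi> \<circ> \<gamma>) (at t) = vector_derivative (T \<circ> (\<phi> \<circ> \<gamma>)) (at t)"
    using vector_derivative_cong_nhds[of "T \<circ> (\<phi> \<circ> \<gamma>)" "\<psi> \<circ> \<gamma>" t, OF ev] by (rule sym)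
  also have "\<dots> = vector_derivative (\<phi> \<circ> \<gamma>) (at t) * deriv T ((\<phi> \<circ> \<gamma>) t)"
    by (rule C1_at_holomorphic(2)[OF C1 T])
  finally show "vector_derivative (\<psi> \<circ> \<gamma>) (at t) =
           vector_derivative (\<phi> \<circ> \<gamma>) (at t) * deriv (\<psi> \<circ> inv_into U \<phi>) (\<phi> (\<gamma> t))"
    unfolding T_def o_apply .
qed

text \<open>Passing to the open interval makes the set of parameters mapped into a chart open, once
  the finite set is removed, as \<open>C1_at\<close> requires; the two endpoints join the
  exceptional set.\<close>

lemma surface_path_iff:
  "surface_path \<A> \<gamma> \<longleftrightarrow> path \<gamma> \<and> (\<exists>S. finite S \<and>
     (\<forall>t\<in>{0<..<1} - S. \<forall>(U, \<phi>)\<in>\<A>. \<gamma> t \<in> U \<longrightarrow> C1_at (\<phi> \<circ> \<gamma>) t))"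
proof safe
  assume sp: "surface_path \<A> \<gamma>"
  thus path: "path \<gamma>" by (simp add: surface_path_def)
  obtain S where S: "finite S"
    "\<And>U \<phi>. (U, \<phi>) \<in> \<A> \<Longrightarrow> (\<phi> \<circ> \<gamma>) C1_differentiable_on {t \<in> {0..1} - S. \<gamma> t \<in> U}"
    using sp by (auto simp: surface_path_def)
  have "C1_at (\<phi> \<circ> \<gamma>) t" if t: "t \<in> {0<..<1} - S" and ch: "(U, \<phi>) \<in> \<A>" "\<gamma> t \<in> U" for t U \<phi>
  proof (rule C1_differentiable_on_imp_C1_at[OF S(2)[OF ch(1)]])
    have "continuous_on ({0<..<1} - S) \<gamma>"
      using path unfolding path_def by (rule continuous_on_subset) auto
    moreover have "open ({0<..<1} - S)"
      using S(1) by (intro open_Diff finite_imp_closed) auto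
    ultimately show "open (({0<..<1} - S) \<inter> \<gamma> -` U)"
      using chart_open[OF ch(1)] by (rule continuous_open_preimage)
  qed (use t ch in auto)
  thus "\<exists>S. finite S \<and> (\<forall>t\<in>{0<..<1} - S. \<forall>(U, \<phi>)\<in>\<A>. \<gamma> t \<in> U \<longrightarrow> C1_at (\<phi> \<circ> \<gamma>) t)"
    using S(1) by (intro exI[of _ S]) auto
next
  fix S assume path: "path \<gamma>" and S: "finite S"
    and C1: "\<forall>t\<in>{0<..<1} - S. \<forall>(U, \<phi>)\<in>\<A>. \<gamma> t \<in> U \<longrightarrow> C1_at (\<phi> \<circ> \<gamma>) t"
  have "(\<phi> \<circ> \<gamma>) C1_differentiable_on {t \<in> {0..1} - (insert 0 (insert 1 S)). \<gamma> t \<in> U}"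
    if "(U, \<phi>) \<in> \<A>" for U \<phi>
    using C1 that by (intro C1_at_imp_C1_differentiable_on) (auto simp: less_le)
  thus "surface_path \<A> \<gamma>"
    unfolding surface_path_def using path S
    by (intro conjI exI[of _ "insert 0 (insert 1 S)"]) auto
qed

lemma surface_path_C1:
  assumes "surface_path \<A> \<gamma>"
  obtains S where "finite S"
    "\<And>t U \<phi>. 0 < t \<Longrightarrow> t < 1 \<Longrightarrow> t \<notin> S \<Longrightarrow> (U, \<phi>) \<in> \<A> \<Longrightarrow> \<gamma> t \<in> U \<Longrightarrow> C1_at (\<phi> \<circ> \<gamma>) t"
proof -
  obtain S where "finite S" "\<forall>t\<in>{0<..<1} - S. \<forall>(U, \<phi>)\<in>\<A>. \<gamma> t \<in> U \<longrightarrow> C1_at (\<phi> \<circ> \<gamma>) t"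
    using assms unfolding surface_path_iff by blast
  thus ?thesis by (intro that[of S]) auto
qed

lemma surface_pathI:
  assumes "path \<gamma>" "finite S"
    and "\<And>t. 0 < t \<Longrightarrow> t < 1 \<Longrightarrow> t \<notin> S \<Longrightarrow> \<exists>U \<phi>. (U, \<phi>) \<in> \<A> \<and> \<gamma> t \<in> U \<and> C1_at (\<phi> \<circ> \<gamma>) t"
  shows "surface_path \<A> \<gamma>"
proof -
  have "C1_at (\<psi> \<circ> \<gamma>) t" if t: "0 < t" "t < 1" "t \<notin> S" and ch: "(V, \<psi>) \<in> \<A>" "\<gamma> t \<in> V" for t V \<psi>
    using assms(3)[OF t] C1_at_chart_change(1)[OF _ ch(1) _ ch(2) path_isCont[OF assms(1) t(1,2)]] by blast
  thus ?thesis
    unfolding surface_path_iff using assms(1,2) by (intro conjI exI[of _ S]) auto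
qed

lemma has_form_integralI:
  assumes "(g has_integral I) {0..1}" "finite S"
    and "\<And>t U \<phi>. 0 < t \<Longrightarrow> t < 1 \<Longrightarrow> t \<notin> S \<Longrightarrow> (U, \<phi>) \<in> \<A> \<Longrightarrow> \<gamma> t \<in> U \<Longrightarrow>
      g t = \<eta> (U, \<phi>) (\<phi> (\<gamma> t)) * vector_derivative (\<phi> \<circ> \<gamma>) (at t)"
  shows "has_form_integral \<A> \<eta> \<gamma> I"
  unfolding has_form_integral_def
  using assms by (intro exI[of _ g] exI[of _ "insert 0 (insert 1 S)"]) (auto simp: less_le)

lemma has_form_integralE:
  assumes "has_form_integral \<A> \<eta> \<gamma> I"
  obtains g S where "(g has_integral I) {0..1}" "finite S"
    "\<And>t U \<phi>. 0 \<le> t \<Longrightarrow> t \<le> 1 \<Longrightarrow> t \<notin> S \<Longrightarrow> (U, \<phi>) \<in> \<A> \<Longrightarrow> \<gamma> t \<in> U \<Longrightarrow>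
      g t = \<eta> (U, \<phi>) (\<phi> (\<gamma> t)) * vector_derivative (\<phi> \<circ> \<gamma>) (at t)"
proof -
  obtain g S where "(g has_integral I) {0..1}" "finite S"
    "\<forall>t\<in>{0..1} - S. \<forall>(U, \<phi>)\<in>\<A>. \<gamma> t \<in> U \<longrightarrow>
           g t = \<eta> (U, \<phi>) (\<phi> (\<gamma> t)) * vector_derivative (\<phi> \<circ> \<gamma>) (at t)"
    using assms unfolding has_form_integral_def by blast
  thus ?thesis by (intro that[of g S]) auto
qed

text \<open>Every point lies in some chart, so two admissible integrands agree off a finite
  set.\<close>

lemma has_form_integral_unique:
  assumes "has_form_integral \<A> \<eta> \<gamma> I" "has_form_integral \<A> \<eta> \<gamma> J"
  shows "I = J"
proof -
  obtain g S where g: "(g has_integral I) {0..1}" "finite S"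
    "\<And>t U \<phi>. 0 \<le> t \<Longrightarrow> t \<le> 1 \<Longrightarrow> t \<notin> S \<Longrightarrow> (U, \<phi>) \<in> \<A> \<Longrightarrow> \<gamma> t \<in> U \<Longrightarrow>
      g t = \<eta> (U, \<phi>) (\<phi> (\<gamma> t)) * vector_derivative (\<phi> \<circ> \<gamma>) (at t)"
    using assms(1) by (rule has_form_integralE) blast
  obtain h R where h: "(h has_integral J) {0..1}" "finite R"
    "\<And>t U \<phi>. 0 \<le> t \<Longrightarrow> t \<le> 1 \<Longrightarrow> t \<notin> R \<Longrightarrow> (U, \<phi>) \<in> \<A> \<Longrightarrow> \<gamma> t \<in> U \<Longrightarrow>
      h t = \<eta> (U, \<phi>) (\<phi> (\<gamma> t)) * vector_derivative (\<phi> \<circ> \<gamma>) (at t)"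
    using assms(2) by (rule has_form_integralE) blast
  have "g t = h t" if t: "t \<in> {0..1} - (S \<union> R)" for t
  proof -
    obtain U \<phi> where "(U, \<phi>) \<in> \<A>" "\<gamma> t \<in> U" by (rule obtain_chart)
    thus ?thesis using g(3) h(3) t by auto
  qed
  hence "(h has_integral I) {0..1}"
    using g(2) h(2) by (intro has_integral_spike_finite[OF _ _ g(1), of "S \<union> R"]) auto
  thus ?thesis using h(1) has_integral_unique by blast
qed

text \<open>Reduces integrals over paths inside a chart to contour integrals in the coordinate,
  where primitives and residues are available; the transformation laws make the integrand valid in
  all other charts as well.\<close>

lemma chart_path:
  assumes ch: "(U, \<phi>) \<in> \<A>" and \<beta>: "valid_path \<beta>" "path_image \<beta> \<subseteq> \<phi> ` U"
  shows surface_path_chart_path: "surface_path \<A> (inv_into U \<phi> \<circ> \<beta>)"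
    and has_form_integral_chart_path:
      "meromorphic_form \<A> \<eta> \<Longrightarrow> (\<eta> (U, \<phi>) has_contour_integral I) \<beta> \<Longrightarrow>
         has_form_integral \<A> \<eta> (inv_into U \<phi> \<circ> \<beta>) I"
proof -
  define \<gamma> where "\<gamma> = inv_into U \<phi> \<circ> \<beta>"
  have "path \<beta>" using \<beta>(1) by (rule valid_path_imp_path)
  hence path: "path \<gamma>"
    unfolding \<gamma>_def using chart_inv_continuous[OF ch] \<beta>(2) path_continuous_image continuous_on_subset
    by blast
  obtain S where S: "finite S" "\<beta> C1_differentiable_on ({0..1} - S)"
    using \<beta>(1) by (auto simp: valid_path_def piecewise_C1_differentiable_on_def)
  have in_U: "\<beta> t \<in> \<phi> ` U" if "0 \<le> t" "t \<le> 1" for t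
    using \<beta>(2) that by (auto simp: path_image_def)
  hence in_U': "\<gamma> t \<in> U" if "0 \<le> t" "t \<le> 1" for t
    using chart_inv_in[OF in_U[OF that]] by (simp add: \<gamma>_def)
  have \<beta>_C1: "C1_at \<beta> t" if "0 < t" "t < 1" "t \<notin> S" for t
  proof (rule C1_differentiable_on_imp_C1_at[OF S(2)])
    show "open ({0<..<1} - S)"
      using S(1) by (intro open_Diff finite_imp_closed) auto
  qed (use that in auto)
  have ev: "\<forall>\<^sub>F s in nhds t. \<beta> s = (\<phi> \<circ> \<gamma>) s" if "0 < t" "t < 1" for t
  proof (rule eventually_mono)
    show "\<forall>\<^sub>F s in nhds t. s \<in> {0<..<1}"
      using that by (intro eventually_nhds_in_open) auto
    show "\<beta> s = (\<phi> \<circ> \<gamma>) s" if "s \<in> {0<..<1}" for s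
      using that chart_of_inv[OF in_U[of s]] by (simp add: \<gamma>_def)
  qed
  have C1: "C1_at (\<phi> \<circ> \<gamma>) t" if "0 < t" "t < 1" "t \<notin> S" for t
    using \<beta>_C1[OF that] C1_at_cong[OF ev[OF that(1,2)]] by blast
  show "surface_path \<A> (inv_into U \<phi> \<circ> \<beta>)"
    unfolding \<gamma>_def[symmetric]
    using path S(1)
  proof (rule surface_pathI)
    fix t assume "0 < t" "t < 1" "t \<notin> S"
    thus "\<exists>U \<phi>. (U, \<phi>) \<in> \<A> \<and> \<gamma> t \<in> U \<and> C1_at (\<phi> \<circ> \<gamma>) t"
      using ch C1[of t] in_U'[of t] by (intro exI[of _ U] exI[of _ \<phi>]) auto
  qed
  assume \<eta>: "meromorphic_form \<A> \<eta>" and int: "(\<eta> (U, \<phi>) has_contour_integral I) \<beta>"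
  show "has_form_integral \<A> \<eta> (inv_into U \<phi> \<circ> \<beta>) I"
    unfolding \<gamma>_def[symmetric]
  proof (rule has_form_integralI[OF _ S(1)])
    show "((\<lambda>t. \<eta> (U, \<phi>) (\<beta> t) * vector_derivative \<beta> (at t)) has_integral I) {0..1}"
      using int by (simp add: has_contour_integral)
    fix t V \<psi> assume t: "0 < t" "t < 1" "t \<notin> S" and ch': "(V, \<psi>) \<in> \<A>" "\<gamma> t \<in> V"
    have eq: "\<phi> (\<gamma> t) = \<beta> t"
      using t chart_of_inv[OF in_U[of t]] by (simp add: \<gamma>_def)
    have "vector_derivative (\<psi> \<circ> \<gamma>) (at t) =
        vector_derivative (\<phi> \<circ> \<gamma>) (at t) * deriv (\<psi> \<circ> inv_into U \<phi>) (\<phi> (\<gamma> t))"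
      using C1_at_chart_change(2)[OF ch ch'(1) in_U'[of t] ch'(2) path_isCont[OF path t(1,2)] C1[OF t]] t
      by simp
    moreover have "vector_derivative (\<phi> \<circ> \<gamma>) (at t) = vector_derivative \<beta> (at t)"
      using vector_derivative_cong_nhds[of \<beta> "\<phi> \<circ> \<gamma>" t, OF ev[OF t(1,2)]] by simp
    moreover have "\<eta> (U, \<phi>) (\<phi> (\<gamma> t)) = \<eta> (V, \<psi>) (\<psi> (\<gamma> t)) * deriv (\<psi> \<circ> inv_into U \<phi>) (\<phi> (\<gamma> t))"
      using in_U' t ch' by (intro meromorphic_form_transform[OF \<eta> ch]) auto
    ultimately show "\<eta> (U, \<phi>) (\<beta> t) * vector_derivative \<beta> (at t) =
        \<eta> (V, \<psi>) (\<psi> (\<gamma> t)) * vector_derivative (\<psi> \<circ> \<gamma>) (at t)"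
      by (simp add: eq)
  qed
qed

lemma join_path:
  assumes \<gamma>: "surface_path \<A> \<gamma>1" "surface_path \<A> \<gamma>2" "pathfinish \<gamma>1 = pathstart \<gamma>2"
  shows surface_path_join: "surface_path \<A> (\<gamma>1 +++ \<gamma>2)"
    and has_form_integral_join:
      "has_form_integral \<A> \<eta> \<gamma>1 I \<Longrightarrow> has_form_integral \<A> \<eta> \<gamma>2 J \<Longrightarrow>
         has_form_integral \<A> \<eta> (\<gamma>1 +++ \<gamma>2) (I + J)"
proof -
  obtain S1 where S1: "finite S1" "\<And>t U \<phi>. 0 < t \<Longrightarrow> t < 1 \<Longrightarrow> t \<notin> S1 \<Longrightarrow> (U, \<phi>) \<in> \<A> \<Longrightarrow>
      \<gamma>1 t \<in> U \<Longrightarrow> C1_at (\<phi> \<circ> \<gamma>1) t"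
    using surface_path_C1[OF \<gamma>(1)] by blast
  obtain S2 where S2: "finite S2" "\<And>t U \<phi>. 0 < t \<Longrightarrow> t < 1 \<Longrightarrow> t \<notin> S2 \<Longrightarrow> (U, \<phi>) \<in> \<A> \<Longrightarrow>
      \<gamma>2 t \<in> U \<Longrightarrow> C1_at (\<phi> \<circ> \<gamma>2) t"
    using surface_path_C1[OF \<gamma>(2)] by blast
  \<comment> \<open>Exceptional parameters of the joined path: the junction 1/2 and the rescaled
    exceptional parameters of both halves.\<close>
  define S where "S T1 T2 = insert (1/2) ((*) 2 -` T1 \<union> (\<lambda>x. 2 * x + (- 1)) -` T2)" for T1 T2 :: "real set"
  have finS: "finite (S T1 T2)" if "finite T1" "finite T2" for T1 T2
    unfolding S_def using that by (simp add: finite_vimageI inj_on_def)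
  have ev1: "\<forall>\<^sub>F s in nhds t. (f \<circ> \<gamma>1) (2 * s + 0) = (f \<circ> (\<gamma>1 +++ \<gamma>2)) s" if "t < 1/2"
    for t and f :: "'a \<Rightarrow> complex"
    by (rule eventually_mono[OF eventually_nhds_in_open[of "{..<1/2}"]])
      (use that in \<open>auto simp: joinpaths_def\<close>)
  have ev2: "\<forall>\<^sub>F s in nhds t. (f \<circ> \<gamma>2) (2 * s + (-1)) = (f \<circ> (\<gamma>1 +++ \<gamma>2)) s" if "1/2 < t"
    for t and f :: "'a \<Rightarrow> complex"
    by (rule eventually_mono[OF eventually_nhds_in_open[of "{1/2<..}"]])
      (use that in \<open>auto simp: joinpaths_def\<close>)
  have C1_1: "C1_at (\<phi> \<circ> (\<gamma>1 +++ \<gamma>2)) t"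
    "vector_derivative (\<phi> \<circ> (\<gamma>1 +++ \<gamma>2)) (at t) = 2 *\<^sub>R vector_derivative (\<phi> \<circ> \<gamma>1) (at (2 * t))"
    if t: "0 < t" "t < 1/2" "2 * t \<notin> S1" and ch: "(U, \<phi>) \<in> \<A>" "\<gamma>1 (2 * t) \<in> U" for t U \<phi>
  proof -
    have "C1_at (\<phi> \<circ> \<gamma>1) (2 * t + 0)"
      using S1(2)[of "2 * t"] t ch by auto
    from C1_at_affine[OF this]
      C1_at_cong[of "\<lambda>s. (\<phi> \<circ> \<gamma>1) (2 * s + 0)" "\<phi> \<circ> (\<gamma>1 +++ \<gamma>2)" t, OF ev1[OF t(2)]]
      vector_derivative_cong_nhds[of "\<lambda>s. (\<phi> \<circ> \<gamma>1) (2 * s + 0)" "\<phi> \<circ> (\<gamma>1 +++ \<gamma>2)" t, OF ev1[OF t(2)]]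
    show "C1_at (\<phi> \<circ> (\<gamma>1 +++ \<gamma>2)) t"
      "vector_derivative (\<phi> \<circ> (\<gamma>1 +++ \<gamma>2)) (at t) = 2 *\<^sub>R vector_derivative (\<phi> \<circ> \<gamma>1) (at (2 * t))"
      by simp_all
  qed
  have C1_2: "C1_at (\<phi> \<circ> (\<gamma>1 +++ \<gamma>2)) t"
    "vector_derivative (\<phi> \<circ> (\<gamma>1 +++ \<gamma>2)) (at t) = 2 *\<^sub>R vector_derivative (\<phi> \<circ> \<gamma>2) (at (2 * t + (- 1)))"
    if t: "1/2 < t" "t < 1" "2 * t + (- 1) \<notin> S2" and ch: "(U, \<phi>) \<in> \<A>" "\<gamma>2 (2 * t + (- 1)) \<in> U" for t U \<phi>
  proof -
    have "C1_at (\<phi> \<circ> \<gamma>2) (2 * t + (- 1))"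
      using t ch by (intro S2(2)) auto
    from C1_at_affine[OF this]
      C1_at_cong[of "\<lambda>s. (\<phi> \<circ> \<gamma>2) (2 * s + (- 1))" "\<phi> \<circ> (\<gamma>1 +++ \<gamma>2)" t, OF ev2[OF t(1)]]
      vector_derivative_cong_nhds[of "\<lambda>s. (\<phi> \<circ> \<gamma>2) (2 * s + (- 1))" "\<phi> \<circ> (\<gamma>1 +++ \<gamma>2)" t, OF ev2[OF t(1)]]
    show "C1_at (\<phi> \<circ> (\<gamma>1 +++ \<gamma>2)) t"
      "vector_derivative (\<phi> \<circ> (\<gamma>1 +++ \<gamma>2)) (at t) = 2 *\<^sub>R vector_derivative (\<phi> \<circ> \<gamma>2) (at (2 * t + (- 1)))"
      by simp_all
  qed
  have j1: "(\<gamma>1 +++ \<gamma>2) t = \<gamma>1 (2 * t)" if "t < 1/2" for t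
    using that by (simp add: joinpaths_def)
  have j2: "(\<gamma>1 +++ \<gamma>2) t = \<gamma>2 (2 * t + (- 1))" if "1/2 < t" for t
    using that by (simp add: joinpaths_def)
  show "surface_path \<A> (\<gamma>1 +++ \<gamma>2)"
  proof (rule surface_pathI[OF _ finS[OF S1(1) S2(1)]])
    show "path (\<gamma>1 +++ \<gamma>2)"
      using \<gamma> by (intro path_join_imp) (auto simp: surface_path_def)
    fix t assume t: "0 < t" "t < 1" "t \<notin> S S1 S2"
    obtain U \<phi> where ch: "(U, \<phi>) \<in> \<A>" "(\<gamma>1 +++ \<gamma>2) t \<in> U" by (rule obtain_chart)
    consider "t < 1/2" | "1/2 < t" using t by (fastforce simp: S_def)
    hence "C1_at (\<phi> \<circ> (\<gamma>1 +++ \<gamma>2)) t"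
      by cases (use t ch C1_1(1)[of t] C1_2(1)[of t] j1 j2 in \<open>auto simp: S_def\<close>)
    with ch show "\<exists>U \<phi>. (U, \<phi>) \<in> \<A> \<and> (\<gamma>1 +++ \<gamma>2) t \<in> U \<and> C1_at (\<phi> \<circ> (\<gamma>1 +++ \<gamma>2)) t"
      by blast
  qed
  assume "has_form_integral \<A> \<eta> \<gamma>1 I"
  then obtain g1 T1 where g1: "(g1 has_integral I) {0..1}" "finite T1"
    "\<And>t U \<phi>. 0 \<le> t \<Longrightarrow> t \<le> 1 \<Longrightarrow> t \<notin> T1 \<Longrightarrow> (U, \<phi>) \<in> \<A> \<Longrightarrow> \<gamma>1 t \<in> U \<Longrightarrow>
      g1 t = \<eta> (U, \<phi>) (\<phi> (\<gamma>1 t)) * vector_derivative (\<phi> \<circ> \<gamma>1) (at t)"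
    by (rule has_form_integralE) blast
  assume "has_form_integral \<A> \<eta> \<gamma>2 J"
  then obtain g2 T2 where g2: "(g2 has_integral J) {0..1}" "finite T2"
    "\<And>t U \<phi>. 0 \<le> t \<Longrightarrow> t \<le> 1 \<Longrightarrow> t \<notin> T2 \<Longrightarrow> (U, \<phi>) \<in> \<A> \<Longrightarrow> \<gamma>2 t \<in> U \<Longrightarrow>
      g2 t = \<eta> (U, \<phi>) (\<phi> (\<gamma>2 t)) * vector_derivative (\<phi> \<circ> \<gamma>2) (at t)"
    by (rule has_form_integralE) blast
  define g where "g t = (if t \<le> 1/2 then 2 *\<^sub>R g1 (2 * t) else 2 *\<^sub>R g2 (2 * t + (- 1)))" for t
  have i1: "((\<lambda>t. 2 *\<^sub>R g1 (2 * t)) has_integral I) {0..1/2}"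
   and i2: "((\<lambda>t. 2 *\<^sub>R g2 (2 * t + (- 1))) has_integral J) {1/2..1}"
    using has_integral_affinity01 [OF g1(1), where m= 2 and c=0, THEN has_integral_cmul [where c=2]]
          has_integral_affinity01 [OF g2(1), where m= 2 and c="-1", THEN has_integral_cmul [where c=2]]
    by (simp_all only: image_affinity_atLeastAtMost_div_diff, simp_all add: scaleR_conv_of_real mult_ac)
  have "(g has_integral I) {0..1/2}"
    by (rule has_integral_spike_finite[OF _ _ i1, of "{}"]) (auto simp: g_def)
  moreover have "(g has_integral J) {1/2..1}"
    by (rule has_integral_spike_finite[OF _ _ i2, of "{1/2}"]) (auto simp: g_def)
  ultimately have int: "(g has_integral (I + J)) {0..1}"
    by (intro has_integral_combine[of 0 "1/2" 1]) auto
  show "has_form_integral \<A> \<eta> (\<gamma>1 +++ \<gamma>2) (I + J)"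
  proof (rule has_form_integralI[OF int])
    show "finite (S (S1 \<union> T1) (S2 \<union> T2))"
      using S1(1) S2(1) g1(2) g2(2) by (intro finS) auto
    fix t U \<phi> assume t: "0 < t" "t < 1" "t \<notin> S (S1 \<union> T1) (S2 \<union> T2)"
      and ch: "(U, \<phi>) \<in> \<A>" "(\<gamma>1 +++ \<gamma>2) t \<in> U"
    consider "t < 1/2" | "1/2 < t" using t by (fastforce simp: S_def)
    thus "g t = \<eta> (U, \<phi>) (\<phi> ((\<gamma>1 +++ \<gamma>2) t)) * vector_derivative (\<phi> \<circ> (\<gamma>1 +++ \<gamma>2)) (at t)"
    proof cases
      case 1
      thus ?thesis
        using t ch C1_1(2)[of t U \<phi>] g1(3)[of "2 * t" U \<phi>] j1[of t] by (auto simp: S_def g_def)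
    next
      case 2
      thus ?thesis
        using t ch C1_2(2)[of t U \<phi>] g2(3)[of "2 * t + (- 1)" U \<phi>] j2[of t] by (auto simp: S_def g_def)
    qed
  qed
qed

lemma reverse_path:
  assumes \<gamma>: "surface_path \<A> \<gamma>"
  shows surface_path_reverse: "surface_path \<A> (reversepath \<gamma>)"
    and has_form_integral_reverse:
      "has_form_integral \<A> \<eta> \<gamma> I \<Longrightarrow> has_form_integral \<A> \<eta> (reversepath \<gamma>) (- I)"
proof -
  obtain S where S: "finite S" "\<And>t U \<phi>. 0 < t \<Longrightarrow> t < 1 \<Longrightarrow> t \<notin> S \<Longrightarrow> (U, \<phi>) \<in> \<A> \<Longrightarrow>
      \<gamma> t \<in> U \<Longrightarrow> C1_at (\<phi> \<circ> \<gamma>) t"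
    using surface_path_C1[OF \<gamma>] by blast
  have fin: "finite ((-) 1 -` T)" if "finite T" for T :: "real set"
    using that by (simp add: finite_vimageI inj_on_def)
  have C1: "C1_at (\<phi> \<circ> reversepath \<gamma>) t"
    "vector_derivative (\<phi> \<circ> reversepath \<gamma>) (at t) = - vector_derivative (\<phi> \<circ> \<gamma>) (at (1 - t))"
    if t: "0 < t" "t < 1" "1 - t \<notin> S" and ch: "(U, \<phi>) \<in> \<A>" "\<gamma> (1 - t) \<in> U" for t U \<phi>
  proof -
    have "C1_at (\<phi> \<circ> \<gamma>) (-1 * t + 1)"
      using S(2)[of "1 - t"] t ch by auto
    from C1_at_affine[OF this]
    show "C1_at (\<phi> \<circ> reversepath \<gamma>) t"
      "vector_derivative (\<phi> \<circ> reversepath \<gamma>) (at t) = - vector_derivative (\<phi> \<circ> \<gamma>) (at (1 - t))"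
      by (simp_all add: reversepath_def o_def)
  qed
  show "surface_path \<A> (reversepath \<gamma>)"
  proof (rule surface_pathI[OF _ fin[OF S(1)]])
    show "path (reversepath \<gamma>)" using \<gamma> by (simp add: surface_path_def)
    fix t :: real assume t: "0 < t" "t < 1" "t \<notin> (-) 1 -` S"
    obtain U \<phi> where ch: "(U, \<phi>) \<in> \<A>" "reversepath \<gamma> t \<in> U" by (rule obtain_chart)
    thus "\<exists>U \<phi>. (U, \<phi>) \<in> \<A> \<and> reversepath \<gamma> t \<in> U \<and> C1_at (\<phi> \<circ> reversepath \<gamma>) t"
      using t C1(1)[of t U \<phi>] by (auto simp: reversepath_def)
  qed
  assume "has_form_integral \<A> \<eta> \<gamma> I"
  then obtain g T where g: "(g has_integral I) {0..1}" "finite T"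
    "\<And>t U \<phi>. 0 \<le> t \<Longrightarrow> t \<le> 1 \<Longrightarrow> t \<notin> T \<Longrightarrow> (U, \<phi>) \<in> \<A> \<Longrightarrow> \<gamma> t \<in> U \<Longrightarrow>
      g t = \<eta> (U, \<phi>) (\<phi> (\<gamma> t)) * vector_derivative (\<phi> \<circ> \<gamma>) (at t)"
    by (rule has_form_integralE) blast
  have int: "((\<lambda>t. - g (1 - t)) has_integral - I) {0..1}"
    using has_integral_affinity01[OF g(1), where m = "-1" and c = 1] by (simp add: has_integral_neg)
  show "has_form_integral \<A> \<eta> (reversepath \<gamma>) (- I)"
  proof (rule has_form_integralI[OF int])
    show "finite ((-) 1 -` (S \<union> T))"
      using S(1) g(2) by (intro fin) auto
    fix t U \<phi> assume t: "0 < t" "t < 1" "t \<notin> (-) 1 -` (S \<union> T)"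
      and ch: "(U, \<phi>) \<in> \<A>" "reversepath \<gamma> t \<in> U"
    thus "- g (1 - t) = \<eta> (U, \<phi>) (\<phi> (reversepath \<gamma> t)) * vector_derivative (\<phi> \<circ> reversepath \<gamma>) (at t)"
      using C1(2)[of t U \<phi>] g(3)[of "1 - t" U \<phi>] by (auto simp: reversepath_def)
  qed
qed

text \<open>Poles are isolated and a punctured disc in the plane is connected, so any two non-poles
  in a small disc can be joined inside it off the pole; connectedness of the surface does the
  rest.\<close>

lemma pole_free_path_exists:
  assumes \<eta>: "meromorphic_form \<A> \<eta>" and pq: "\<not> form_pole \<A> \<eta> p" "\<not> form_pole \<A> \<eta> q"
  obtains \<gamma> I where "pole_free_path \<A> \<eta> \<gamma>" "pathstart \<gamma> = p" "pathfinish \<gamma> = q"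
    "has_form_integral \<A> \<eta> \<gamma> I"
proof -
  define R where "R p q \<longleftrightarrow> (\<exists>\<gamma> I. pole_free_path \<A> \<eta> \<gamma> \<and> pathstart \<gamma> = p \<and> pathfinish \<gamma> = q \<and>
    has_form_integral \<A> \<eta> \<gamma> I)" for p q
  have R_trans: "R x z" if xyz: "R x y" "R y z" for x y z
  proof -
    obtain \<gamma>1 I1 \<gamma>2 I2 where "pole_free_path \<A> \<eta> \<gamma>1" "pathstart \<gamma>1 = x" "pathfinish \<gamma>1 = y"
      "has_form_integral \<A> \<eta> \<gamma>1 I1" "pole_free_path \<A> \<eta> \<gamma>2" "pathstart \<gamma>2 = y" "pathfinish \<gamma>2 = z"
      "has_form_integral \<A> \<eta> \<gamma>2 I2"
      using xyz unfolding R_def by blast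
    thus ?thesis
      unfolding R_def pole_free_path_def
      by (intro exI[of _ "\<gamma>1 +++ \<gamma>2"] exI[of _ "I1 + I2"])
        (auto simp: surface_path_join has_form_integral_join path_image_join)
  qed
  have local: "\<exists>N. open N \<and> a \<in> N \<and> (\<forall>x\<in>N. \<forall>y\<in>N. \<not> form_pole \<A> \<eta> x \<longrightarrow> \<not> form_pole \<A> \<eta> y \<longrightarrow> R x y)" for a
  proof -
    obtain U \<phi> where ch: "(U, \<phi>) \<in> \<A>" "a \<in> U" by (rule obtain_chart)
    obtain e where e: "e > 0" "\<And>z. z \<in> ball (\<phi> a) e - {\<phi> a} \<Longrightarrow> z \<in> \<phi> ` U \<and> \<not> form_pole \<A> \<eta> (inv_into U \<phi> z)"
      by (rule pole_free_punctured_disc[OF \<eta> ch]) (rule that)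
    \<comment> \<open>The centre is the only possible pole in the disc and is removed only if it is
      one, since otherwise it may itself be an endpoint.\<close>
    define D where "D = (if form_pole \<A> \<eta> a then ball (\<phi> a) e - {\<phi> a} else ball (\<phi> a) e)"
    have D12: "open D" "connected D"
      using connected_punctured_ball[of "\<phi> a" e] by (auto simp: D_def DIM_complex)
    have D_good: "z \<in> \<phi> ` U \<and> \<not> form_pole \<A> \<eta> (inv_into U \<phi> z)" if "z \<in> D" for z
      using that e(2)[of z] ch chart_inv[OF ch] by (cases "z = \<phi> a") (auto simp: D_def split: if_splits)
    have "D \<subseteq> \<phi> ` U"
      using D_good by blast
    note D = D12 this conjunct2[OF D_good]
    have hol: "\<eta> (U, \<phi>) holomorphic_on D"
      by (rule form_holomorphic_on[OF \<eta> ch(1) D_good])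
    have "R x y" if xy: "x \<in> \<phi> -` ball (\<phi> a) e \<inter> U" "y \<in> \<phi> -` ball (\<phi> a) e \<inter> U"
      "\<not> form_pole \<A> \<eta> x" "\<not> form_pole \<A> \<eta> y" for x y
    proof -
      have "\<phi> x \<in> D" "\<phi> y \<in> D"
        using xy ch chart_inj[OF ch(1)] by (auto simp: D_def dest: inj_onD)
      from connected_open_polynomial_connected[OF D(1,2) this]
      obtain \<beta> where \<beta>: "polynomial_function \<beta>" "path_image \<beta> \<subseteq> D" "pathstart \<beta> = \<phi> x" "pathfinish \<beta> = \<phi> y"
        by blast
      have vp: "valid_path \<beta>" using \<beta>(1) by (rule valid_path_polynomial_function)
      have "\<eta> (U, \<phi>) contour_integrable_on \<beta>"
        by (rule contour_integrable_holomorphic_simple[OF hol D(1) vp \<beta>(2)])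
      then obtain I where I: "(\<eta> (U, \<phi>) has_contour_integral I) \<beta>"
        by (auto simp: contour_integrable_on_def)
      have im: "path_image \<beta> \<subseteq> \<phi> ` U" using \<beta>(2) D(3) by blast
      have "pole_free_path \<A> \<eta> (inv_into U \<phi> \<circ> \<beta>)"
        unfolding pole_free_path_def
        using surface_path_chart_path[OF ch(1) vp im] \<beta>(2) D(4) by (auto simp: path_image_compose)
      moreover have "pathstart (inv_into U \<phi> \<circ> \<beta>) = x" "pathfinish (inv_into U \<phi> \<circ> \<beta>) = y"
        using \<beta>(3,4) xy chart_inv[OF ch(1)] by (auto simp: pathstart_compose pathfinish_compose)
      ultimately show ?thesis
        unfolding R_def using has_form_integral_chart_path[OF ch(1) vp im \<eta> I] by blast
    qed
    moreover have "open (\<phi> -` ball (\<phi> a) e \<inter> U)"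
      using open_chart_vimage[OF ch(1)] by auto
    ultimately show ?thesis
      using ch(2) e(1) by (intro exI[of _ "\<phi> -` ball (\<phi> a) e \<inter> U"]) auto
  qed
  \<comment> \<open>Reachability is demanded of the non-poles near \<open>a\<close>, not of
    \<open>a\<close>; in this way poles take part in the open-closed argument, which runs over the
    whole connected surface.\<close>
  define Q where "Q = {a. \<exists>N. open N \<and> a \<in> N \<and> (\<forall>q\<in>N. \<not> form_pole \<A> \<eta> q \<longrightarrow> R p q)}"
  have "open Q"
    unfolding Q_def by (subst open_subopen) blast
  moreover have "open (- Q)"
  proof (subst open_subopen, safe)
    fix a assume a: "a \<notin> Q"
    obtain N where N: "open N" "a \<in> N" "\<And>x y. x \<in> N \<Longrightarrow> y \<in> N \<Longrightarrow> \<not> form_pole \<A> \<eta> x \<Longrightarrow>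
      \<not> form_pole \<A> \<eta> y \<Longrightarrow> R x y"
      using local[of a] by metis
    have "b \<notin> Q" if "b \<in> N" for b
    proof
      assume "b \<in> Q"
      then obtain N' where N': "open N'" "b \<in> N'" "\<And>q. q \<in> N' \<Longrightarrow> \<not> form_pole \<A> \<eta> q \<Longrightarrow> R p q"
        unfolding Q_def by blast
      have "\<forall>\<^sub>F r in at b. r \<in> N \<inter> N' \<and> \<not> form_pole \<A> \<eta> r"
        using eventually_at_in_open'[of "N \<inter> N'" b] N N' that eventually_not_form_pole[OF \<eta>, of b]
        by (intro eventually_conj) auto
      then obtain r where r: "r \<in> N" "r \<in> N'" "\<not> form_pole \<A> \<eta> r"
        using eventually_happens'[OF at_surface_neq_bot] by blast
      have "R p q" if "q \<in> N" "\<not> form_pole \<A> \<eta> q" for q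
        using R_trans N'(3) N(3) r that by blast
      with N a show False unfolding Q_def by blast
    qed
    with N show "\<exists>T. open T \<and> a \<in> T \<and> T \<subseteq> - Q" by blast
  qed
  moreover have "p \<in> Q"
    using local[of p] pq(1) unfolding Q_def by blast
  ultimately have "Q = UNIV"
    using connected_surface unfolding connected_def by blast
  hence "R p q"
    using pq(2) unfolding Q_def by blast
  thus ?thesis using that unfolding R_def by blast
qed

end

section \<open>Logarithmic primitives\<close>

lemma has_vector_derivative_cong_nhds:
  assumes "(f has_vector_derivative d) (at t)" "\<forall>\<^sub>F s in nhds t. f s = g s"
  shows "(g has_vector_derivative d) (at t)"
  using assms has_vector_derivative_cong_ev[of UNIV f g t d] eventually_nhds_x_imp_x[OF assms(2)] by simp

lemma has_field_derivative_cong_nhds: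
  assumes "(f has_field_derivative d) (at t)" "\<forall>\<^sub>F s in nhds t. f s = g s"
  shows "(g has_field_derivative d) (at t)"
  using assms DERIV_cong_ev[OF refl assms(2) refl] by simp

text \<open>Near \<open>t\<close> the values of \<open>L\<close> stay within \<open>pi\<close> of
  \<open>L t\<close>, so there \<open>L\<close> is the branch obtained from \<open>Ln\<close> by
  dividing the argument by \<open>w t\<close>. The division brings the argument of \<open>Ln\<close>
  to 1 at the parameter \<open>t\<close>, off the cut.\<close>

lemma continuous_logarithm_has_vector_derivative:
  fixes w L :: "real \<Rightarrow> complex"
  assumes L: "isCont L t" and wL: "\<forall>\<^sub>F s in nhds t. w s = exp (L s)"
    and w: "(w has_vector_derivative d * w t) (at t)"
  shows "(L has_vector_derivative d) (at t)"
proof -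
  have wt: "w t = exp (L t)" using eventually_nhds_x_imp_x[OF wL] .
  have "\<forall>\<^sub>F s in nhds t. dist (L s) (L t) < pi"
    using L isCont_eventually_nhds[of t L "ball (L t) pi"] pi_gt_zero by (simp add: dist_commute)
  hence "\<forall>\<^sub>F s in nhds t. L t + Ln (w s * exp (- L t)) = L s"
    using wL
  proof eventually_elim
    case (elim s)
    have "\<bar>Im (L s - L t)\<bar> < pi"
      using elim(1) abs_Im_le_cmod[of "L s - L t"] by (simp add: dist_norm)
    hence "Ln (exp (L s - L t)) = L s - L t"
      by (intro Ln_exp) auto
    thus ?case using elim(2) by (simp add: exp_diff exp_minus field_simps)
  qed
  moreover have "((\<lambda>s. L t + Ln (w s * exp (- L t))) has_vector_derivative d) (at t)"
  proof -
    have "((\<lambda>y. L t + Ln (y * exp (- L t))) has_field_derivative exp (- L t) / (w t * exp (- L t))) (at (w t))"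
      by (auto intro!: derivative_eq_intros simp: wt exp_minus)
    from field_vector_diff_chain_at[OF w this] show ?thesis
      by (simp add: o_def wt)
  qed
  ultimately show ?thesis
    using has_vector_derivative_cong_ev[of UNIV "\<lambda>s. L t + Ln (w s * exp (- L t))" L t d]
      eventually_nhds_x_imp_x by (simp add: wt exp_minus)
qed

context surface
begin

text \<open>Nonvanishing is required separately since the zero function solves the equation too.
  Nothing is asked at the poles of \<open>\<eta>\<close>.\<close>

definition log_primitive :: "'a one_form \<Rightarrow> ('a \<Rightarrow> complex) \<Rightarrow> bool" where
  "log_primitive \<eta> v \<longleftrightarrow> (\<forall>(U, \<phi>)\<in>\<A>. \<forall>p\<in>U. \<not> form_pole \<A> \<eta> p \<longrightarrow>
     v p \<noteq> 0 \<and> ((\<lambda>z. v (inv_into U \<phi> z)) has_field_derivative 2 * \<eta> (U, \<phi>) (\<phi> p) * v p) (at (\<phi> p)))"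

lemma log_primitive_nonzero:
  assumes "log_primitive \<eta> v" "\<not> form_pole \<A> \<eta> p"
  shows "v p \<noteq> 0"
proof -
  obtain U \<phi> where "(U, \<phi>) \<in> \<A>" "p \<in> U" by (rule obtain_chart)
  thus ?thesis using assms unfolding log_primitive_def by blast
qed

lemma log_primitive_has_derivative:
  assumes "log_primitive \<eta> v" "\<not> form_pole \<A> \<eta> p" "(U, \<phi>) \<in> \<A>" "p \<in> U"
  shows "((\<lambda>z. v (inv_into U \<phi> z)) has_field_derivative 2 * \<eta> (U, \<phi>) (\<phi> p) * v p) (at (\<phi> p))"
  using assms unfolding log_primitive_def by blast

lemma log_primitive_isCont:
  assumes "log_primitive \<eta> v" "\<not> form_pole \<A> \<eta> p"
  shows "isCont v p"
proof -
  obtain U \<phi> where ch: "(U, \<phi>) \<in> \<A>" "p \<in> U" by (rule obtain_chart)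
  have "(\<lambda>z. v (inv_into U \<phi> z)) \<midarrow>\<phi> p\<rightarrow> v p"
    using DERIV_isCont[OF log_primitive_has_derivative[OF assms ch]] chart_inv[OF ch]
    by (simp add: isCont_def)
  thus ?thesis
    unfolding isCont_def using tendsto_chart_inv[OF ch] by blast
qed

text \<open>A continuous logarithm \<open>L\<close> of \<open>v\<close> along the path exists
  because the interval is contractible, and its derivative is twice the pulled-back form. The
  fundamental theorem of calculus then yields the existence of the integral together with its
  value.\<close>

lemma log_primitive_integral:
  assumes \<eta>: "log_primitive \<eta> v" and \<gamma>: "pole_free_path \<A> \<eta> \<gamma>"
  obtains L where "has_form_integral \<A> \<eta> \<gamma> ((L (1::real) - L 0) / 2)"
    "exp (L 0) = v (pathstart \<gamma>)" "exp (L 1) = v (pathfinish \<gamma>)"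
proof -
  have path: "path \<gamma>" and sp: "surface_path \<A> \<gamma>"
    and np: "\<And>t. 0 \<le> t \<Longrightarrow> t \<le> 1 \<Longrightarrow> \<not> form_pole \<A> \<eta> (\<gamma> t)"
    using \<gamma> by (auto simp: pole_free_path_def surface_path_def path_image_def)
  obtain S where S: "finite S" "\<And>t U \<phi>. 0 < t \<Longrightarrow> t < 1 \<Longrightarrow> t \<notin> S \<Longrightarrow> (U, \<phi>) \<in> \<A> \<Longrightarrow>
      \<gamma> t \<in> U \<Longrightarrow> C1_at (\<phi> \<circ> \<gamma>) t"
    using surface_path_C1[OF sp] by blast
  define w where "w = v \<circ> \<gamma>"
  have "continuous_on (\<gamma> ` {0..1}) v"
    using np log_primitive_isCont[OF \<eta>] by (intro continuous_at_imp_continuous_on) auto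
  hence "continuous_on {0..1} w"
    unfolding w_def using path unfolding path_def by (intro continuous_on_compose)
  moreover have "w t \<noteq> 0" if "t \<in> {0..1}" for t
    using np[of t] log_primitive_nonzero[OF \<eta>] that by (auto simp: w_def)
  ultimately obtain L where L: "continuous_on {0..1} L" "\<And>t. t \<in> {0..1} \<Longrightarrow> w t = exp (L t)"
    using continuous_logarithm_on_contractible[of "{0..1}" w] convex_imp_contractible[of "{0..1::real}"]
    by (metis convex_real_interval(5))
  have L': "(L has_vector_derivative 2 * (\<eta> (U, \<phi>) (\<phi> (\<gamma> t)) * vector_derivative (\<phi> \<circ> \<gamma>) (at t))) (at t)"
    if t: "0 < t" "t < 1" "t \<notin> S" and ch: "(U, \<phi>) \<in> \<A>" "\<gamma> t \<in> U" for t U \<phi>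
  proof (rule continuous_logarithm_has_vector_derivative)
    show "isCont L t"
      using L(1) t by (intro continuous_on_interior[of "{0..1}"]) (auto simp: interior_atLeastAtMost_real)
    have "\<forall>\<^sub>F s in nhds t. s \<in> {0<..<1}"
      using t by (intro eventually_nhds_in_open) auto
    thus "\<forall>\<^sub>F s in nhds t. w s = exp (L s)"
      by eventually_elim (use L(2) in auto)
    have "(\<phi> \<circ> \<gamma> has_vector_derivative vector_derivative (\<phi> \<circ> \<gamma>) (at t)) (at t)"
      using S(2)[OF t ch] by (rule C1_at_has_vector_derivative)
    moreover have "((\<lambda>z. v (inv_into U \<phi> z)) has_field_derivative 2 * \<eta> (U, \<phi>) (\<phi> (\<gamma> t)) * v (\<gamma> t))
        (at ((\<phi> \<circ> \<gamma>) t))"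
      using log_primitive_has_derivative[OF \<eta> np ch] t by simp
    ultimately have "((\<lambda>z. v (inv_into U \<phi> z)) \<circ> (\<phi> \<circ> \<gamma>) has_vector_derivative
        vector_derivative (\<phi> \<circ> \<gamma>) (at t) * (2 * \<eta> (U, \<phi>) (\<phi> (\<gamma> t)) * v (\<gamma> t))) (at t)"
      by (rule field_vector_diff_chain_at)
    moreover have "\<forall>\<^sub>F s in nhds t. ((\<lambda>z. v (inv_into U \<phi> z)) \<circ> (\<phi> \<circ> \<gamma>)) s = w s"
      using isCont_eventually_nhds[OF path_isCont[OF path t(1,2)] chart_open[OF ch(1)] ch(2)]
      by eventually_elim (simp add: w_def chart_inv[OF ch(1)])
    ultimately have "(w has_vector_derivative
        vector_derivative (\<phi> \<circ> \<gamma>) (at t) * (2 * \<eta> (U, \<phi>) (\<phi> (\<gamma> t)) * v (\<gamma> t))) (at t)"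
      by (rule has_vector_derivative_cong_nhds)
    thus "(w has_vector_derivative 2 * (\<eta> (U, \<phi>) (\<phi> (\<gamma> t)) * vector_derivative (\<phi> \<circ> \<gamma>) (at t)) * w t) (at t)"
      by (simp add: w_def mult_ac)
  qed
  have "((\<lambda>t. vector_derivative L (at t)) has_integral (L 1 - L 0)) {0..1}"
  proof (rule fundamental_theorem_of_calculus_interior_strong[OF S(1) _ _ L(1)])
    fix t :: real assume "t \<in> {0<..<1} - S"
    moreover obtain U \<phi> where "(U, \<phi>) \<in> \<A>" "\<gamma> t \<in> U" by (rule obtain_chart)
    ultimately show "(L has_vector_derivative vector_derivative L (at t)) (at t)"
      using L'[of t U \<phi>] vector_derivative_at by fastforce
  qed auto
  hence "((\<lambda>t. vector_derivative L (at t) / 2) has_integral ((L 1 - L 0) / 2)) {0..1}"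
    by (rule has_integral_divide)
  hence "has_form_integral \<A> \<eta> \<gamma> ((L 1 - L 0) / 2)"
    by (rule has_form_integralI[OF _ S(1)]) (use L' vector_derivative_at in fastforce)
  thus ?thesis
    using that[of L] L(2) by (simp add: w_def pathstart_def pathfinish_def)
qed

lemma log_primitive_exp_integral:
  assumes "log_primitive \<eta> v" "pole_free_path \<A> \<eta> \<gamma>" "has_form_integral \<A> \<eta> \<gamma> I"
  shows "v (pathfinish \<gamma>) = v (pathstart \<gamma>) * exp I ^ 2"
proof -
  obtain L where L: "has_form_integral \<A> \<eta> \<gamma> ((L (1::real) - L 0) / 2)"
    "exp (L 0) = v (pathstart \<gamma>)" "exp (L 1) = v (pathfinish \<gamma>)"
    using log_primitive_integral[OF assms(1,2)] by blast
  have "2 * I = L 1 - L 0"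
    by (simp only: has_form_integral_unique[OF assms(3) L(1)], simp)
  hence "exp I ^ 2 = exp (L 1 - L 0)"
    using exp_double[of I] by (simp only:)
  thus ?thesis
    by (simp add: exp_diff flip: L(2,3))
qed

text \<open>Around a loop \<open>L\<close> changes by an element of 2 pi i Z; the halving in the
  integral turns this into pi i Z.\<close>

lemma log_primitive_periods:
  assumes "log_primitive \<eta> v"
  shows "periods_in_pi_i_Z \<A> \<eta>"
  unfolding periods_in_pi_i_Z_def
proof (intro allI impI, elim conjE)
  fix \<gamma> assume \<gamma>: "pole_free_path \<A> \<eta> \<gamma>" "pathfinish \<gamma> = pathstart \<gamma>"
  obtain L where L: "has_form_integral \<A> \<eta> \<gamma> ((L (1::real) - L 0) / 2)"
    "exp (L 0) = v (pathstart \<gamma>)" "exp (L 1) = v (pathfinish \<gamma>)"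
    using log_primitive_integral[OF assms \<gamma>(1)] by blast
  have "exp (L 1) = exp (L 0)" using L \<gamma>(2) by simp
  then obtain n :: int where "L 1 = L 0 + (of_int (2 * n) * pi) * \<i>"
    by (auto simp: exp_eq)
  hence "(L 1 - L 0) / 2 = of_int n * (of_real pi * \<i>)" by simp
  with L(1) show "\<exists>k::int. has_form_integral \<A> \<eta> \<gamma> (of_int k * (of_real pi * \<i>))"
    by metis
qed

text \<open>Compares xi with a square \<open>v\<close> obtained by other means: squaring removes the
  dependence on the path, and the base point fixes the ratio.\<close>

lemma xi_values_square:
  assumes "log_primitive \<eta> v" "x \<in> xi_values \<A> \<eta> c z0 p"
  shows "x\<^sup>2 * v z0 = c\<^sup>2 * v p"
  using assms(2) log_primitive_exp_integral[OF assms(1)]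
  by (auto simp: xi_values_def power_mult_distrib)

lemma xi_values_nonempty:
  assumes "meromorphic_form \<A> \<eta>" "\<not> form_pole \<A> \<eta> z0" "\<not> form_pole \<A> \<eta> p"
  shows "xi_values \<A> \<eta> c z0 p \<noteq> {}"
proof -
  obtain \<gamma> I where "pole_free_path \<A> \<eta> \<gamma>" "pathstart \<gamma> = z0" "pathfinish \<gamma> = p"
    "has_form_integral \<A> \<eta> \<gamma> I"
    using pole_free_path_exists[OF assms] .
  hence "c * exp I \<in> xi_values \<A> \<eta> c z0 p" unfolding xi_values_def by blast
  thus ?thesis by blast
qed

lemma xi_values_nonpole:
  "x \<in> xi_values \<A> \<eta> c z0 p \<Longrightarrow> \<not> form_pole \<A> \<eta> p"
  unfolding xi_values_def pole_free_path_def using pathfinish_in_path_image by blast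

text \<open>The generic counterpart of \<open>log_primitive\<close>: the equation is asked off a
  discrete set, and meromorphy at the poles of \<open>\<eta>\<close> is included. This is the
  information that the entries of a given curve supply.\<close>

definition half_log_derivative :: "('a \<Rightarrow> complex) \<Rightarrow> 'a one_form \<Rightarrow> bool" where
  "half_log_derivative u \<eta> \<longleftrightarrow> surface_meromorphic u \<and> (\<forall>p. \<forall>\<^sub>F q in at p. u q \<noteq> 0) \<and>
     (\<forall>(U, \<phi>)\<in>\<A>. \<forall>p\<in>U. \<forall>\<^sub>F z in at (\<phi> p).
        deriv (\<lambda>z. u (inv_into U \<phi> z)) z = 2 * \<eta> (U, \<phi>) z * u (inv_into U \<phi> z))"

lemma half_log_derivativeD:
  assumes "half_log_derivative u \<eta>" "(U, \<phi>) \<in> \<A>" "p \<in> U"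
  shows "(\<lambda>z. u (inv_into U \<phi> z)) meromorphic_on {\<phi> p}"
    and "\<forall>\<^sub>F z in at (\<phi> p). u (inv_into U \<phi> z) \<noteq> 0"
    and "\<forall>\<^sub>F z in at (\<phi> p). deriv (\<lambda>z. u (inv_into U \<phi> z)) z = 2 * \<eta> (U, \<phi>) z * u (inv_into U \<phi> z)"
proof -
  have "(\<lambda>z. u (inv_into U \<phi> z)) meromorphic_on \<phi> ` U"
    using assms surface_meromorphicD by (auto simp: half_log_derivative_def)
  thus "(\<lambda>z. u (inv_into U \<phi> z)) meromorphic_on {\<phi> p}"
    by (rule meromorphic_on_subset) (use assms in auto)
  show "\<forall>\<^sub>F z in at (\<phi> p). u (inv_into U \<phi> z) \<noteq> 0"
    using assms eventually_chart_inv[OF assms(2,3), of "\<lambda>q. u q \<noteq> 0"] by (auto simp: half_log_derivative_def)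
  show "\<forall>\<^sub>F z in at (\<phi> p). deriv (\<lambda>z. u (inv_into U \<phi> z)) z = 2 * \<eta> (U, \<phi>) z * u (inv_into U \<phi> z)"
    using assms unfolding half_log_derivative_def by blast
qed

lemma half_log_derivative_simple_poles:
  assumes "half_log_derivative u \<eta>"
  shows "only_simple_poles \<A> \<eta>"
  unfolding only_simple_poles_def
proof (intro ballI, clarify)
  fix U \<phi> p assume "(U, \<phi>) \<in> \<A>" "p \<in> U" and pole: "is_pole (\<eta> (U, \<phi>)) (\<phi> p)"
  from logarithmic_derivative_at(1)[OF half_log_derivativeD[OF assms this(1,2)] pole]
  show "zorder (\<eta> (U, \<phi>)) (\<phi> p) = -1" .
qed

text \<open>The values of \<open>u\<close> at isolated points are arbitrary and are first replaced
  by limits. At a regular point of \<open>\<eta>\<close> the function then coincides with an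
  analytic unit, for which the generic equation extends to the point itself.\<close>

lemma half_log_derivative_log_primitive:
  assumes u: "half_log_derivative u \<eta>" and \<eta>: "meromorphic_form \<A> \<eta>"
  obtains v where "log_primitive \<eta> v" "\<And>p. \<forall>\<^sub>F q in at p. v q = u q"
proof -
  define v where "v q = finite_part (sphere_extension u q)" for q
  have mu: "surface_meromorphic u" using u by (simp add: half_log_derivative_def)
  have vu: "\<forall>\<^sub>F q in at p. v q = u q" for p
    unfolding v_def by (rule eventually_sphere_extension[OF mu])
  have "v p \<noteq> 0 \<and> ((\<lambda>z. v (inv_into U \<phi> z)) has_field_derivative 2 * \<eta> (U, \<phi>) (\<phi> p) * v p) (at (\<phi> p))"
    if ch: "(U, \<phi>) \<in> \<A>" "p \<in> U" and np: "\<not> form_pole \<A> \<eta> p" for U \<phi> p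
  proof -
    have "\<not> is_pole (\<eta> (U, \<phi>)) (\<phi> p)" using form_pole_iff[OF \<eta> ch] np by simp
    from logarithmic_derivative_at(2)[OF half_log_derivativeD[OF u ch] this]
    obtain g where g: "g analytic_on {\<phi> p}" "g (\<phi> p) \<noteq> 0" "\<forall>\<^sub>F w in at (\<phi> p). u (inv_into U \<phi> w) = g w"
      by blast
    have nice: "(\<lambda>z. v (inv_into U \<phi> z)) nicely_meromorphic_on (\<phi> ` U)"
      using meromorphic_function_sphere_extension[OF mu] ch(1)
      by (auto simp: meromorphic_function_def in_chart_eq v_def)
    have vg: "\<forall>\<^sub>F w in at (\<phi> p). v (inv_into U \<phi> w) = g w"
      using g(3) vu[of p] eventually_chart_inv[OF ch, of "\<lambda>q. v q = u q"]
      by (auto elim: eventually_elim2)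
    have vgp: "v (inv_into U \<phi> (\<phi> p)) = g (\<phi> p)"
      using nicely_meromorphic_eqI[OF nice analytic_on_imp_nicely_meromorphic_on[OF g(1)] _ _ vg] ch by auto
    have "\<forall>\<^sub>F w in nhds (\<phi> p). v (inv_into U \<phi> w) = g w"
      using vg vgp by (simp add: eventually_nhds_conv_at)
    moreover have "(g has_field_derivative deriv g (\<phi> p)) (at (\<phi> p))"
      using analytic_on_imp_differentiable_at[OF g(1)] DERIV_deriv_iff_field_differentiable by auto
    ultimately have dv: "((\<lambda>z. v (inv_into U \<phi> z)) has_field_derivative deriv g (\<phi> p)) (at (\<phi> p))"
      by (auto elim: has_field_derivative_cong_nhds simp: eq_commute)
    have "\<forall>\<^sub>F w in at (\<phi> p). deriv g w = 2 * \<eta> (U, \<phi>) w * g w"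
      using half_log_derivativeD(3)[OF u ch] eventually_at_eventually_nhds[OF g(3)]
    proof eventually_elim
      case (elim w)
      have "deriv (\<lambda>z. u (inv_into U \<phi> z)) w = deriv g w"
        using elim(2) by (intro deriv_cong_ev) auto
      thus ?case using elim eventually_nhds_x_imp_x[OF elim(2)] by simp
    qed
    moreover have "\<eta> (U, \<phi>) analytic_on {\<phi> p}" by (rule form_analytic_at[OF \<eta> ch np])
    ultimately have "deriv g (\<phi> p) = 2 * \<eta> (U, \<phi>) (\<phi> p) * g (\<phi> p)"
      using g(1)
      by (intro nicely_meromorphic_eqI[of "deriv g" "{\<phi> p}" "\<lambda>w. 2 * \<eta> (U, \<phi>) w * g w" "{\<phi> p}"]
          analytic_on_imp_nicely_meromorphic_on analytic_intros) auto
    thus ?thesis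
      using dv vgp g(2) chart_inv[OF ch] by simp
  qed
  hence "log_primitive \<eta> v" unfolding log_primitive_def by blast
  thus ?thesis using that vu by blast
qed

section \<open>The square of xi built from the period condition\<close>

context
  fixes \<eta> :: "'a one_form" and c :: complex and z0 :: 'a
  assumes \<eta>: "meromorphic_form \<A> \<eta>" and simple: "only_simple_poles \<A> \<eta>"
    and periods: "periods_in_pi_i_Z \<A> \<eta>" and z0: "\<not> form_pole \<A> \<eta> z0" and c: "c \<noteq> 0"
begin

text \<open>One path followed by the reverse of the other is a loop, so the two integrals differ by
  a multiple of pi i and the exponentials at most by a sign.\<close>

lemma xi_values_square_unique:
  assumes "x \<in> xi_values \<A> \<eta> c z0 p" "y \<in> xi_values \<A> \<eta> c z0 p"
  shows "x\<^sup>2 = y\<^sup>2"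
proof -
  obtain I \<gamma> J \<delta> where \<gamma>: "x = c * exp I" "pole_free_path \<A> \<eta> \<gamma>" "pathstart \<gamma> = z0" "pathfinish \<gamma> = p"
    "has_form_integral \<A> \<eta> \<gamma> I" and \<delta>: "y = c * exp J" "pole_free_path \<A> \<eta> \<delta>" "pathstart \<delta> = z0" "pathfinish \<delta> = p"
    "has_form_integral \<A> \<eta> \<delta> J"
    using assms unfolding xi_values_def by blast
  have sp: "surface_path \<A> \<gamma>" "surface_path \<A> (reversepath \<delta>)" "pathfinish \<gamma> = pathstart (reversepath \<delta>)"
    using \<gamma> \<delta> by (auto simp: pole_free_path_def surface_path_reverse)
  have "pole_free_path \<A> \<eta> (\<gamma> +++ reversepath \<delta>)"
    using \<gamma> \<delta> sp by (auto simp: pole_free_path_def surface_path_join path_image_join)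
  then obtain k :: int where "has_form_integral \<A> \<eta> (\<gamma> +++ reversepath \<delta>) (of_int k * (of_real pi * \<i>))"
    using periods \<gamma> \<delta> unfolding periods_in_pi_i_Z_def by fastforce
  moreover have "has_form_integral \<A> \<eta> (\<gamma> +++ reversepath \<delta>) (I + - J)"
    using \<gamma> \<delta> by (intro has_form_integral_join sp has_form_integral_reverse) (auto simp: pole_free_path_def)
  ultimately have "of_int k * (of_real pi * \<i>) = I + - J"
    by (rule has_form_integral_unique)
  hence "I = J + of_int k * (of_real pi * \<i>)"
    by simp
  hence "2 * I = 2 * J + of_int (2 * k) * of_real pi * \<i>"
    by simp
  hence "exp (2 * I) = exp (2 * J)"
    unfolding exp_eq by (auto intro!: exI[of _ k])
  thus ?thesis
    by (simp add: \<gamma>(1) \<delta>(1) power_mult_distrib exp_double)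
qed

text \<open>At a pole of \<open>\<eta>\<close> there are no values to choose from, and 0 serves as
  default.\<close>

definition xi_square :: "'a \<Rightarrow> complex" where
  "xi_square p = (if form_pole \<A> \<eta> p then 0 else (SOME x. x \<in> xi_values \<A> \<eta> c z0 p)\<^sup>2)"

lemma xi_square_eq: "x \<in> xi_values \<A> \<eta> c z0 p \<Longrightarrow> xi_square p = x\<^sup>2"
  using xi_values_square_unique someI[of "\<lambda>x. x \<in> xi_values \<A> \<eta> c z0 p" x] xi_values_nonpole
  by (metis xi_square_def)

text \<open>To reach a point near \<open>p\<close>, a fixed path to \<open>p\<close> is prolonged by
  a straight segment in the chart; this multiplies xi by the exponential of an increment of a
  primitive \<open>H\<close> of the coefficient, which can be differentiated.\<close>

lemma log_primitive_xi_square: "log_primitive \<eta> xi_square"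
  unfolding log_primitive_def
proof (intro ballI, clarify)
  fix U \<phi> p assume ch: "(U, \<phi>) \<in> \<A>" "p \<in> U" and np: "\<not> form_pole \<A> \<eta> p"
  have "\<eta> (U, \<phi>) analytic_on {\<phi> p}" by (rule form_analytic_at[OF \<eta> ch np])
  then obtain e0 where e0: "e0 > 0" "\<eta> (U, \<phi>) holomorphic_on ball (\<phi> p) e0"
    by (auto simp: analytic_on_def)
  obtain e1 where e1: "e1 > 0" "ball (\<phi> p) e1 \<subseteq> \<phi> ` U"
    using chart_open_image[OF ch(1)] ch(2) by (meson image_eqI openE)
  define B where "B = ball (\<phi> p) (min e0 e1)"
  have B: "\<eta> (U, \<phi>) holomorphic_on B" "B \<subseteq> \<phi> ` U" "open B" "convex B" "\<phi> p \<in> B"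
    using e0 e1 by (auto simp: B_def intro: holomorphic_on_subset)
  have npB: "\<not> form_pole \<A> \<eta> (inv_into U \<phi> z)" if "z \<in> B" for z
  proof -
    have "\<eta> (U, \<phi>) analytic_on {z}" using B that by (intro holomorphic_on_imp_analytic_at[of _ B])
    hence "\<not> is_pole (\<eta> (U, \<phi>)) z" by (rule analytic_at_imp_no_pole)
    moreover have "inv_into U \<phi> z \<in> U" "\<phi> (inv_into U \<phi> z) = z"
      using that B(2) chart_inv_in[of z \<phi> U] chart_of_inv[of z \<phi> U] by auto
    ultimately show ?thesis using form_pole_iff[OF \<eta> ch(1)] by auto
  qed
  obtain H where H: "\<And>z. z \<in> B \<Longrightarrow> (H has_field_derivative \<eta> (U, \<phi>) z) (at z within B)"
    using holomorphic_convex_primitive'[OF B(4,3,1)] B(3) by (metis at_within_open)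
  obtain x where x: "x \<in> xi_values \<A> \<eta> c z0 p"
    using xi_values_nonempty[OF \<eta> z0 np] by blast
  then obtain I \<gamma> where \<gamma>: "x = c * exp I" "pole_free_path \<A> \<eta> \<gamma>" "pathstart \<gamma> = z0" "pathfinish \<gamma> = p"
    "has_form_integral \<A> \<eta> \<gamma> I"
    unfolding xi_values_def by blast
  have eq: "xi_square (inv_into U \<phi> z) = x\<^sup>2 * exp (2 * (H z - H (\<phi> p)))" if z: "z \<in> B" for z
  proof -
    define \<beta> where "\<beta> = linepath (\<phi> p) z"
    have im: "path_image \<beta> \<subseteq> B"
      unfolding \<beta>_def using B z by (simp add: closed_segment_subset)
    hence im': "path_image \<beta> \<subseteq> \<phi> ` U" using B(2) by blast
    have vp: "valid_path \<beta>" by (simp add: \<beta>_def)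
    have "(\<eta> (U, \<phi>) has_contour_integral (H (pathfinish \<beta>) - H (pathstart \<beta>))) \<beta>"
      by (rule contour_integral_primitive[OF H vp im])
    hence I': "has_form_integral \<A> \<eta> (inv_into U \<phi> \<circ> \<beta>) (H z - H (\<phi> p))"
      using has_form_integral_chart_path[OF ch(1) vp im' \<eta>] by (simp add: \<beta>_def)
    have sp: "surface_path \<A> (inv_into U \<phi> \<circ> \<beta>)" by (rule surface_path_chart_path[OF ch(1) vp im'])
    have ends: "pathstart (inv_into U \<phi> \<circ> \<beta>) = p" "pathfinish (inv_into U \<phi> \<circ> \<beta>) = inv_into U \<phi> z"
      using chart_inv[OF ch] by (auto simp: \<beta>_def pathstart_compose pathfinish_compose)
    have sp\<gamma>: "surface_path \<A> \<gamma>" using \<gamma>(2) by (simp add: pole_free_path_def)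
    have "pole_free_path \<A> \<eta> (\<gamma> +++ (inv_into U \<phi> \<circ> \<beta>))"
      using surface_path_join[OF sp\<gamma> sp] \<gamma>(2,4) ends im npB
      by (auto simp: pole_free_path_def path_image_join path_image_compose)
    moreover have "has_form_integral \<A> \<eta> (\<gamma> +++ (inv_into U \<phi> \<circ> \<beta>)) (I + (H z - H (\<phi> p)))"
      using ends \<gamma> by (intro has_form_integral_join sp sp\<gamma> I') auto
    ultimately have "c * exp (I + (H z - H (\<phi> p))) \<in> xi_values \<A> \<eta> c z0 (inv_into U \<phi> z)"
      unfolding xi_values_def using \<gamma>(3) ends by fastforce
    from xi_square_eq[OF this] show ?thesis
      by (simp add: \<gamma>(1) exp_add power_mult_distrib exp_double del: right_diff_distrib_numeral)
  qed
  have xp: "xi_square p = x\<^sup>2" by (rule xi_square_eq[OF x])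
  have "((\<lambda>z. x\<^sup>2 * exp (2 * (H z - H (\<phi> p)))) has_field_derivative 2 * \<eta> (U, \<phi>) (\<phi> p) * xi_square p) (at (\<phi> p))"
    using H[OF B(5)] at_within_open[OF B(5,3)] xp by (auto intro!: derivative_eq_intros)
  moreover have "\<forall>\<^sub>F z in nhds (\<phi> p). x\<^sup>2 * exp (2 * (H z - H (\<phi> p))) = xi_square (inv_into U \<phi> z)"
    using eventually_nhds_in_open[OF B(3,5)] by eventually_elim (simp add: eq)
  ultimately have "((\<lambda>z. xi_square (inv_into U \<phi> z)) has_field_derivative 2 * \<eta> (U, \<phi>) (\<phi> p) * xi_square p) (at (\<phi> p))"
    by (subst (asm) DERIV_cong_ev[OF refl _ refl])
  thus "xi_square p \<noteq> 0 \<and> ((\<lambda>z. xi_square (inv_into U \<phi> z)) has_field_derivative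
      2 * \<eta> (U, \<phi>) (\<phi> p) * xi_square p) (at (\<phi> p))"
    using xp \<gamma>(1) c by simp
qed

lemma surface_meromorphic_xi_square: "surface_meromorphic xi_square"
  unfolding surface_meromorphic_def
proof (intro ballI, clarify)
  fix U \<phi> assume ch: "(U, \<phi>) \<in> \<A>"
  show "(\<lambda>z. xi_square (inv_into U \<phi> z)) meromorphic_on \<phi> ` U"
  proof (subst meromorphic_on_meromorphic_at, safe)
    fix p assume p: "p \<in> U"
    obtain e where e: "e > 0" "\<And>z. z \<in> ball (\<phi> p) e - {\<phi> p} \<Longrightarrow> z \<in> \<phi> ` U \<and> \<not> form_pole \<A> \<eta> (inv_into U \<phi> z)"
      by (rule pole_free_punctured_disc[OF \<eta> ch p]) (rule that)
    have deriv: "((\<lambda>z. xi_square (inv_into U \<phi> z)) has_field_derivative 2 * \<eta> (U, \<phi>) z * xi_square (inv_into U \<phi> z)) (at z)"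
      if "z \<in> ball (\<phi> p) e - {\<phi> p}" for z
      using log_primitive_has_derivative[OF log_primitive_xi_square conjunct2[OF e(2)[OF that]] ch]
        chart_inv_in[of z \<phi> U] chart_of_inv[of z \<phi> U] e(2)[OF that] by simp
    show "(\<lambda>z. xi_square (inv_into U \<phi> z)) meromorphic_on {\<phi> p}"
    proof (cases "form_pole \<A> \<eta> p")
      case False
      have "(\<lambda>z. xi_square (inv_into U \<phi> z)) holomorphic_on ball (\<phi> p) e"
      proof (subst holomorphic_on_open[OF open_ball], rule ballI)
        fix z assume "z \<in> ball (\<phi> p) e"
        thus "\<exists>f'. ((\<lambda>z. xi_square (inv_into U \<phi> z)) has_field_derivative f') (at z)"
          using deriv[of z] log_primitive_has_derivative[OF log_primitive_xi_square False ch p]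
          by (cases "z = \<phi> p") blast+
      qed
      thus ?thesis
        using e(1) by (intro analytic_on_imp_meromorphic_on holomorphic_on_imp_analytic_at[of _ "ball (\<phi> p) e"]) auto
    next
      case True
      have pole: "is_pole (\<eta> (U, \<phi>)) (\<phi> p)" using form_pole_iff[OF \<eta> ch p] True by simp
      \<comment> \<open>Radius e / 2 keeps the circle inside the punctured disc, so no other pole
        contributes: its integral is 2 pi i times the residue, and by the period condition it is k
        pi i.\<close>
      define \<beta> where "\<beta> = circlepath (\<phi> p) (e / 2)"
      have im: "path_image \<beta> \<subseteq> ball (\<phi> p) e - {\<phi> p}"
        using e(1) by (auto simp: \<beta>_def)
      hence im': "path_image \<beta> \<subseteq> \<phi> ` U" using e(2) by blast
      have vp: "valid_path \<beta>" by (simp add: \<beta>_def)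
      have "\<eta> (U, \<phi>) holomorphic_on ball (\<phi> p) e - {\<phi> p}"
        by (rule form_holomorphic_on[OF \<eta> ch e(2)])
      hence "(\<eta> (U, \<phi>) has_contour_integral 2 * pi * \<i> * residue (\<eta> (U, \<phi>)) (\<phi> p)) \<beta>"
        unfolding \<beta>_def using e(1) by (intro base_residue[of "ball (\<phi> p) e"]) auto
      hence I: "has_form_integral \<A> \<eta> (inv_into U \<phi> \<circ> \<beta>) (2 * pi * \<i> * residue (\<eta> (U, \<phi>)) (\<phi> p))"
        by (rule has_form_integral_chart_path[OF ch vp im' \<eta>])
      have "pole_free_path \<A> \<eta> (inv_into U \<phi> \<circ> \<beta>)"
        using surface_path_chart_path[OF ch vp im'] e(2)[OF subsetD[OF im]]
        by (auto simp: pole_free_path_def path_image_compose)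
      moreover have "pathfinish (inv_into U \<phi> \<circ> \<beta>) = pathstart (inv_into U \<phi> \<circ> \<beta>)"
        by (simp add: pathfinish_compose pathstart_compose \<beta>_def)
      ultimately obtain k :: int where "has_form_integral \<A> \<eta> (inv_into U \<phi> \<circ> \<beta>) (of_int k * (of_real pi * \<i>))"
        using periods unfolding periods_in_pi_i_Z_def by blast
      from has_form_integral_unique[OF I this]
      have "2 * residue (\<eta> (U, \<phi>)) (\<phi> p) = of_int k" by simp
      moreover
      have zo: "zorder (\<eta> (U, \<phi>)) (\<phi> p) = -1"
        using simple ch p pole unfolding only_simple_poles_def by blast
      moreover have "\<eta> (U, \<phi>) meromorphic_on {\<phi> p}"
        using meromorphic_form_meromorphic[OF \<eta> ch] by (rule meromorphic_on_subset) (use p in auto)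
      ultimately show ?thesis
        using meromorphic_at_if_half_integer_residue[OF e(1) deriv _ pole zo] by blast
    qed
  qed
qed

end

end

section \<open>The curve given by the representation formula\<close>

text \<open>The notation of \<open>fps_nth\<close> is still active in the imported theories; with it, every occurrence
  of \<open>$\<close> is ambiguous.\<close>

no_notation fps_nth (infixl "$" 75)

section \<open>Two by two matrices and their classes modulo sign\<close>

lemma mat22_entries [simp]:
  "mat22 a b c d $ 1 $ 1 = a" "mat22 a b c d $ 1 $ 2 = b"
  "mat22 a b c d $ 2 $ 1 = c" "mat22 a b c d $ 2 $ 2 = d"
  by (simp_all add: mat22_def)

lemma mat22_eqI:
  fixes X Y :: matrix2
  assumes "X $ 1 $ 1 = Y $ 1 $ 1" "X $ 1 $ 2 = Y $ 1 $ 2" "X $ 2 $ 1 = Y $ 2 $ 1" "X $ 2 $ 2 = Y $ 2 $ 2"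
  shows "X = Y"
  using assms by (simp add: vec_eq_iff forall_2)

lemma det_mat22: "det (mat22 a b c d) = a * d - b * c"
  by (simp add: det_2)

lemma uminus_mat22: "- mat22 a b c d = mat22 (- a) (- b) (- c) (- d)"
  by (rule mat22_eqI) simp_all

lemma matrix_inv_mult_mat22:
  fixes X Y :: matrix2
  assumes "det X = 1"
  shows "matrix_inv X ** Y = mat22
     (X $ 2 $ 2 * Y $ 1 $ 1 - X $ 1 $ 2 * Y $ 2 $ 1) (X $ 2 $ 2 * Y $ 1 $ 2 - X $ 1 $ 2 * Y $ 2 $ 2)
     (X $ 1 $ 1 * Y $ 2 $ 1 - X $ 2 $ 1 * Y $ 1 $ 1) (X $ 1 $ 1 * Y $ 2 $ 2 - X $ 2 $ 1 * Y $ 1 $ 2)"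
proof -
  \<comment> \<open>The adjugate, which is the inverse since the determinant is 1.\<close>
  define Z where "Z = mat22 (X $ 2 $ 2) (- X $ 1 $ 2) (- X $ 2 $ 1) (X $ 1 $ 1)"
  have ZX: "Z ** X = mat 1"
    using assms by (intro mat22_eqI) (auto simp: Z_def matrix_matrix_mult_def mat_def sum_2 det_2 algebra_simps)
  have "invertible X" using assms by (simp add: invertible_det_nz)
  hence "X ** matrix_inv X = mat 1"
    unfolding invertible_def matrix_inv_def by (rule someI_ex[THEN conjunct1])
  hence "Z ** X ** matrix_inv X = Z"
    by (simp flip: matrix_mul_assoc)
  hence "matrix_inv X = Z" using ZX by simp
  thus ?thesis
    by (intro mat22_eqI) (auto simp: Z_def matrix_matrix_mult_def sum_2)
qed

lemma pm_class_uminus [simp]: "pm_class (- X) = pm_class X"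
  by (auto simp: pm_class_def)

lemma pm_class_self [simp]: "X \<in> pm_class X"
  by (simp add: pm_class_def)

lemma representation_matrix_uminus: "representation_matrix g gs (- x) = - representation_matrix g gs x"
  by (simp add: representation_matrix_def uminus_mat22)

lemma pm_class_representation_matrix_cong:
  assumes "x\<^sup>2 = y\<^sup>2"
  shows "pm_class (representation_matrix g gs x) = pm_class (representation_matrix g gs y)"
  using assms by (auto simp: power2_eq_iff representation_matrix_uminus)

text \<open>Each relation is homogeneous linear or even in the entries, hence valid for both
  representatives of the class.\<close>

lemma representation_matrix_entries:
  assumes "X \<in> pm_class (representation_matrix g gs x)" "g \<noteq> gs" "x \<noteq> 0"
  shows "X $ 1 $ 1 = g * X $ 2 $ 1" "X $ 1 $ 2 = gs * X $ 2 $ 2"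
    "(X $ 2 $ 1)\<^sup>2 * x\<^sup>2 = 1" "X $ 2 $ 1 * X $ 2 $ 2 * (g - gs) = 1"
  using assms by (auto simp: pm_class_def representation_matrix_def field_simps)

text \<open>Dividing by \<open>f z\<close> moves the argument of \<open>Ln\<close> to 1, away from
  the branch cut, whatever nonzero value \<open>f z\<close> has.\<close>

lemma analytic_square_root:
  assumes "f analytic_on {z}" "f z \<noteq> 0"
  obtains r where "r analytic_on {z}" "\<forall>\<^sub>F w in nhds z. (r w)\<^sup>2 = f w" "\<forall>\<^sub>F w in nhds z. f w \<noteq> 0"
proof -
  define r where "r w = csqrt (f z) * exp (Ln (f w / f z) / 2)" for w
  have "r analytic_on {z}"
    unfolding r_def using assms by (intro analytic_intros) auto
  moreover have nz: "\<forall>\<^sub>F w in nhds z. f w \<noteq> 0"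
    using analytic_at_imp_isCont[OF assms(1)] isCont_eventually_nhds[of z f "- {0}"] assms(2) by auto
  moreover have "\<forall>\<^sub>F w in nhds z. (r w)\<^sup>2 = f w"
    using nz
  proof eventually_elim
    case (elim w)
    have "(r w)\<^sup>2 = f z * exp (2 * (Ln (f w / f z) / 2))"
      unfolding r_def exp_double by (simp add: power_mult_distrib)
    thus ?case using elim assms(2) by simp
  qed
  ultimately show ?thesis using that by blast
qed

lemma tendsto_inverse_at_infinity:
  fixes f :: "'a \<Rightarrow> complex"
  assumes "filterlim f at_infinity F"
  shows "((\<lambda>x. inverse (f x)) \<longlongrightarrow> 0) F"
  using filterlim_compose[OF tendsto_inverse_0 assms] .

lemma eventually_analytic_at:
  fixes f :: "complex \<Rightarrow> complex"
  assumes "f analytic_on {z}"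
  shows "\<forall>\<^sub>F w in nhds z. f analytic_on {w}"
proof -
  obtain S where S: "open S" "z \<in> S" "f holomorphic_on S"
    using assms by (auto simp: analytic_at)
  thus ?thesis
    using eventually_nhds_in_open[OF S(1,2)]
    by (auto elim!: eventually_mono intro: holomorphic_on_imp_analytic_at)
qed

lemma analytic_eventually_eq_0:
  assumes "f analytic_on {z}" "\<forall>\<^sub>F w in at z. f w = 0"
  shows "f z = 0"
  using nicely_meromorphic_eqI[of f "{z}" "\<lambda>_. 0" "{z}" z] assms
    analytic_on_imp_nicely_meromorphic_on by auto

section \<open>Holomorphic lifts and generic points\<close>

context surface
begin

lemma eventually_generic:
  assumes "meromorphic_function \<A> G" "meromorphic_function \<A> Gs" "G \<noteq> Gs"
  shows "\<forall>\<^sub>F q in at p. \<not> form_pole \<A> (gauss_form G Gs) q \<and> G q \<noteq> Infty \<and> Gs q \<noteq> Infty \<and>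
    finite_part (G q) \<noteq> finite_part (Gs q)"
  using eventually_not_form_pole[OF meromorphic_form_gauss[OF assms(1,2)]]
    meromorphic_function_eventually_finite[OF assms(1)] meromorphic_function_eventually_finite[OF assms(2)]
    meromorphic_function_neqD[OF assms] by eventually_elim blast

lemma holomorphic_lift_analytic:
  assumes "holomorphic_lift E (U, \<phi>) W X" "z \<in> W"
  shows "(\<lambda>w. X w $ i $ j) analytic_on {z}"
  using assms by (auto simp: holomorphic_lift_def intro!: holomorphic_on_imp_analytic_at[of _ W])

lemma holomorphic_lift_has_derivative:
  assumes "holomorphic_lift E (U, \<phi>) W X" "z \<in> W"
  shows "((\<lambda>w. X w $ i $ j) has_field_derivative matrix_deriv X z $ i $ j) (at z)"
  using DERIV_deriv_iff_field_differentiable[THEN iffD2,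
      OF analytic_on_imp_differentiable_at[OF holomorphic_lift_analytic[OF assms]]]
  by (simp add: matrix_deriv_def)

lemma holomorphic_lift_deriv_analytic:
  assumes "holomorphic_lift E (U, \<phi>) W X" "z \<in> W"
  shows "(\<lambda>w. matrix_deriv X w $ i $ j) analytic_on {z}"
  using analytic_deriv[OF holomorphic_lift_analytic[OF assms]] by (simp add: matrix_deriv_def)

lemma meromorphic_function_nicely:
  "meromorphic_function \<A> G \<Longrightarrow> (U, \<phi>) \<in> \<A> \<Longrightarrow>
     (\<lambda>z. finite_part (G (inv_into U \<phi> z))) nicely_meromorphic_on \<phi> ` U"
  by (auto simp: meromorphic_function_def in_chart_eq)

lemma meromorphic_function_Infty_iff:
  "meromorphic_function \<A> G \<Longrightarrow> (U, \<phi>) \<in> \<A> \<Longrightarrow> p \<in> U \<Longrightarrow>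
     G p = Infty \<longleftrightarrow> is_pole (\<lambda>z. finite_part (G (inv_into U \<phi> z))) (\<phi> p)"
  by (auto simp: meromorphic_function_def in_chart_eq)

lemma meromorphic_function_analytic:
  assumes "meromorphic_function \<A> G" "(U, \<phi>) \<in> \<A>" "p \<in> U" "G p \<noteq> Infty"
  shows "(\<lambda>z. finite_part (G (inv_into U \<phi> z))) analytic_on {\<phi> p}"
  using nicely_meromorphic_on_imp_analytic_at[OF meromorphic_function_nicely[OF assms(1,2)]]
    meromorphic_function_Infty_iff[OF assms(1-3)] assms(3,4) by blast

lemma holomorphic_lift_germ:
  assumes "(U, \<phi>) \<in> \<A>" "z \<in> \<phi> ` U" and ana: "\<And>i j. (\<lambda>w. X w $ i $ j) analytic_on {z}"
    and X: "\<forall>\<^sub>F w in nhds z. det (X w) = 1 \<and> E (inv_into U \<phi> w) = pm_class (X w)"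
  obtains W where "z \<in> W" "holomorphic_lift E (U, \<phi>) W X"
proof -
  have "\<forall>\<^sub>F w in nhds z. \<forall>i j. (\<lambda>w. X w $ i $ j) analytic_on {w}"
    by (simp add: forall_2 eventually_conj_iff eventually_analytic_at[OF ana])
  hence "\<forall>\<^sub>F w in nhds z. w \<in> \<phi> ` U \<and> (\<forall>i j. (\<lambda>w. X w $ i $ j) analytic_on {w}) \<and>
      det (X w) = 1 \<and> E (inv_into U \<phi> w) = pm_class (X w)"
    using X eventually_in_chart_image(2)[OF assms(1,2)] by eventually_elim blast
  then obtain W where W: "open W" "z \<in> W" "\<And>w. w \<in> W \<Longrightarrow> w \<in> \<phi> ` U"
    "\<And>w i j. w \<in> W \<Longrightarrow> (\<lambda>w. X w $ i $ j) analytic_on {w}" "\<And>w. w \<in> W \<Longrightarrow> det (X w) = 1"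
    "\<And>w. w \<in> W \<Longrightarrow> E (inv_into U \<phi> w) = pm_class (X w)"
    unfolding eventually_nhds by blast
  have "holomorphic_lift E (U, \<phi>) W X"
    using W by (auto simp: holomorphic_lift_def intro: holomorphic_onI_analytic_at)
  with W(2) show ?thesis using that by blast
qed

text \<open>The first column carries 1/t and the second t, with t a root of \<open>y\<close>; an
  analytic root exists because \<open>y\<close> is an analytic unit, and both roots give the same
  class. The value at \<open>p\<close> is overwritten because the curve need not have a sensible one
  there.\<close>

lemma holomorphic_at_PSL2I:
  assumes ch: "(U, \<phi>) \<in> \<A>" "p \<in> U"
    and y: "y analytic_on {\<phi> p}" "y (\<phi> p) \<noteq> 0"
    and ana: "\<alpha> analytic_on {\<phi> p}" "\<beta> analytic_on {\<phi> p}" "\<gamma> analytic_on {\<phi> p}" "\<delta> analytic_on {\<phi> p}"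
    and det: "\<forall>\<^sub>F w in nhds (\<phi> p). \<alpha> w * \<delta> w - \<beta> w * \<gamma> w = 1"
    and E: "\<forall>\<^sub>F w in at (\<phi> p). \<forall>t. t\<^sup>2 = y w \<longrightarrow> E (inv_into U \<phi> w) =
      pm_class (mat22 (\<alpha> w / t) (t * \<beta> w) (\<gamma> w / t) (t * \<delta> w))"
  shows "holomorphic_at_PSL2 \<A> E p"
proof -
  obtain r where r: "r analytic_on {\<phi> p}" "\<forall>\<^sub>F w in nhds (\<phi> p). (r w)\<^sup>2 = y w" "\<forall>\<^sub>F w in nhds (\<phi> p). y w \<noteq> 0"
    using analytic_square_root[OF y] .
  define X where "X w = mat22 (\<alpha> w / r w) (r w * \<beta> w) (\<gamma> w / r w) (r w * \<delta> w)" for w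
  have "r (\<phi> p) \<noteq> 0"
    using eventually_nhds_x_imp_x[OF r(2)] eventually_nhds_x_imp_x[OF r(3)] by auto
  hence X_ana: "(\<lambda>w. X w $ i $ j) analytic_on {\<phi> p}" for i j
    using exhaust_2[of i] exhaust_2[of j] ana r(1) by (auto simp: X_def intro!: analytic_intros)
  have "\<forall>\<^sub>F w in nhds (\<phi> p). det (X w) = 1 \<and> (E(p := pm_class (X (\<phi> p)))) (inv_into U \<phi> w) = pm_class (X w)"
    using eventually_in_chart_image(2)[OF ch(1) imageI[OF ch(2)]] det E[unfolded eventually_at_filter] r(2,3)
  proof eventually_elim
    case (elim w)
    have "r w \<noteq> 0" using elim(4,5) by auto
    hence "det (X w) = 1"
      using elim(2) by (simp add: X_def det_mat22 mult.commute)
    moreover have "(E(p := pm_class (X (\<phi> p)))) (inv_into U \<phi> w) = pm_class (X w)"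
    proof (cases "w = \<phi> p")
      case True
      thus ?thesis using chart_inv[OF ch] by simp
    next
      case False
      hence "inv_into U \<phi> w \<noteq> p" using chart_of_inv[OF elim(1)] by metis
      thus ?thesis using elim(3,4) False by (simp add: X_def)
    qed
    ultimately show ?case ..
  qed
  then obtain W where "\<phi> p \<in> W" "holomorphic_lift (E(p := pm_class (X (\<phi> p)))) (U, \<phi>) W X"
    using holomorphic_lift_germ[OF ch(1) imageI[OF ch(2)] X_ana] by blast
  thus ?thesis
    unfolding holomorphic_at_PSL2_def using ch by blast
qed

lemma chart_has_derivative:
  assumes "surface_meromorphic f" "(U, \<phi>) \<in> \<A>" "p \<in> U"
  shows "\<forall>\<^sub>F w in at (\<phi> p). ((\<lambda>z. f (inv_into U \<phi> z)) has_field_derivative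
    deriv (\<lambda>z. f (inv_into U \<phi> z)) w) (at w)"
proof -
  have "\<forall>\<^sub>F w in at (\<phi> p). (\<lambda>z. f (inv_into U \<phi> z)) analytic_on {w}"
    using meromorphic_on_imp_eventually_analytic[OF surface_meromorphicD[OF assms(1,2)]] assms(3) by auto
  thus ?thesis
    by eventually_elim
      (use analytic_on_imp_differentiable_at DERIV_deriv_iff_field_differentiable in blast)
qed

section \<open>Curves built from a square of xi\<close>

context
  fixes G Gs :: "'a \<Rightarrow> riemann_sphere" and v :: "'a \<Rightarrow> complex" and E :: "'a \<Rightarrow> matrix2 set"
    and g gs \<eta>
  assumes G: "meromorphic_function \<A> G" and Gs: "meromorphic_function \<A> Gs" and neq: "G \<noteq> Gs"
    and v: "surface_meromorphic v" and v_log: "log_primitive (gauss_form G Gs) v"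
    and E: "\<And>p x. \<not> form_pole \<A> (gauss_form G Gs) p \<Longrightarrow> x\<^sup>2 = v p \<Longrightarrow>
      E p = pm_class (representation_matrix (finite_part (G p)) (finite_part (Gs p)) x)"
  defines "g \<equiv> \<lambda>p. finite_part (G p)" and "gs \<equiv> \<lambda>p. finite_part (Gs p)"
    and "\<eta> \<equiv> gauss_form G Gs"
begin

lemma curve_facts:
  shows G_part_meromorphic: "surface_meromorphic g" and Gs_part_meromorphic: "surface_meromorphic gs"
    and gauss_form_meromorphic: "meromorphic_form \<A> \<eta>" and square_log_primitive: "log_primitive \<eta> v"
  using meromorphic_function_finite_part[OF G] meromorphic_function_finite_part[OF Gs]
    meromorphic_form_gauss[OF G Gs] v_log by (simp_all add: g_def gs_def \<eta>_def)

lemma curve_square_analytic: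
  assumes "(U, \<phi>) \<in> \<A>" "p \<in> U" "\<not> form_pole \<A> \<eta> p"
  shows "(\<lambda>z. v (inv_into U \<phi> z)) analytic_on {\<phi> p}"
proof (rule meromorphic_at_isCont_imp_analytic)
  show "(\<lambda>z. v (inv_into U \<phi> z)) meromorphic_on {\<phi> p}"
    using surface_meromorphicD[OF v assms(1)] by (rule meromorphic_on_subset) (use assms in auto)
  show "isCont (\<lambda>z. v (inv_into U \<phi> z)) (\<phi> p)"
    using log_primitive_has_derivative[OF square_log_primitive assms(3,1,2)] by (rule DERIV_isCont)
qed

lemma curve_eq_representation: "\<not> form_pole \<A> \<eta> p \<Longrightarrow> x\<^sup>2 = v p \<Longrightarrow> E p = pm_class (representation_matrix (g p) (gs p) x)"
  using E by (simp add: g_def gs_def \<eta>_def)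

lemma eventually_curve_generic: "\<forall>\<^sub>F q in at p. \<not> form_pole \<A> \<eta> q \<and> G q \<noteq> Infty \<and> Gs q \<noteq> Infty \<and> g q \<noteq> gs q"
  using eventually_generic[OF G Gs neq] by (simp add: g_def gs_def \<eta>_def)

lemma eventually_curve_generic_chart:
  assumes "(U, \<phi>) \<in> \<A>" "p \<in> U"
  shows "\<forall>\<^sub>F w in at (\<phi> p). \<not> form_pole \<A> \<eta> (inv_into U \<phi> w) \<and> g (inv_into U \<phi> w) \<noteq> gs (inv_into U \<phi> w)"
  using eventually_curve_generic[of p] eventually_chart_inv[OF assms, of "\<lambda>q. \<not> form_pole \<A> \<eta> q \<and> g q \<noteq> gs q"]
  by (auto elim: eventually_mono)

lemma curve_entries:
  assumes "\<not> form_pole \<A> \<eta> q" "g q \<noteq> gs q" "X \<in> E q"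
  shows "X $ 1 $ 1 = g q * X $ 2 $ 1" "X $ 1 $ 2 = gs q * X $ 2 $ 2"
    "(X $ 2 $ 1)\<^sup>2 * v q = 1" "X $ 2 $ 1 * X $ 2 $ 2 * (g q - gs q) = 1"
proof -
  have x: "(csqrt (v q))\<^sup>2 = v q" by simp
  have "csqrt (v q) \<noteq> 0" using log_primitive_nonzero[OF square_log_primitive assms(1)] by simp
  from representation_matrix_entries[OF _ assms(2) this] assms(3) curve_eq_representation[OF assms(1) x] x
  show "X $ 1 $ 1 = g q * X $ 2 $ 1" "X $ 1 $ 2 = gs q * X $ 2 $ 2"
    "(X $ 2 $ 1)\<^sup>2 * v q = 1" "X $ 2 $ 1 * X $ 2 $ 2 * (g q - gs q) = 1"
    by auto
qed

lemma curve_in_PSL2: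
  assumes "\<not> form_pole \<A> \<eta> q" "g q \<noteq> gs q"
  shows "E q \<in> PSL2"
proof -
  have x: "(csqrt (v q))\<^sup>2 = v q" by simp
  have "csqrt (v q) \<noteq> 0" using log_primitive_nonzero[OF square_log_primitive assms(1)] by simp
  hence "det (representation_matrix (g q) (gs q) (csqrt (v q))) = 1"
    using assms(2) by (simp add: representation_matrix_def det_mat22 diff_divide_distrib[symmetric])
  thus ?thesis
    using curve_eq_representation[OF assms(1) x] by (auto simp: PSL2_def)
qed

lemma curve_meromorphic_PSL2: "meromorphic_PSL2 \<A> E"
proof -
  \<comment> \<open>Factoring s out of the representation matrix at xi = s, where s^2 = v, leaves
    these single-valued entries; thus \<open>v\<close> plays the part of h.\<close>
  let ?a = "\<lambda>p. g p / v p" and ?b = "\<lambda>p. gs p / (g p - gs p)" and ?c = "\<lambda>p. 1 / v p"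
    and ?d = "\<lambda>p. 1 / (g p - gs p)"
  have m: "surface_meromorphic ?a" "surface_meromorphic ?b" "surface_meromorphic ?c" "surface_meromorphic ?d"
    by (auto intro!: surface_meromorphic_divide surface_meromorphic_diff surface_meromorphic_const G_part_meromorphic Gs_part_meromorphic v)
  have ev: "\<forall>\<^sub>F p in at p0. E p \<in> PSL2 \<and> (\<exists>s. s\<^sup>2 = finite_part (sphere_extension v p) \<and>
      E p = pm_class (mat22 (s * finite_part (sphere_extension ?a p)) (s * finite_part (sphere_extension ?b p))
        (s * finite_part (sphere_extension ?c p)) (s * finite_part (sphere_extension ?d p))))" for p0
    using eventually_curve_generic[of p0] eventually_sphere_extension[OF v, of p0] eventually_sphere_extension[OF m(1), of p0]
      eventually_sphere_extension[OF m(2), of p0] eventually_sphere_extension[OF m(3), of p0]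
      eventually_sphere_extension[OF m(4), of p0]
  proof eventually_elim
    case (elim p)
    define s where "s = csqrt (v p)"
    have s: "s\<^sup>2 = v p" by (simp add: s_def)
    have "s \<noteq> 0" using log_primitive_nonzero[OF square_log_primitive] elim(1) by (simp add: s_def)
    have "mat22 (s * ?a p) (s * ?b p) (s * ?c p) (s * ?d p) = representation_matrix (g p) (gs p) s"
      using \<open>s \<noteq> 0\<close> by (simp add: representation_matrix_def power2_eq_square flip: s)
    hence "E p = pm_class (mat22 (s * ?a p) (s * ?b p) (s * ?c p) (s * ?d p))"
      using curve_eq_representation[OF _ s] elim(1) by simp
    moreover have "E p \<in> PSL2"
      using curve_in_PSL2 elim(1) by blast
    ultimately show ?case
      unfolding elim using s by blast
  qed
  show ?thesis
    unfolding meromorphic_PSL2_def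
    by (intro exI[of _ "sphere_extension v"] exI[of _ "sphere_extension ?a"] exI[of _ "sphere_extension ?b"]
        exI[of _ "sphere_extension ?c"] exI[of _ "sphere_extension ?d"] conjI
        meromorphic_function_sphere_extension m v)
      (use ev in \<open>simp add: eventually_cosparse_UNIV\<close>)
qed

text \<open>When A = G C and B = Gs D are differentiated, the terms with C' and D' cancel in the two
  off-diagonal entries of X^{-1} dX and leave -C^2 dG and D^2 dGs. The sign-free relations then turn
  C^2 and D^2 into single-valued functions.\<close>

lemma lift_derivatives:
  assumes ch: "(U, \<phi>) \<in> \<A>" and lift: "holomorphic_lift E (U, \<phi>) W X" and z: "z \<in> W"
  shows "\<forall>\<^sub>F w in at z.
     X w $ 2 $ 2 * matrix_deriv X w $ 1 $ 1 - X w $ 1 $ 2 * matrix_deriv X w $ 2 $ 1 = 0 \<and>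
     X w $ 1 $ 1 * matrix_deriv X w $ 2 $ 1 - X w $ 2 $ 1 * matrix_deriv X w $ 1 $ 1 =
       - (1 / v (inv_into U \<phi> w)) * differential G (U, \<phi>) w \<and>
     X w $ 2 $ 2 * matrix_deriv X w $ 1 $ 2 - X w $ 1 $ 2 * matrix_deriv X w $ 2 $ 2 =
       v (inv_into U \<phi> w) / (g (inv_into U \<phi> w) - gs (inv_into U \<phi> w)) ^ 2 * differential Gs (U, \<phi>) w"
proof -
  have W: "open W" "W \<subseteq> \<phi> ` U" and XE: "\<And>w. w \<in> W \<Longrightarrow> X w \<in> E (inv_into U \<phi> w)"
    using lift by (auto simp: holomorphic_lift_def)
  define p where "p = inv_into U \<phi> z"
  have p: "p \<in> U" "\<phi> p = z"
    using z W chart_inv_in[of z \<phi> U] chart_of_inv[of z \<phi> U] by (auto simp: p_def)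
  define rel where "rel w \<longleftrightarrow> w \<in> W \<and> \<not> form_pole \<A> \<eta> (inv_into U \<phi> w) \<and>
     g (inv_into U \<phi> w) \<noteq> gs (inv_into U \<phi> w)" for w
  have "\<forall>\<^sub>F w in at z. rel w"
    using eventually_curve_generic_chart[OF ch p(1)] eventually_at_in_open'[OF W(1) z]
    unfolding rel_def p(2) by eventually_elim blast
  from eventually_at_eventually_nhds[OF this] eventually_differential[OF G ch p(1)] 
    eventually_differential[OF Gs ch p(1)] eventually_gauss_form[OF G Gs ch p(1)]
    chart_has_derivative[OF G_part_meromorphic ch p(1)] chart_has_derivative[OF Gs_part_meromorphic ch p(1)]
  show ?thesis
    unfolding p(2)
  proof eventually_elim
    case (elim w)
    have rw: "rel w" using elim(1) by (rule eventually_nhds_x_imp_x)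
    define q where "q = inv_into U \<phi> w"
    have wW: "w \<in> W" and q: "q \<in> U" "\<phi> q = w" and np: "\<not> form_pole \<A> \<eta> q" and gneq: "g q \<noteq> gs q"
      using rw W chart_inv_in[of w \<phi> U] chart_of_inv[of w \<phi> U] by (auto simp: rel_def q_def)
    define A B C D where "A = X w $ 1 $ 1" and "B = X w $ 1 $ 2" and "C = X w $ 2 $ 1" and "D = X w $ 2 $ 2"
    define A' B' C' D' where "A' = matrix_deriv X w $ 1 $ 1" and "B' = matrix_deriv X w $ 1 $ 2"
      and "C' = matrix_deriv X w $ 2 $ 1" and "D' = matrix_deriv X w $ 2 $ 2"
    define g' gs' where "g' = deriv (\<lambda>z. g (inv_into U \<phi> z)) w" and "gs' = deriv (\<lambda>z. gs (inv_into U \<phi> z)) w"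
    have dX: "((\<lambda>w. X w $ 1 $ 1) has_field_derivative A') (at w)" "((\<lambda>w. X w $ 1 $ 2) has_field_derivative B') (at w)"
      "((\<lambda>w. X w $ 2 $ 1) has_field_derivative C') (at w)" "((\<lambda>w. X w $ 2 $ 2) has_field_derivative D') (at w)"
      unfolding A'_def B'_def C'_def D'_def by (rule holomorphic_lift_has_derivative[OF lift wW])+
    have dg: "((\<lambda>z. g (inv_into U \<phi> z)) has_field_derivative g') (at w)"
      "((\<lambda>z. gs (inv_into U \<phi> z)) has_field_derivative gs') (at w)"
      using elim(5,6) by (simp_all add: g'_def gs'_def)
    have dv: "((\<lambda>z. v (inv_into U \<phi> z)) has_field_derivative 2 * \<eta> (U, \<phi>) w * v q) (at w)"
      using log_primitive_has_derivative[OF square_log_primitive np ch q(1)] q(2) by simp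
    have rels: "A = g q * C" "B = gs q * D" "C\<^sup>2 * v q = 1" "C * D * (g q - gs q) = 1"
      using curve_entries[OF np gneq, of "X w"] XE[OF wW] by (simp_all add: A_def B_def C_def D_def q_def)
    have ev: "\<forall>\<^sub>F y in nhds w. X y $ 1 $ 1 = g (inv_into U \<phi> y) * X y $ 2 $ 1"
      "\<forall>\<^sub>F y in nhds w. X y $ 1 $ 2 = gs (inv_into U \<phi> y) * X y $ 2 $ 2"
      "\<forall>\<^sub>F y in nhds w. (X y $ 2 $ 1)\<^sup>2 * v (inv_into U \<phi> y) = 1"
      using elim(1) curve_entries XE by (auto elim!: eventually_mono simp: rel_def)
    have A'_eq: "A' = g' * C + g q * C'"
    proof (rule DERIV_unique[OF dX(1)])
      have "((\<lambda>y. g (inv_into U \<phi> y) * X y $ 2 $ 1) has_field_derivative g' * C + g q * C') (at w)"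
        using DERIV_mult[OF dg(1) dX(3)] by (simp add: C_def q_def mult_ac add_ac)
      thus "((\<lambda>w. X w $ 1 $ 1) has_field_derivative g' * C + g q * C') (at w)"
        by (rule has_field_derivative_cong_nhds) (use ev(1) in \<open>simp add: eq_commute\<close>)
    qed
    have B'_eq: "B' = gs' * D + gs q * D'"
    proof (rule DERIV_unique[OF dX(2)])
      have "((\<lambda>y. gs (inv_into U \<phi> y) * X y $ 2 $ 2) has_field_derivative gs' * D + gs q * D') (at w)"
        using DERIV_mult[OF dg(2) dX(4)] by (simp add: D_def q_def mult_ac add_ac)
      thus "((\<lambda>w. X w $ 1 $ 2) has_field_derivative gs' * D + gs q * D') (at w)"
        by (rule has_field_derivative_cong_nhds) (use ev(2) in \<open>simp add: eq_commute\<close>)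
    qed
    \<comment> \<open>Obtained by differentiating C^2 v = 1 and inserting v' = 2 \<eta> v, so that
      no sign of C has to be chosen.\<close>
    have C'_eq: "C' = - \<eta> (U, \<phi>) w * C"
    proof -
      have "((\<lambda>y. (X y $ 2 $ 1)\<^sup>2 * v (inv_into U \<phi> y)) has_field_derivative
          2 * C * C' * v q + 2 * \<eta> (U, \<phi>) w * v q * C\<^sup>2) (at w)"
        using DERIV_mult[OF DERIV_power[OF dX(3), of 2] dv] by (simp add: C_def q_def mult_ac)
      hence "((\<lambda>y. 1) has_field_derivative 2 * C * C' * v q + 2 * \<eta> (U, \<phi>) w * v q * C\<^sup>2) (at w)"
        by (rule has_field_derivative_cong_nhds) (rule ev(3))
      hence "2 * C * C' * v q + 2 * \<eta> (U, \<phi>) w * v q * C\<^sup>2 = 0"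
        using DERIV_const DERIV_unique by blast
      hence "2 * C * v q * (C' + \<eta> (U, \<phi>) w * C) = 0"
        by (simp add: algebra_simps power2_eq_square)
      moreover have "2 * C * v q \<noteq> 0" using rels(3) by auto
      ultimately show ?thesis by (simp add: eq_neg_iff_add_eq_0)
    qed
    have \<eta>_eq: "\<eta> (U, \<phi>) w * (g q - gs q) = g'"
      using elim(4) gneq by (simp add: \<eta>_def g'_def q_def g_def gs_def)
    have diff_eq: "differential G (U, \<phi>) w = g'" "differential Gs (U, \<phi>) w = gs'"
      using elim(2,3) by (simp_all add: g'_def gs'_def g_def gs_def)
    have C2: "1 / v q = C\<^sup>2"
      using rels(3) by (metis divide_eq_eq mult_zero_right zero_neq_one)
    have D2: "v q / (g q - gs q) ^ 2 = D\<^sup>2"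
    proof -
      have "D = 1 / (C * (g q - gs q))"
        using rels(4) gneq by (metis eq_divide_imp mult.assoc mult.commute mult_zero_left zero_neq_one)
      hence "D\<^sup>2 = 1 / (C\<^sup>2 * (g q - gs q) ^ 2)"
        by (simp add: power_divide power_mult_distrib)
      moreover have "C\<^sup>2 = 1 / v q" "v q \<noteq> 0"
        using rels(3) by (auto simp: eq_divide_eq)
      ultimately show ?thesis by simp
    qed
    have "D * A' - B * C' = C * D * (g' - \<eta> (U, \<phi>) w * (g q - gs q))"
      unfolding A'_eq C'_eq rels(1,2) by (simp add: algebra_simps)
    hence "D * A' - B * C' = 0"
      by (simp add: \<eta>_eq)
    moreover have "A * C' - C * A' = - (1 / v q) * differential G (U, \<phi>) w"
      unfolding A'_eq rels(1) C2 diff_eq by (simp add: algebra_simps power2_eq_square)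
    moreover have "D * B' - B * D' = v q / (g q - gs q) ^ 2 * differential Gs (U, \<phi>) w"
      unfolding B'_eq rels(2) D2 diff_eq by (simp add: algebra_simps power2_eq_square)
    ultimately show ?case
      unfolding A_def B_def C_def D_def A'_def B'_def C'_def D'_def q_def by blast
  qed
qed

lemma lift_legendrian:
  assumes ch: "(U, \<phi>) \<in> \<A>" and lift: "holomorphic_lift E (U, \<phi>) W X" and z: "z \<in> W"
  shows "X z $ 2 $ 2 * matrix_deriv X z $ 1 $ 1 - X z $ 1 $ 2 * matrix_deriv X z $ 2 $ 1 = 0"
proof (rule analytic_eventually_eq_0[of "\<lambda>w. X w $ 2 $ 2 * matrix_deriv X w $ 1 $ 1 - X w $ 1 $ 2 * matrix_deriv X w $ 2 $ 1"])
  show "(\<lambda>w. X w $ 2 $ 2 * matrix_deriv X w $ 1 $ 1 - X w $ 1 $ 2 * matrix_deriv X w $ 2 $ 1) analytic_on {z}"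
    by (intro analytic_intros holomorphic_lift_analytic[OF lift z] holomorphic_lift_deriv_analytic[OF lift z])
qed (use lift_derivatives[OF assms] in \<open>auto elim: eventually_mono\<close>)

lemma curve_legendrian: "legendrian \<A> E"
  unfolding legendrian_def using curve_meromorphic_PSL2 lift_legendrian by auto

lemma curve_canonical_form:
  shows "\<exists>\<omega>. canonical_form \<A> E \<omega> \<and> (\<forall>(U, \<phi>)\<in>\<A>. \<forall>p\<in>U. \<not> form_pole \<A> \<eta> p \<longrightarrow>
    \<omega> (U, \<phi>) (\<phi> p) = - differential G (U, \<phi>) (\<phi> p) / v p)"
proof -
  define \<omega>0 where "\<omega>0 = (\<lambda>(U, \<phi>) z. - 1 / v (inv_into U \<phi> z) * differential G (U, \<phi>) z)"
  define \<theta>0 where "\<theta>0 = (\<lambda>(U, \<phi>) z. v (inv_into U \<phi> z) /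
    ((g (inv_into U \<phi> z) - gs (inv_into U \<phi> z)) * (g (inv_into U \<phi> z) - gs (inv_into U \<phi> z)))
      * differential Gs (U, \<phi>) z)"
  note mero = surface_meromorphic_divide surface_meromorphic_diff surface_meromorphic_mult
    surface_meromorphic_const v G_part_meromorphic Gs_part_meromorphic
  have "pre_form \<omega>0"
    unfolding \<omega>0_def by (rule pre_form_mult[of "\<lambda>p. - 1 / v p"])
      (intro mero meromorphic_form_imp_pre_form meromorphic_form_differential G)+
  moreover have "pre_form \<theta>0"
    unfolding \<theta>0_def by (rule pre_form_mult[of "\<lambda>p. v p / ((g p - gs p) * (g p - gs p))"])
      (intro mero meromorphic_form_imp_pre_form meromorphic_form_differential Gs)+
  ultimately have pre: "pre_form \<omega>0" "pre_form \<theta>0" by blast+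
  define \<omega> where "\<omega> = (\<lambda>ch. remove_sings (\<omega>0 ch))"
  define \<theta> where "\<theta> = (\<lambda>ch. remove_sings (\<theta>0 ch))"
  have form: "meromorphic_form \<A> \<omega>" "meromorphic_form \<A> \<theta>"
    unfolding \<omega>_def \<theta>_def using pre meromorphic_form_remove_sings by blast+
  have "matrix_inv (X z) ** matrix_deriv X z = mat22 0 (\<theta> (U, \<phi>) z) (\<omega> (U, \<phi>) z) 0"
    if ch: "(U, \<phi>) \<in> \<A>" and lift: "holomorphic_lift E (U, \<phi>) W X" and z: "z \<in> W" for U \<phi> W X z
  proof -
    have detX: "\<And>w. w \<in> W \<Longrightarrow> det (X w) = 1" and W: "open W" "W \<subseteq> \<phi> ` U"
      using lift by (auto simp: holomorphic_lift_def)
    have zU: "z \<in> \<phi> ` U" using z W by blast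
    define p where "p = inv_into U \<phi> z"
    have p: "p \<in> U" "\<phi> p = z"
      using zU chart_inv_in[of z \<phi> U] chart_of_inv[of z \<phi> U] by (auto simp: p_def)
    note ana = analytic_intros holomorphic_lift_analytic[OF lift z] holomorphic_lift_deriv_analytic[OF lift z]
    have "\<forall>\<^sub>F w in at z. X w $ 1 $ 1 * matrix_deriv X w $ 2 $ 1 - X w $ 2 $ 1 * matrix_deriv X w $ 1 $ 1 = \<omega> (U, \<phi>) w"
      using lift_derivatives[OF ch lift z] eventually_remove_sings_pre_form[OF pre(1) ch p(1), unfolded p(2)]
      by eventually_elim (simp add: \<omega>_def \<omega>0_def)
    hence o: "X z $ 1 $ 1 * matrix_deriv X z $ 2 $ 1 - X z $ 2 $ 1 * matrix_deriv X z $ 1 $ 1 = \<omega> (U, \<phi>) z"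
      by (rule nicely_meromorphic_eqI[where A = "{z}", OF analytic_on_imp_nicely_meromorphic_on
            meromorphic_form_nicely[OF form(1) ch] _ zU, rotated 2]) (intro ana | simp)+
    have "\<forall>\<^sub>F w in at z. X w $ 2 $ 2 * matrix_deriv X w $ 1 $ 2 - X w $ 1 $ 2 * matrix_deriv X w $ 2 $ 2 = \<theta> (U, \<phi>) w"
      using lift_derivatives[OF ch lift z] eventually_remove_sings_pre_form[OF pre(2) ch p(1), unfolded p(2)]
      by eventually_elim (simp add: \<theta>_def \<theta>0_def power2_eq_square)
    hence t: "X z $ 2 $ 2 * matrix_deriv X z $ 1 $ 2 - X z $ 1 $ 2 * matrix_deriv X z $ 2 $ 2 = \<theta> (U, \<phi>) z"
      by (rule nicely_meromorphic_eqI[where A = "{z}", OF analytic_on_imp_nicely_meromorphic_on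
            meromorphic_form_nicely[OF form(2) ch] _ zU, rotated 2]) (intro ana | simp)+
    have l: "X z $ 2 $ 2 * matrix_deriv X z $ 1 $ 1 - X z $ 1 $ 2 * matrix_deriv X z $ 2 $ 1 = 0"
      by (rule lift_legendrian[OF ch lift z])
    have "((\<lambda>w. X w $ 1 $ 1 * X w $ 2 $ 2 - X w $ 1 $ 2 * X w $ 2 $ 1) has_field_derivative
       (matrix_deriv X z $ 1 $ 1 * X z $ 2 $ 2 + matrix_deriv X z $ 2 $ 2 * X z $ 1 $ 1) -
       (matrix_deriv X z $ 1 $ 2 * X z $ 2 $ 1 + matrix_deriv X z $ 2 $ 1 * X z $ 1 $ 2)) (at z)"
      by (intro DERIV_diff DERIV_mult holomorphic_lift_has_derivative[OF lift z])
    moreover have "\<forall>\<^sub>F w in nhds z. X w $ 1 $ 1 * X w $ 2 $ 2 - X w $ 1 $ 2 * X w $ 2 $ 1 = 1"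
      using eventually_nhds_in_open[OF W(1) z] by eventually_elim (use detX in \<open>simp add: det_2\<close>)
    ultimately have "((\<lambda>w. 1) has_field_derivative
       (matrix_deriv X z $ 1 $ 1 * X z $ 2 $ 2 + matrix_deriv X z $ 2 $ 2 * X z $ 1 $ 1) -
       (matrix_deriv X z $ 1 $ 2 * X z $ 2 $ 1 + matrix_deriv X z $ 2 $ 1 * X z $ 1 $ 2)) (at z)"
      by (rule has_field_derivative_cong_nhds)
    hence d: "(matrix_deriv X z $ 1 $ 1 * X z $ 2 $ 2 + matrix_deriv X z $ 2 $ 2 * X z $ 1 $ 1) -
       (matrix_deriv X z $ 1 $ 2 * X z $ 2 $ 1 + matrix_deriv X z $ 2 $ 1 * X z $ 1 $ 2) = 0"
      using DERIV_const DERIV_unique by blast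
    \<comment> \<open>The second diagonal entry of X^{-1} dX: the derivative of det X = 1 minus the
      Legendrian relation.\<close>
    have "X z $ 1 $ 1 * matrix_deriv X z $ 2 $ 2 - X z $ 2 $ 1 * matrix_deriv X z $ 1 $ 2 = 0"
      using d l by (simp add: algebra_simps)
    thus ?thesis
      unfolding matrix_inv_mult_mat22[OF detX[OF z]] using o t l by simp
  qed
  hence "canonical_form \<A> E \<omega>"
    unfolding canonical_form_def using form by (intro conjI exI[of _ \<theta>]) auto
  moreover have "\<omega> (U, \<phi>) (\<phi> p) = - differential G (U, \<phi>) (\<phi> p) / v p"
    if ch: "(U, \<phi>) \<in> \<A>" "p \<in> U" and np: "\<not> form_pole \<A> \<eta> p" for U \<phi> p
  proof -
    have va: "(\<lambda>z. v (inv_into U \<phi> z)) analytic_on {\<phi> p}"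
      by (rule curve_square_analytic[OF ch np])
    have vp: "v (inv_into U \<phi> (\<phi> p)) \<noteq> 0"
      using log_primitive_nonzero[OF square_log_primitive np] chart_inv[OF ch] by simp
    \<comment> \<open>The differential of \<open>G\<close> may have a pole where
      \<open>\<eta>\<close> has none, namely at a pole of \<open>G\<close> where \<open>Gs\<close>
      has a pole of higher order. The factor -1/v is an analytic unit, so the product has a pole
      there too and keeps the default value 0.\<close>
    have "\<omega>0 (U, \<phi>) nicely_meromorphic_on {\<phi> p}"
      unfolding nicely_meromorphic_on_def
    proof (intro conjI ballI)
      show "\<omega>0 (U, \<phi>) meromorphic_on {\<phi> p}"
        using pre_form_meromorphic[OF pre(1) ch(1)] by (rule meromorphic_on_subset) (use ch in auto)
      fix z assume "z \<in> {\<phi> p}"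
      have d: "differential G (U, \<phi>) nicely_meromorphic_on {\<phi> p}"
        using meromorphic_form_nicely[OF meromorphic_form_differential[OF G] ch(1)]
        by (rule nicely_meromorphic_on_subset) (use ch in auto)
      have c: "(\<lambda>z. - 1 / v (inv_into U \<phi> z)) \<midarrow>\<phi> p\<rightarrow> - 1 / v (inv_into U \<phi> (\<phi> p))"
        using analytic_at_imp_isCont[OF va] vp by (intro tendsto_intros) (auto simp: isCont_def)
      have "is_pole (\<omega>0 (U, \<phi>)) (\<phi> p) \<and> \<omega>0 (U, \<phi>) (\<phi> p) = 0" if "is_pole (differential G (U, \<phi>)) (\<phi> p)"
      proof -
        have "filterlim (\<lambda>z. - 1 / v (inv_into U \<phi> z) * differential G (U, \<phi>) z) at_infinity (at (\<phi> p))"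
          using that unfolding is_pole_def
          by (intro tendsto_mult_filterlim_at_infinity[OF c]) (use vp in auto)
        moreover have "differential G (U, \<phi>) (\<phi> p) = 0"
          using d that nicely_meromorphic_on_remove_sings_eq[OF d, of "\<phi> p"] by simp
        ultimately show ?thesis unfolding is_pole_def \<omega>0_def prod.case by simp
      qed
      moreover have "\<omega>0 (U, \<phi>) \<midarrow>\<phi> p\<rightarrow> \<omega>0 (U, \<phi>) (\<phi> p)" if "\<not> is_pole (differential G (U, \<phi>)) (\<phi> p)"
        using d that c unfolding nicely_meromorphic_on_def \<omega>0_def prod.case
        by (intro tendsto_mult) auto
      ultimately show "is_pole (\<omega>0 (U, \<phi>)) z \<and> \<omega>0 (U, \<phi>) z = 0 \<or> \<omega>0 (U, \<phi>) \<midarrow>z\<rightarrow> \<omega>0 (U, \<phi>) z"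
        using \<open>z \<in> {\<phi> p}\<close> by blast
    qed
    hence "\<omega> (U, \<phi>) (\<phi> p) = \<omega>0 (U, \<phi>) (\<phi> p)"
      unfolding \<omega>_def by (rule nicely_meromorphic_on_remove_sings_eq) auto
    thus ?thesis
      using chart_inv[OF ch] by (simp add: \<omega>0_def)
  qed
  ultimately show ?thesis by blast
qed

lemma curve_gauss_maps: "hyperbolic_gauss_maps \<A> E G Gs"
  unfolding hyperbolic_gauss_maps_def holomorphic_sphere_map_def eventually_cosparse_UNIV
proof (intro conjI disjI1 G Gs allI)
  fix p
  show "\<forall>\<^sub>F q in at p. \<forall>X\<in>E q. G q = sphere_quotient (X $ 1 $ 1) (X $ 2 $ 1) \<and>
      Gs q = sphere_quotient (X $ 1 $ 2) (X $ 2 $ 2)"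
    using eventually_curve_generic[of p]
  proof eventually_elim
    case (elim q)
    show ?case
    proof
      fix X assume "X \<in> E q"
      from curve_entries[OF _ _ this] elim
      have "X $ 1 $ 1 = g q * X $ 2 $ 1" "X $ 1 $ 2 = gs q * X $ 2 $ 2" "X $ 2 $ 1 \<noteq> 0" "X $ 2 $ 2 \<noteq> 0"
        by auto
      moreover have "G q = Fin (g q)" "Gs q = Fin (gs q)"
        using elim by (cases "G q"; cases "Gs q"; simp add: g_def gs_def)+
      ultimately show "G q = sphere_quotient (X $ 1 $ 1) (X $ 2 $ 1) \<and>
          Gs q = sphere_quotient (X $ 1 $ 2) (X $ 2 $ 2)"
        by (simp add: sphere_quotient_def)
    qed
  qed
qed

text \<open>The quotient of the entries in the first column recovers \<open>G\<close>.\<close>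

lemma curve_not_constant:
  assumes "\<not> G constant_on UNIV"
  shows "\<not> constant_PSL2 E"
proof
  assume "constant_PSL2 E"
  then obtain P where P: "\<And>p. \<forall>\<^sub>F q in at p. E q = P"
    unfolding constant_PSL2_def eventually_cosparse_UNIV by blast
  obtain p0 :: 'a where True by simp
  have "\<forall>\<^sub>F q in at p0. E q = P \<and> E q \<in> PSL2"
    using P[of p0] eventually_curve_generic[of p0] by eventually_elim (use curve_in_PSL2 in blast)
  hence "P \<in> PSL2"
    using eventually_happens'[OF at_surface_neq_bot] by blast
  then obtain X where X: "X \<in> P" using pm_class_self unfolding PSL2_def by blast
  have "G = (\<lambda>_. Fin (X $ 1 $ 1 / X $ 2 $ 1))"
  proof (rule meromorphic_function_eqI[OF G meromorphic_function_const])
    fix p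
    show "\<forall>\<^sub>F q in at p. finite_part (G q) = finite_part (Fin (X $ 1 $ 1 / X $ 2 $ 1))"
      using P[of p] eventually_curve_generic[of p]
    proof eventually_elim
      case (elim q)
      hence "X $ 1 $ 1 = g q * X $ 2 $ 1" "X $ 2 $ 1 \<noteq> 0"
        using curve_entries[of q X] X by auto
      thus ?case by (simp add: g_def)
    qed
  qed
  with assms show False by (auto simp: constant_on_def)
qed

lemma equal_gauss_maps_imp_pole:
  assumes "G p = Gs p"
  shows "pole_PSL2 \<A> E p"
  unfolding pole_PSL2_def
proof
  assume "holomorphic_at_PSL2 \<A> E p"
  then obtain U \<phi> P W X where ch: "(U, \<phi>) \<in> \<A>" "p \<in> U" and W: "\<phi> p \<in> W"
    and lift: "holomorphic_lift (E(p := P)) (U, \<phi>) W X"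
    unfolding holomorphic_at_PSL2_def by blast
  define G1 Gs1 where "G1 z = g (inv_into U \<phi> z)" and "Gs1 z = gs (inv_into U \<phi> z)" for z
  have lift': "open W" "\<And>w. w \<in> W \<Longrightarrow> w \<in> \<phi> ` U" "\<And>w. w \<in> W \<Longrightarrow> det (X w) = 1"
    "\<And>w. w \<in> W \<Longrightarrow> X w \<in> (E(p := P)) (inv_into U \<phi> w)"
    using lift by (auto simp: holomorphic_lift_def)
  have rel: "\<forall>\<^sub>F w in at (\<phi> p). X w $ 1 $ 1 = G1 w * X w $ 2 $ 1 \<and> X w $ 1 $ 2 = Gs1 w * X w $ 2 $ 2 \<and>
      X w $ 2 $ 1 * X w $ 2 $ 2 * (G1 w - Gs1 w) = 1 \<and> X w $ 1 $ 1 * X w $ 2 $ 2 - X w $ 1 $ 2 * X w $ 2 $ 1 = 1"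
    using eventually_curve_generic_chart[OF ch] eventually_at_in_open[OF lift'(1) W]
  proof eventually_elim
    case (elim w)
    have "inv_into U \<phi> w \<noteq> p" using elim(2) chart_of_inv[OF lift'(2), of w] by auto
    hence "X w \<in> E (inv_into U \<phi> w)" using lift'(4)[of w] elim(2) by simp
    from curve_entries[OF _ _ this] elim lift'(3)[of w] show ?case
      by (simp add: G1_def Gs1_def det_2)
  qed
  have cont: "(\<lambda>w. X w $ i $ j) \<midarrow>\<phi> p\<rightarrow> X (\<phi> p) $ i $ j" for i j
    using analytic_at_imp_isCont[OF holomorphic_lift_analytic[OF lift W]] by (simp add: isCont_def)
  \<comment> \<open>In either case an expression that equals 1 in a punctured neighbourhood is shown
    to have limit 0.\<close>
  have "((\<lambda>w. 1 :: complex) \<longlongrightarrow> 0) (at (\<phi> p))"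
  proof (cases "G p = Infty")
    case False
    have "isCont G1 (\<phi> p)" "isCont Gs1 (\<phi> p)"
      using meromorphic_function_analytic[OF G ch False] meromorphic_function_analytic[OF Gs ch]
        False assms analytic_at_imp_isCont by (auto simp: G1_def[abs_def] Gs1_def[abs_def] g_def gs_def)
    moreover have "G1 (\<phi> p) = Gs1 (\<phi> p)"
      using assms chart_inv[OF ch] by (simp add: G1_def Gs1_def g_def gs_def)
    ultimately have "(\<lambda>w. G1 w - Gs1 w) \<midarrow>\<phi> p\<rightarrow> 0"
      unfolding isCont_def using tendsto_diff[of G1 "G1 (\<phi> p)" "at (\<phi> p)" Gs1 "Gs1 (\<phi> p)"] by simp
    hence "(\<lambda>w. X w $ 2 $ 1 * X w $ 2 $ 2 * (G1 w - Gs1 w)) \<midarrow>\<phi> p\<rightarrow> X (\<phi> p) $ 2 $ 1 * X (\<phi> p) $ 2 $ 2 * 0"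
      by (intro tendsto_mult cont)
    thus ?thesis
      using rel by (auto elim!: Lim_transform_eventually eventually_mono)
  next
    case True
    have poles: "is_pole G1 (\<phi> p)" "is_pole Gs1 (\<phi> p)"
      using True assms meromorphic_function_Infty_iff[OF G ch] meromorphic_function_Infty_iff[OF Gs ch]
      by (simp_all add: G1_def [abs_def] Gs1_def [abs_def] g_def gs_def)
    note inverses = poles[unfolded is_pole_def, THEN tendsto_inverse_at_infinity]
    have "(\<lambda>w. X w $ 1 $ 1 * (X w $ 1 $ 2 * inverse (Gs1 w)) - X w $ 1 $ 2 * (X w $ 1 $ 1 * inverse (G1 w)))
        \<midarrow>\<phi> p\<rightarrow> X (\<phi> p) $ 1 $ 1 * (X (\<phi> p) $ 1 $ 2 * 0) - X (\<phi> p) $ 1 $ 2 * (X (\<phi> p) $ 1 $ 1 * 0)"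
      by (intro tendsto_diff tendsto_mult cont inverses)
    moreover have "\<forall>\<^sub>F w in at (\<phi> p). X w $ 1 $ 1 * (X w $ 1 $ 2 * inverse (Gs1 w)) -
        X w $ 1 $ 2 * (X w $ 1 $ 1 * inverse (G1 w)) = 1"
      using rel non_zero_neighbour_pole[OF poles(1)] non_zero_neighbour_pole[OF poles(2)]
      by eventually_elim (simp add: field_simps)
    ultimately show ?thesis
      by (auto elim!: Lim_transform_eventually)
  qed
  thus False
    using LIM_unique[OF tendsto_const] by fastforce
qed

lemma distinct_gauss_maps_imp_holomorphic:
  assumes "G p \<noteq> Gs p"
  shows "holomorphic_at_PSL2 \<A> E p"
proof -
  obtain U \<phi> where ch: "(U, \<phi>) \<in> \<A>" "p \<in> U" by (rule obtain_chart)
  define G1 Gs1 V where "G1 z = g (inv_into U \<phi> z)" and "Gs1 z = gs (inv_into U \<phi> z)"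
    and "V z = v (inv_into U \<phi> z)" for z
  have mero: "G1 meromorphic_on {\<phi> p}" "Gs1 meromorphic_on {\<phi> p}" "V meromorphic_on {\<phi> p}"
    using surface_meromorphicD[OF G_part_meromorphic ch(1)] surface_meromorphicD[OF Gs_part_meromorphic ch(1)]
      surface_meromorphicD[OF v ch(1)] ch(2)
    by (auto simp: G1_def[abs_def] Gs1_def[abs_def] V_def[abs_def] intro: meromorphic_on_subset)
  have gen: "\<forall>\<^sub>F w in at (\<phi> p). \<not> form_pole \<A> \<eta> (inv_into U \<phi> w) \<and> G1 w \<noteq> Gs1 w"
    using eventually_curve_generic_chart[OF ch] by (simp add: G1_def Gs1_def)
  have gauss: "\<forall>\<^sub>F w in at (\<phi> p). \<eta> (U, \<phi>) w = deriv G1 w / (G1 w - Gs1 w)"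
    using eventually_gauss_form[OF G Gs ch] by (simp add: \<eta>_def G1_def[abs_def] Gs1_def g_def gs_def)
  have Gs_ana: "Gs1 analytic_on {\<phi> p}" if "Gs p \<noteq> Infty"
    using meromorphic_function_analytic[OF Gs ch that] by (simp add: Gs1_def[abs_def] gs_def)
  show ?thesis
  proof (cases "G p = Infty")
    case False
    have G_ana: "G1 analytic_on {\<phi> p}"
      using meromorphic_function_analytic[OF G ch False] by (simp add: G1_def[abs_def] g_def)
    \<comment> \<open>If \<open>Gs\<close> is infinite, 1/(G - Gs) tends to 0; so \<open>d\<close>
      is analytic in every subcase, and \<eta>, being dG times \<open>d\<close>, has no pole at
      \<open>p\<close>.\<close>
    define d where "d = remove_sings (\<lambda>z. inverse (G1 z - Gs1 z))"
    have d_mero: "(\<lambda>z. inverse (G1 z - Gs1 z)) meromorphic_on {\<phi> p}"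
      using mero by (intro meromorphic_intros)
    have "\<exists>l. (\<lambda>z. inverse (G1 z - Gs1 z)) \<midarrow>\<phi> p\<rightarrow> l"
    proof (cases "Gs p = Infty")
      case True
      hence "is_pole Gs1 (\<phi> p)"
        using meromorphic_function_Infty_iff[OF Gs ch] by (simp add: Gs1_def[abs_def] gs_def)
      hence "filterlim (\<lambda>z. - G1 z + Gs1 z) at_infinity (at (\<phi> p))"
        using analytic_at_imp_isCont[OF G_ana] unfolding is_pole_def isCont_def
        by (intro tendsto_add_filterlim_at_infinity[OF tendsto_minus])
      from tendsto_minus[OF tendsto_inverse_at_infinity[OF this]] show ?thesis
        by (auto simp flip: inverse_minus_eq)
    next
      case finite: False
      have "G1 (\<phi> p) - Gs1 (\<phi> p) \<noteq> 0"
        using assms False finite chart_inv[OF ch] by (cases "G p"; cases "Gs p"; simp add: G1_def Gs1_def g_def gs_def)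
      hence "isCont (\<lambda>z. inverse (G1 z - Gs1 z)) (\<phi> p)"
        using analytic_at_imp_isCont[OF G_ana] analytic_at_imp_isCont[OF Gs_ana[OF finite]]
        by (intro continuous_intros) auto
      thus ?thesis by (auto simp: isCont_def)
    qed
    hence d_ana: "d analytic_on {\<phi> p}"
      unfolding d_def using d_mero remove_sings_analytic_at by (auto simp: meromorphic_on_altdef)
    have d_eq: "\<forall>\<^sub>F w in at (\<phi> p). d w = inverse (G1 w - Gs1 w)"
      unfolding d_def using d_mero by (rule eventually_remove_sings_eq_meromorphic) simp
    have "\<not> is_pole (\<lambda>w. deriv G1 w * d w) (\<phi> p)"
      using G_ana d_ana by (intro analytic_at_imp_no_pole analytic_intros) auto
    moreover have "\<forall>\<^sub>F w in at (\<phi> p). \<eta> (U, \<phi>) w = deriv G1 w * d w"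
      using gauss d_eq by eventually_elim (simp add: divide_inverse)
    from is_pole_cong[OF this refl] have "is_pole (\<eta> (U, \<phi>)) (\<phi> p) = is_pole (\<lambda>w. deriv G1 w * d w) (\<phi> p)" .
    ultimately have np: "\<not> form_pole \<A> \<eta> p"
      using form_pole_iff[OF gauss_form_meromorphic ch] by simp
    \<comment> \<open>The entry Gs/(G - Gs) is written as G d - 1 because \<open>Gs\<close> may have
      a pole here.\<close>
    show ?thesis
    proof (rule holomorphic_at_PSL2I[OF ch, of V G1 "\<lambda>w. G1 w * d w - 1" "\<lambda>_. 1" d])
      show "V analytic_on {\<phi> p}" using curve_square_analytic[OF ch np] by (simp add: V_def[abs_def])
      show "V (\<phi> p) \<noteq> 0" using log_primitive_nonzero[OF square_log_primitive np] chart_inv[OF ch] by (simp add: V_def)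
      show "\<forall>\<^sub>F w in at (\<phi> p). \<forall>t. t\<^sup>2 = V w \<longrightarrow> E (inv_into U \<phi> w) =
          pm_class (mat22 (G1 w / t) (t * (G1 w * d w - 1)) (1 / t) (t * d w))"
        using gen d_eq
      proof (eventually_elim, intro allI impI)
        fix w t assume a: "\<not> form_pole \<A> \<eta> (inv_into U \<phi> w) \<and> G1 w \<noteq> Gs1 w" "d w = inverse (G1 w - Gs1 w)" "t\<^sup>2 = V w"
        have "E (inv_into U \<phi> w) = pm_class (representation_matrix (G1 w) (Gs1 w) t)"
          using curve_eq_representation a by (simp add: G1_def Gs1_def V_def)
        moreover have "G1 w * d w - 1 = Gs1 w / (G1 w - Gs1 w)"
          using a by (simp add: field_simps)
        ultimately show "E (inv_into U \<phi> w) = pm_class (mat22 (G1 w / t) (t * (G1 w * d w - 1)) (1 / t) (t * d w))"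
          using a by (simp add: representation_matrix_def divide_inverse mult.assoc)
      qed
    qed (use G_ana d_ana in \<open>auto intro!: analytic_intros\<close>)
  next
    case True
    hence finite: "Gs p \<noteq> Infty" using assms by auto
    have pole: "is_pole G1 (\<phi> p)"
      using meromorphic_function_Infty_iff[OF G ch] True by (simp add: G1_def[abs_def] g_def)
    define q where "q = remove_sings (\<lambda>z. inverse (G1 z))"
    have lim0: "(\<lambda>z. inverse (G1 z)) \<midarrow>\<phi> p\<rightarrow> 0"
      using pole unfolding is_pole_def by (rule tendsto_inverse_at_infinity)
    have q_mero: "(\<lambda>z. inverse (G1 z)) meromorphic_on {\<phi> p}"
      using mero by (intro meromorphic_intros)
    have q_ana: "q analytic_on {\<phi> p}"
      unfolding q_def using q_mero remove_sings_analytic_at lim0 by (auto simp: meromorphic_on_altdef)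
    have q0: "q (\<phi> p) = 0" unfolding q_def using lim0 by (rule remove_sings_eqI)
    have q_eq: "\<forall>\<^sub>F w in at (\<phi> p). q w = inverse (G1 w)"
      unfolding q_def using q_mero by (rule eventually_remove_sings_eq_meromorphic) simp
    note Gs_ana = Gs_ana[OF finite]
    \<comment> \<open>With \<open>q\<close> = 1/G this is G/(G - Gs), with the pole of
      \<open>G\<close> cancelled; \<open>q\<close> vanishes at \<open>p\<close>, so the denominator
      is 1 there.\<close>
    define d where "d w = inverse (1 - q w * Gs1 w)" for w
    have d_ana: "d analytic_on {\<phi> p}"
      unfolding d_def[abs_def] using q_ana Gs_ana q0 by (intro analytic_intros) auto
    have nz: "\<forall>\<^sub>F w in nhds (\<phi> p). 1 - q w * Gs1 w \<in> - {0}"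
    proof (rule isCont_eventually_nhds)
      show "isCont (\<lambda>w. 1 - q w * Gs1 w) (\<phi> p)"
        using q_ana Gs_ana by (intro analytic_at_imp_isCont analytic_intros)
    qed (use q0 in auto)
    \<comment> \<open>The logarithmic derivative of xi/G, that is \<eta> - dG/G = Gs dG / (G (G -
      Gs)), expressed through \<open>q\<close> and \<open>d\<close> to show that it is
      analytic.\<close>
    define \<kappa> where "\<kappa> w = - deriv q w * Gs1 w * d w" for w
    have \<kappa>_ana: "\<kappa> analytic_on {\<phi> p}"
      unfolding \<kappa>_def[abs_def] using q_ana Gs_ana d_ana by (intro analytic_intros)
    \<comment> \<open>The square of xi/G. Its value at \<open>p\<close> is meaningless, so it is
      replaced by an analytic unit \<open>y\<close>, which the regularity of the logarithmic
      derivative provides.\<close>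
    define Y where "Y w = V w * (q w)\<^sup>2" for w
    have Y_mero: "Y meromorphic_on {\<phi> p}"
      unfolding Y_def[abs_def] using mero analytic_on_imp_meromorphic_on[OF q_ana] by (intro meromorphic_intros)
    have G_nz: "\<forall>\<^sub>F w in at (\<phi> p). G1 w \<noteq> 0" by (rule non_zero_neighbour_pole[OF pole])
    have Y_nz: "\<forall>\<^sub>F w in at (\<phi> p). Y w \<noteq> 0"
      using gen q_eq G_nz
      by eventually_elim (use log_primitive_nonzero[OF square_log_primitive] in \<open>simp add: Y_def V_def\<close>)
    have "\<forall>\<^sub>F w in at (\<phi> p). deriv Y w = 2 * \<kappa> w * Y w"
      using gen gauss eventually_at_eventually_nhds[OF q_eq] G_nz
        eventually_in_chart_image(1)[OF ch(1) imageI[OF ch(2)]] chart_has_derivative[OF G_part_meromorphic ch]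
    proof eventually_elim
      case (elim w)
      have wU: "inv_into U \<phi> w \<in> U" "\<phi> (inv_into U \<phi> w) = w"
        using chart_inv_in[OF elim(5)] chart_of_inv[OF elim(5)] by auto
      have qw: "q w = inverse (G1 w)" using elim(3) by (rule eventually_nhds_x_imp_x)
      have dG: "(G1 has_field_derivative deriv G1 w) (at w)"
        using elim(6) by (simp add: G1_def[abs_def])
      have "((\<lambda>w. inverse (G1 w)) has_field_derivative - (deriv G1 w * inverse ((G1 w)\<^sup>2))) (at w)"
        using dG elim(4) by (auto intro!: derivative_eq_intros simp: power2_eq_square)
      hence dq: "(q has_field_derivative - (deriv G1 w * inverse ((G1 w)\<^sup>2))) (at w)"
        by (rule has_field_derivative_cong_nhds) (use elim(3) in \<open>simp add: eq_commute\<close>)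
      have dV: "(V has_field_derivative 2 * \<eta> (U, \<phi>) w * V w) (at w)"
        using log_primitive_has_derivative[OF square_log_primitive _ ch(1) wU(1)] elim(1) wU(2) by (simp add: V_def[abs_def])
      have "(Y has_field_derivative 2 * \<eta> (U, \<phi>) w * V w * (q w)\<^sup>2 +
          2 * q w * (- (deriv G1 w * inverse ((G1 w)\<^sup>2))) * V w) (at w)"
        unfolding Y_def[abs_def] using DERIV_mult[OF dV DERIV_power[OF dq, of 2]] by (simp add: mult_ac)
      hence "deriv Y w = 2 * \<eta> (U, \<phi>) w * V w * (q w)\<^sup>2 +
          2 * q w * (- (deriv G1 w * inverse ((G1 w)\<^sup>2))) * V w"
        by (rule DERIV_imp_deriv)
      also have "\<dots> = 2 * (\<eta> (U, \<phi>) w - deriv G1 w / G1 w) * Y w"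
        unfolding Y_def qw by (simp add: algebra_simps divide_inverse power2_eq_square)
      finally have "deriv Y w = 2 * (\<eta> (U, \<phi>) w - deriv G1 w / G1 w) * Y w" .
      moreover have "\<eta> (U, \<phi>) w - deriv G1 w / G1 w = deriv G1 w * Gs1 w / (G1 w * (G1 w - Gs1 w))"
        using elim(1,2,4) by (simp add: field_simps)
      moreover have "\<kappa> w = deriv G1 w * Gs1 w / (G1 w * (G1 w - Gs1 w))"
      proof -
        have "1 - q w * Gs1 w = (G1 w - Gs1 w) / G1 w"
          using elim(4) by (simp add: qw field_simps)
        hence "d w = G1 w / (G1 w - Gs1 w)" by (simp add: d_def)
        moreover have "deriv q w = - (deriv G1 w / (G1 w)\<^sup>2)"
          using DERIV_imp_deriv[OF dq] by (simp add: divide_inverse)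
        ultimately show ?thesis
          using elim(4) by (simp add: \<kappa>_def power2_eq_square)
      qed
      ultimately show ?case by simp
    qed
    from logarithmic_derivative_at(2)[OF Y_mero Y_nz this analytic_at_imp_no_pole[OF \<kappa>_ana]]
    obtain y where y: "y analytic_on {\<phi> p}" "y (\<phi> p) \<noteq> 0" "\<forall>\<^sub>F w in at (\<phi> p). Y w = y w"
      by blast
    \<comment> \<open>For t = xi/G the entries G/xi, 1/xi and xi/(G - Gs) become 1/t, q/t and t
      d.\<close>
    show ?thesis
    proof (rule holomorphic_at_PSL2I[OF ch y(1,2), of "\<lambda>_. 1" "\<lambda>w. Gs1 w * d w" q d])
      show "\<forall>\<^sub>F w in nhds (\<phi> p). 1 * d w - Gs1 w * d w * q w = 1"
        using nz
      proof eventually_elim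
        case (elim w)
        have "1 * d w - Gs1 w * d w * q w = (1 - q w * Gs1 w) * d w" by (simp add: algebra_simps)
        thus ?case using elim by (simp add: d_def)
      qed
      show "\<forall>\<^sub>F w in at (\<phi> p). \<forall>t. t\<^sup>2 = y w \<longrightarrow> E (inv_into U \<phi> w) =
          pm_class (mat22 (1 / t) (t * (Gs1 w * d w)) (q w / t) (t * d w))"
        using gen q_eq G_nz y(3)
      proof (eventually_elim, intro allI impI)
        fix w t assume a: "\<not> form_pole \<A> \<eta> (inv_into U \<phi> w) \<and> G1 w \<noteq> Gs1 w" "q w = inverse (G1 w)"
          "G1 w \<noteq> 0" "Y w = y w" "t\<^sup>2 = y w"
        have "(t * G1 w)\<^sup>2 = V w * (q w * G1 w)\<^sup>2"
          using a(5) by (simp add: power_mult_distrib Y_def flip: a(4))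
        also have "q w * G1 w = 1" using a(2,3) by simp
        finally have "(t * G1 w)\<^sup>2 = V w" by simp
        hence "E (inv_into U \<phi> w) = pm_class (representation_matrix (G1 w) (Gs1 w) (t * G1 w))"
          using curve_eq_representation a(1) by (simp add: G1_def Gs1_def V_def)
        moreover have "d w = G1 w / (G1 w - Gs1 w)"
        proof -
          have "1 - q w * Gs1 w = (G1 w - Gs1 w) / G1 w" using a(3) by (simp add: a(2) field_simps)
          thus ?thesis by (simp add: d_def)
        qed
        ultimately show "E (inv_into U \<phi> w) =
          pm_class (mat22 (1 / t) (t * (Gs1 w * d w)) (q w / t) (t * d w))"
          using a(3) by (simp add: representation_matrix_def a(2) divide_inverse mult_ac)
      qed
    qed (use q_ana Gs_ana d_ana in \<open>auto intro!: analytic_intros\<close>)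
  qed
qed

lemma curve_pole_iff: "pole_PSL2 \<A> E p \<longleftrightarrow> G p = Gs p"
  using equal_gauss_maps_imp_pole distinct_gauss_maps_imp_holomorphic pole_PSL2_def by metis

end

end

section \<open>Legendrian curves with given Gauss maps\<close>

text \<open>The determinant determines D from C, and C x is 1 or -1; in the second case -x takes the
  place of x, which only changes the sign of the matrix.\<close>

lemma pm_class_eq_representation_matrix:
  assumes "X $ 1 $ 1 = g * X $ 2 $ 1" "X $ 1 $ 2 = gs * X $ 2 $ 2" "det X = 1"
    and "(X $ 2 $ 1)\<^sup>2 * x\<^sup>2 = 1"
  shows "pm_class X = pm_class (representation_matrix g gs x)"
proof -
  have det: "X $ 2 $ 1 * X $ 2 $ 2 * (g - gs) = 1"
    using assms(1-3) by (simp add: det_2 algebra_simps)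
  have eq: "X = representation_matrix g gs y" if "X $ 2 $ 1 * y = 1" for y
  proof -
    have "y \<noteq> 0" "X $ 2 $ 1 = 1 / y" using that by (auto simp: eq_divide_eq)
    moreover have "X $ 2 $ 2 = y / (g - gs)"
    proof -
      have "y = (X $ 2 $ 1 * y) * X $ 2 $ 2 * (g - gs)"
        using det by (metis mult.assoc mult.commute mult.right_neutral)
      moreover have "g - gs \<noteq> 0" using det by auto
      ultimately show ?thesis using that by (simp add: eq_divide_eq)
    qed
    ultimately show ?thesis
      using assms(1,2) by (intro mat22_eqI) (auto simp: representation_matrix_def)
  qed
  have "(X $ 2 $ 1 * x)\<^sup>2 = 1"
    using assms(4) by (simp add: power_mult_distrib)
  hence "X $ 2 $ 1 * x = 1 \<or> X $ 2 $ 1 * (- x) = 1"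
    by (auto simp: power2_eq_1_iff)
  thus ?thesis
    using eq[of x] eq[of "- x"] by (auto simp: representation_matrix_uminus)
qed

lemma PSL2_det:
  assumes "P \<in> PSL2" "X \<in> P"
  shows "det X = 1" "P = pm_class X"
  using assms by (auto simp: PSL2_def pm_class_def det_2)

context surface
begin

text \<open>The entry C contains the two-valued root of h; its square h c^2 does not.\<close>

lemma meromorphic_PSL2_lower_left_square:
  assumes "meromorphic_PSL2 \<A> E"
  obtains k where "surface_meromorphic k" "\<And>p. \<forall>\<^sub>F q in at p. \<forall>X\<in>E q. (X $ 2 $ 1)\<^sup>2 = k q"
proof -
  obtain h a b c d where m: "meromorphic_function \<A> h" "meromorphic_function \<A> c"
    and E: "\<forall>p. \<forall>\<^sub>F p in at p. E p \<in> PSL2 \<and> (\<exists>s. s^2 = finite_part (h p) \<and>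
              E p = pm_class (mat22 (s * finite_part (a p)) (s * finite_part (b p))
                                    (s * finite_part (c p)) (s * finite_part (d p))))"
    using assms unfolding meromorphic_PSL2_def eventually_cosparse_UNIV by blast
  show ?thesis
  proof (rule that[of "\<lambda>p. finite_part (h p) * (finite_part (c p) * finite_part (c p))"])
    show "surface_meromorphic (\<lambda>p. finite_part (h p) * (finite_part (c p) * finite_part (c p)))"
      using m by (intro surface_meromorphic_mult meromorphic_function_finite_part)
    show "\<forall>\<^sub>F q in at p. \<forall>X\<in>E q. (X $ 2 $ 1)\<^sup>2 = finite_part (h q) * (finite_part (c q) * finite_part (c q))" for p
      using E[rule_format, of p] by eventually_elim (auto simp: pm_class_def power2_eq_square)
  qed
qed

text \<open>At generic points h is nonzero, since otherwise the matrix would vanish; an analytic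
  root of h then gives the lift. The Legendrian condition speaks of lifts only, so this is what
  makes it applicable to a given curve.\<close>

lemma meromorphic_PSL2_local_lift:
  assumes E: "meromorphic_PSL2 \<A> E" and ch: "(U, \<phi>) \<in> \<A>" "p \<in> U"
  shows "\<forall>\<^sub>F w in at (\<phi> p). \<exists>W X. w \<in> W \<and> holomorphic_lift E (U, \<phi>) W X"
proof -
  obtain h a b c d where m: "meromorphic_function \<A> h" "meromorphic_function \<A> a" "meromorphic_function \<A> b"
      "meromorphic_function \<A> c" "meromorphic_function \<A> d"
    and E: "\<forall>\<^sub>F p in at p. E p \<in> PSL2 \<and> (\<exists>s. s^2 = finite_part (h p) \<and>
              E p = pm_class (mat22 (s * finite_part (a p)) (s * finite_part (b p))
                                    (s * finite_part (c p)) (s * finite_part (d p))))"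
    using E unfolding meromorphic_PSL2_def eventually_cosparse_UNIV by blast
  define H A B C D where "H z = finite_part (h (inv_into U \<phi> z))" and "A z = finite_part (a (inv_into U \<phi> z))"
    and "B z = finite_part (b (inv_into U \<phi> z))" and "C z = finite_part (c (inv_into U \<phi> z))"
    and "D z = finite_part (d (inv_into U \<phi> z))" for z
  have ana: "\<forall>\<^sub>F w in at (\<phi> p). H analytic_on {w}" "\<forall>\<^sub>F w in at (\<phi> p). A analytic_on {w}"
    "\<forall>\<^sub>F w in at (\<phi> p). B analytic_on {w}" "\<forall>\<^sub>F w in at (\<phi> p). C analytic_on {w}"
    "\<forall>\<^sub>F w in at (\<phi> p). D analytic_on {w}"
    unfolding H_def[abs_def] A_def[abs_def] B_def[abs_def] C_def[abs_def] D_def[abs_def]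
    using m[THEN meromorphic_function_finite_part, THEN surface_meromorphicD, OF ch(1),
        THEN meromorphic_on_imp_eventually_analytic, OF imageI, OF ch(2)] by blast+
  have EW: "\<forall>\<^sub>F w in at (\<phi> p). E (inv_into U \<phi> w) \<in> PSL2 \<and> (\<exists>s. s^2 = H w \<and>
              E (inv_into U \<phi> w) = pm_class (mat22 (s * A w) (s * B w) (s * C w) (s * D w)))"
    unfolding H_def A_def B_def C_def D_def by (subst eventually_chart_inv[OF ch]) (rule E)
  from eventually_at_eventually_nhds[OF EW] ana eventually_in_chart_image(1)[OF ch(1) imageI[OF ch(2)]]
  show ?thesis
  proof eventually_elim
    case (elim w)
    have "H w \<noteq> 0"
    proof
      assume "H w = 0"
      hence "det (mat22 0 0 0 0) = 1"
        using eventually_nhds_x_imp_x[OF elim(1)] PSL2_det(1)[OF _ pm_class_self] by auto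
      thus False by (simp add: det_mat22)
    qed
    then obtain r where r: "r analytic_on {w}" "\<forall>\<^sub>F y in nhds w. (r y)\<^sup>2 = H y"
      using analytic_square_root[OF elim(2)] by blast
    define X where "X y = mat22 (r y * A y) (r y * B y) (r y * C y) (r y * D y)" for y
    have X_ana: "(\<lambda>z. X z $ i $ j) analytic_on {w}" for i j
      using exhaust_2[of i] exhaust_2[of j] r(1) elim(3-6) by (auto simp: X_def intro!: analytic_intros)
    have "\<forall>\<^sub>F y in nhds w. det (X y) = 1 \<and> E (inv_into U \<phi> y) = pm_class (X y)"
      using elim(1) r(2)
    proof eventually_elim
      case (elim y)
      obtain s where s: "s\<^sup>2 = H y" "E (inv_into U \<phi> y) = pm_class (mat22 (s * A y) (s * B y) (s * C y) (s * D y))"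
        using elim(1) by blast
      hence "s = r y \<or> s = - r y"
        using elim(2) by (metis power2_eq_iff)
      hence "mat22 (s * A y) (s * B y) (s * C y) (s * D y) = X y \<or>
          mat22 (s * A y) (s * B y) (s * C y) (s * D y) = - X y"
        by (auto simp: X_def uminus_mat22)
      hence "E (inv_into U \<phi> y) = pm_class (X y)"
        using s(2) pm_class_uminus by metis
      moreover from this have "det (X y) = 1"
        using elim(1) by (intro PSL2_det(1)[of "pm_class (X y)"]) auto
      ultimately show ?case by blast
    qed
    from holomorphic_lift_germ[OF ch(1) elim(7) X_ana this] show ?case by blast
  qed
qed

lemma meromorphic_PSL2_eventually:
  assumes "meromorphic_PSL2 \<A> E"
  shows "\<forall>\<^sub>F q in at p. E q \<in> PSL2"
  using assms unfolding meromorphic_PSL2_def eventually_cosparse_UNIV by (auto elim: eventually_mono)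

lemma sphere_map_nonconstant:
  assumes "holomorphic_sphere_map \<A> G" "\<not> G constant_on UNIV"
  shows "meromorphic_function \<A> G"
  using assms by (auto simp: holomorphic_sphere_map_def constant_on_def)

lemma sphere_quotient_eqD:
  assumes "sphere_quotient a b = Fin z"
  shows "b \<noteq> 0" "a = z * b"
  using assms by (auto simp: sphere_quotient_def split: if_splits)

text \<open>All values of xi share one square, so the union consists of a single class; it is
  nonempty because \<open>p\<close> can be reached from \<open>z0\<close> off the poles.\<close>

lemma representation_curve_eq:
  assumes \<eta>: "meromorphic_form \<A> (gauss_form G Gs)" and np: "\<not> form_pole \<A> (gauss_form G Gs) z0"
    "\<not> form_pole \<A> (gauss_form G Gs) p"
    and sq: "\<And>y. y \<in> xi_values \<A> (gauss_form G Gs) c z0 p \<Longrightarrow> y\<^sup>2 = x\<^sup>2"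
  shows "representation_curve \<A> G Gs c z0 p =
    pm_class (representation_matrix (finite_part (G p)) (finite_part (Gs p)) x)"
proof -
  have "pm_class (representation_matrix (finite_part (G p)) (finite_part (Gs p)) y) =
      pm_class (representation_matrix (finite_part (G p)) (finite_part (Gs p)) x)"
    if "y \<in> xi_values \<A> (gauss_form G Gs) c z0 p" for y
    using sq[OF that] by (rule pm_class_representation_matrix_cong)
  thus ?thesis
    unfolding representation_curve_def using xi_values_nonempty[OF \<eta> np, of c] by simp
qed

section \<open>Recovering the square of xi from a Legendrian curve\<close>

context
  fixes E G Gs
  assumes leg: "legendrian \<A> E" and maps: "hyperbolic_gauss_maps \<A> E G Gs"
    and nonconst: "\<not> G constant_on UNIV" "\<not> Gs constant_on UNIV"
begin

lemma legendrian_gauss_maps: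
  shows gauss_map_meromorphic: "meromorphic_function \<A> G"
    and gauss_map'_meromorphic: "meromorphic_function \<A> Gs"
  using maps nonconst by (auto simp: hyperbolic_gauss_maps_def intro: sphere_map_nonconstant)

lemma legendrian_meromorphic: "meromorphic_PSL2 \<A> E"
  using leg by (simp add: legendrian_def)

lemma legendrian_quotients:
  "\<forall>\<^sub>F q in at p. \<forall>X\<in>E q. G q = sphere_quotient (X $ 1 $ 1) (X $ 2 $ 1) \<and>
     Gs q = sphere_quotient (X $ 1 $ 2) (X $ 2 $ 2)"
  using maps unfolding hyperbolic_gauss_maps_def eventually_cosparse_UNIV by blast

text \<open>Equal Gauss maps would make the two columns of the matrix proportional, against
  determinant 1.\<close>

lemma legendrian_gauss_maps_distinct: "G \<noteq> Gs"
proof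
  assume eq: "G = Gs"
  obtain p0 :: 'a where True by simp
  have "\<forall>\<^sub>F q in at p0. False"
    using legendrian_quotients[of p0] meromorphic_PSL2_eventually[OF legendrian_meromorphic, of p0]
  proof eventually_elim
    case (elim q)
    obtain X where X: "X \<in> E q" using elim(2) pm_class_self unfolding PSL2_def by blast
    have "X $ 1 $ 1 * X $ 2 $ 2 - X $ 1 $ 2 * X $ 2 $ 1 = 1"
      using PSL2_det(1)[OF elim(2) X] by (simp add: det_2)
    moreover have "sphere_quotient (X $ 1 $ 1) (X $ 2 $ 1) = sphere_quotient (X $ 1 $ 2) (X $ 2 $ 2)"
      using elim(1) X eq by metis
    ultimately show False
      by (auto simp: sphere_quotient_def field_simps split: if_splits)
  qed
  thus False by simp
qed

lemma legendrian_entries: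
  "\<forall>\<^sub>F q in at p. E q \<in> PSL2 \<and> \<not> form_pole \<A> (gauss_form G Gs) q \<and>
     finite_part (G q) \<noteq> finite_part (Gs q) \<and>
     (\<forall>X\<in>E q. X $ 1 $ 1 = finite_part (G q) * X $ 2 $ 1 \<and> X $ 1 $ 2 = finite_part (Gs q) * X $ 2 $ 2 \<and>
       X $ 2 $ 1 \<noteq> 0 \<and> X $ 2 $ 2 \<noteq> 0)"
  using legendrian_quotients[of p] meromorphic_PSL2_eventually[OF legendrian_meromorphic, of p]
    eventually_generic[OF legendrian_gauss_maps legendrian_gauss_maps_distinct, of p]
proof eventually_elim
  case (elim q)
  have fin: "G q = Fin (finite_part (G q))" "Gs q = Fin (finite_part (Gs q))"
    using elim(3) by (cases "G q"; cases "Gs q"; simp)+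
  have "X $ 1 $ 1 = finite_part (G q) * X $ 2 $ 1 \<and> X $ 1 $ 2 = finite_part (Gs q) * X $ 2 $ 2 \<and>
       X $ 2 $ 1 \<noteq> 0 \<and> X $ 2 $ 2 \<noteq> 0" if "X \<in> E q" for X
  proof -
    have "sphere_quotient (X $ 1 $ 1) (X $ 2 $ 1) = Fin (finite_part (G q))"
      "sphere_quotient (X $ 1 $ 2) (X $ 2 $ 2) = Fin (finite_part (Gs q))"
      using elim(1) that fin by metis+
    from sphere_quotient_eqD[OF this(1)] sphere_quotient_eqD[OF this(2)] show ?thesis by blast
  qed
  thus ?case using elim by blast
qed

lemma legendrian_half_log_derivative:
  obtains u where "half_log_derivative u (gauss_form G Gs)"
    "\<And>p. \<forall>\<^sub>F q in at p. \<forall>X\<in>E q. (X $ 2 $ 1)\<^sup>2 * u q = 1"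
proof -
  obtain k where k: "surface_meromorphic k" "\<And>p. \<forall>\<^sub>F q in at p. \<forall>X\<in>E q. (X $ 2 $ 1)\<^sup>2 = k q"
    by (rule meromorphic_PSL2_lower_left_square[OF legendrian_meromorphic]) (rule that)
  \<comment> \<open>In the representation formula C = 1/xi, so this is the candidate for the square
    of xi.\<close>
  define u where "u p = 1 / k p" for p
  have u: "surface_meromorphic u"
    unfolding u_def[abs_def] using k(1) by (intro surface_meromorphic_divide surface_meromorphic_const)
  have sq: "\<forall>\<^sub>F q in at p. \<forall>X\<in>E q. (X $ 2 $ 1)\<^sup>2 * u q = 1" for p
    using k(2)[of p] legendrian_entries[of p]
    by eventually_elim (auto simp: u_def)
  have nz: "\<forall>\<^sub>F q in at p. u q \<noteq> 0" for p
    using sq[of p] legendrian_entries[of p]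
  proof eventually_elim
    case (elim q)
    obtain X where "X \<in> E q" using elim(2) pm_class_self unfolding PSL2_def by blast
    with elim(1) show ?case by auto
  qed
  have "\<forall>\<^sub>F z in at (\<phi> p). deriv (\<lambda>z. u (inv_into U \<phi> z)) z = 2 * gauss_form G Gs (U, \<phi>) z * u (inv_into U \<phi> z)"
    if ch: "(U, \<phi>) \<in> \<A>" "p \<in> U" for U \<phi> p
  proof -
    define rel where "rel q \<longleftrightarrow> finite_part (G q) \<noteq> finite_part (Gs q) \<and>
       (\<forall>X\<in>E q. X $ 1 $ 1 = finite_part (G q) * X $ 2 $ 1 \<and> X $ 1 $ 2 = finite_part (Gs q) * X $ 2 $ 2 \<and>
       X $ 2 $ 1 \<noteq> 0 \<and> X $ 2 $ 2 \<noteq> 0 \<and> (X $ 2 $ 1)\<^sup>2 * u q = 1)" for q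
    have "\<forall>\<^sub>F q in at p. rel q"
      using legendrian_entries[of p] sq[of p] by eventually_elim (auto simp: rel_def)
    hence "\<forall>\<^sub>F z in at (\<phi> p). rel (inv_into U \<phi> z)"
      by (subst eventually_chart_inv[OF ch])
    from eventually_at_eventually_nhds[OF this] meromorphic_PSL2_local_lift[OF legendrian_meromorphic ch]
      eventually_gauss_form[OF legendrian_gauss_maps ch]
      chart_has_derivative[OF meromorphic_function_finite_part[OF gauss_map_meromorphic] ch]
    show ?thesis
    proof eventually_elim
      case (elim w)
      obtain W X where W: "w \<in> W" and lift: "holomorphic_lift E (U, \<phi>) W X" using elim(2) by blast
      have lift': "open W" "\<And>y. y \<in> W \<Longrightarrow> X y \<in> E (inv_into U \<phi> y)"
        using lift by (auto simp: holomorphic_lift_def)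
      define g gs where "g y = finite_part (G (inv_into U \<phi> y))" and "gs y = finite_part (Gs (inv_into U \<phi> y))" for y
      have ev: "\<forall>\<^sub>F y in nhds w. g y \<noteq> gs y \<and> X y $ 1 $ 1 = g y * X y $ 2 $ 1 \<and> X y $ 1 $ 2 = gs y * X y $ 2 $ 2 \<and>
          X y $ 2 $ 1 \<noteq> 0 \<and> X y $ 2 $ 2 \<noteq> 0 \<and> (X y $ 2 $ 1)\<^sup>2 * u (inv_into U \<phi> y) = 1"
        using elim(1) eventually_nhds_in_open[OF lift'(1) W]
        by eventually_elim (use lift'(2) in \<open>simp add: rel_def g_def gs_def\<close>)
      define C D C' where "C = X w $ 2 $ 1" and "D = X w $ 2 $ 2" and "C' = matrix_deriv X w $ 2 $ 1"
      have at_w: "g w \<noteq> gs w" "X w $ 1 $ 2 = gs w * D" "C \<noteq> 0" "D \<noteq> 0" "C\<^sup>2 * u (inv_into U \<phi> w) = 1"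
        using eventually_nhds_x_imp_x[OF ev] by (auto simp: C_def D_def)
      have dg: "(g has_field_derivative deriv g w) (at w)"
        using elim(4) by (simp add: g_def[abs_def])
      have dC: "((\<lambda>y. X y $ 2 $ 1) has_field_derivative C') (at w)"
        unfolding C'_def by (rule holomorphic_lift_has_derivative[OF lift W])
      have "((\<lambda>y. g y * X y $ 2 $ 1) has_field_derivative deriv g w * C + C' * g w) (at w)"
        using DERIV_mult[OF dg dC] by (simp add: C_def)
      hence "((\<lambda>y. X y $ 1 $ 1) has_field_derivative deriv g w * C + C' * g w) (at w)"
        by (rule has_field_derivative_cong_nhds) (use ev in \<open>auto elim: eventually_mono\<close>)
      hence "matrix_deriv X w $ 1 $ 1 = deriv g w * C + C' * g w"
        using holomorphic_lift_has_derivative[OF lift W] DERIV_unique by blast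
      moreover have "D * matrix_deriv X w $ 1 $ 1 - gs w * D * C' = 0"
        using leg ch(1) lift W at_w(2) unfolding legendrian_def C'_def D_def by fastforce
      \<comment> \<open>After inserting A = g C and B = gs D, the Legendrian equation has the factor
        D, which is nonzero because \<open>Gs\<close> is finite at generic points.\<close>
      ultimately have "D * (deriv g w * C + C' * (g w - gs w)) = 0"
        by (simp add: algebra_simps)
      hence C'_eq: "C' * (g w - gs w) = - deriv g w * C"
        using at_w(4) by (simp add: eq_neg_iff_add_eq_0 add.commute)
      have "((\<lambda>y. 1 / (X y $ 2 $ 1)\<^sup>2) has_field_derivative - 2 * C' / C ^ 3) (at w)"
        using dC at_w(3)
        by (auto intro!: derivative_eq_intros simp: C_def power2_eq_square power3_eq_cube field_simps)
      moreover have "\<forall>\<^sub>F y in nhds w. 1 / (X y $ 2 $ 1)\<^sup>2 = u (inv_into U \<phi> y)"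
        using ev by eventually_elim (auto simp: field_simps)
      ultimately have "((\<lambda>y. u (inv_into U \<phi> y)) has_field_derivative - 2 * C' / C ^ 3) (at w)"
        by (rule has_field_derivative_cong_nhds)
      hence "deriv (\<lambda>y. u (inv_into U \<phi> y)) w = - 2 * C' / C ^ 3"
        by (rule DERIV_imp_deriv)
      moreover have "C' = - deriv g w * C / (g w - gs w)"
        unfolding C'_eq[symmetric] using at_w(1) by simp
      moreover have "u (inv_into U \<phi> w) = 1 / C\<^sup>2"
        using at_w(3,5) by (simp add: field_simps)
      moreover have "gauss_form G Gs (U, \<phi>) w = deriv g w / (g w - gs w)"
        using elim(3) by (simp add: g_def[abs_def] gs_def)
      ultimately show ?case
        using at_w(3) by (simp add: power2_eq_square power3_eq_cube)
    qed
  qed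
  with u nz sq show ?thesis
    by (intro that[of u]) (auto simp: half_log_derivative_def)
qed

lemma legendrian_representation:
  shows "only_simple_poles \<A> (gauss_form G Gs) \<and> periods_in_pi_i_Z \<A> (gauss_form G Gs) \<and>
    (\<forall>z0. \<not> form_pole \<A> (gauss_form G Gs) z0 \<longrightarrow>
       (\<exists>c. c \<noteq> 0 \<and> (\<forall>\<^sub>\<approx>p. E p = representation_curve \<A> G Gs c z0 p)))"
proof -
  define \<eta> where "\<eta> = gauss_form G Gs"
  have \<eta>: "meromorphic_form \<A> \<eta>"
    unfolding \<eta>_def by (rule meromorphic_form_gauss[OF legendrian_gauss_maps])
  obtain u where u: "half_log_derivative u \<eta>" "\<And>p. \<forall>\<^sub>F q in at p. \<forall>X\<in>E q. (X $ 2 $ 1)\<^sup>2 * u q = 1"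
    by (rule legendrian_half_log_derivative[folded \<eta>_def]) (rule that)
  obtain v where v: "log_primitive \<eta> v" "\<And>p. \<forall>\<^sub>F q in at p. v q = u q"
    by (rule half_log_derivative_log_primitive[OF u(1) \<eta>]) (rule that)
  have "\<exists>c. c \<noteq> 0 \<and> (\<forall>\<^sub>\<approx>p. E p = representation_curve \<A> G Gs c z0 p)" if z0: "\<not> form_pole \<A> \<eta> z0" for z0
  proof (intro exI conjI)
    have vz0: "v z0 \<noteq> 0" by (rule log_primitive_nonzero[OF v(1) z0])
    \<comment> \<open>This constant makes the square of xi equal to \<open>v\<close> at
      \<open>z0\<close>, hence at every point that is not a pole of \<open>\<eta>\<close>; the other
      root gives the same curve in PSL(2,C).\<close>
    thus "csqrt (v z0) \<noteq> 0" by simp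
    show "\<forall>\<^sub>\<approx>p. E p = representation_curve \<A> G Gs (csqrt (v z0)) z0 p"
      unfolding eventually_cosparse_UNIV
    proof
      fix p
      show "\<forall>\<^sub>F q in at p. E q = representation_curve \<A> G Gs (csqrt (v z0)) z0 q"
        using legendrian_entries[of p] u(2)[of p] v(2)[of p]
      proof eventually_elim
        case (elim q)
        obtain X where X: "X \<in> E q" using elim(1) pm_class_self unfolding PSL2_def by blast
        have np: "\<not> form_pole \<A> \<eta> q" using elim(1) by (simp add: \<eta>_def)
        have "representation_curve \<A> G Gs (csqrt (v z0)) z0 q =
            pm_class (representation_matrix (finite_part (G q)) (finite_part (Gs q)) (csqrt (v q)))"
        proof (rule representation_curve_eq)
          fix y assume "y \<in> xi_values \<A> (gauss_form G Gs) (csqrt (v z0)) z0 q"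
          from xi_values_square[OF v(1)[unfolded \<eta>_def] this] vz0 show "y\<^sup>2 = (csqrt (v q))\<^sup>2"
            by simp
        qed (use \<eta> z0 np in \<open>simp_all add: \<eta>_def\<close>)
        also have "\<dots> = pm_class X"
          using elim X PSL2_det(1)[of "E q" X]
          by (intro pm_class_eq_representation_matrix[symmetric]) auto
        also have "\<dots> = E q" using elim(1) X PSL2_det(2) by blast
        finally show ?case by simp
      qed
    qed
  qed
  thus ?thesis
    using half_log_derivative_simple_poles[OF u(1)] log_primitive_periods[OF v(1)] unfolding \<eta>_def by blast
qed

end

text \<open>The periods make \<open>xi_square\<close> a single-valued square, and together with the
  simple poles they make it meromorphic; this is the input for the facts about curves built from
  such a square.\<close>

lemma representation_curve_properties:
  assumes G: "meromorphic_function \<A> G" and Gs: "meromorphic_function \<A> Gs"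
    and nonconst: "\<not> G constant_on UNIV" and neq: "G \<noteq> Gs"
    and simple: "only_simple_poles \<A> (gauss_form G Gs)" and periods: "periods_in_pi_i_Z \<A> (gauss_form G Gs)"
    and z0: "\<not> form_pole \<A> (gauss_form G Gs) z0" and c: "c \<noteq> 0"
  shows "let E = representation_curve \<A> G Gs c z0; \<xi> = xi_values \<A> (gauss_form G Gs) c z0 in
           legendrian \<A> E \<and>
           \<not> constant_PSL2 E \<and>
           hyperbolic_gauss_maps \<A> E G Gs \<and>
           (\<exists>\<omega>. canonical_form \<A> E \<omega> \<and>
              (\<forall>(U, \<phi>)\<in>\<A>. \<forall>p\<in>U. \<forall>x\<in>\<xi> p.
                 \<omega> (U, \<phi>) (\<phi> p) = - differential G (U, \<phi>) (\<phi> p) / x^2)) \<and>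
           (\<forall>p. pole_PSL2 \<A> E p \<longleftrightarrow> G p = Gs p)"
proof -
  define E where "E = representation_curve \<A> G Gs c z0"
  note \<eta> = meromorphic_form_gauss[OF G Gs]
  note xi = \<eta> simple periods z0 c
  define v where "v = xi_square (gauss_form G Gs) c z0"
  have v: "surface_meromorphic v" "log_primitive (gauss_form G Gs) v"
    unfolding v_def by (rule surface_meromorphic_xi_square[OF xi] log_primitive_xi_square[OF xi])+
  have sq: "y\<^sup>2 = v p" if "y \<in> xi_values \<A> (gauss_form G Gs) c z0 p" for y p
    unfolding v_def using xi_square_eq[OF xi that] by simp
  have E: "E p = pm_class (representation_matrix (finite_part (G p)) (finite_part (Gs p)) x)"
    if "\<not> form_pole \<A> (gauss_form G Gs) p" "x\<^sup>2 = v p" for p x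
    unfolding E_def using that sq by (intro representation_curve_eq[OF \<eta> z0]) auto
  note curve = G Gs neq v E
  obtain \<omega> where \<omega>: "canonical_form \<A> E \<omega>" "\<And>U \<phi> p. (U, \<phi>) \<in> \<A> \<Longrightarrow> p \<in> U \<Longrightarrow>
      \<not> form_pole \<A> (gauss_form G Gs) p \<Longrightarrow> \<omega> (U, \<phi>) (\<phi> p) = - differential G (U, \<phi>) (\<phi> p) / v p"
    using curve_canonical_form[OF curve] by blast
  have "\<forall>(U, \<phi>)\<in>\<A>. \<forall>p\<in>U. \<forall>x\<in>xi_values \<A> (gauss_form G Gs) c z0 p.
      \<omega> (U, \<phi>) (\<phi> p) = - differential G (U, \<phi>) (\<phi> p) / x^2"
    using \<omega>(2) sq xi_values_nonpole by fastforce
  with \<omega>(1) show ?thesis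
    using curve_legendrian[OF curve] curve_not_constant[OF curve nonconst] curve_gauss_maps[OF curve]
      curve_pole_iff[OF curve] by (auto simp: Let_def simp flip: E_def)
qed

end

theorem theorem3p3:
  fixes \<A> :: "('a::t2_space) chart set"
  assumes surface: "riemann_surface \<A>"
  shows
    "(\<forall>G Gs c z0.
        meromorphic_function \<A> G \<and> meromorphic_function \<A> Gs \<and>
        \<not> G constant_on UNIV \<and> \<not> Gs constant_on UNIV \<and> G \<noteq> Gs \<and>
        only_simple_poles \<A> (gauss_form G Gs) \<and>
        periods_in_pi_i_Z \<A> (gauss_form G Gs) \<and>
        \<not> form_pole \<A> (gauss_form G Gs) z0 \<and> c \<noteq> 0 \<longrightarrow>
        (let E = representation_curve \<A> G Gs c z0; \<xi> = xi_values \<A> (gauss_form G Gs) c z0 in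
           legendrian \<A> E \<and>
           \<not> constant_PSL2 E \<and>
           hyperbolic_gauss_maps \<A> E G Gs \<and>
           (\<exists>\<omega>. canonical_form \<A> E \<omega> \<and>
              (\<forall>(U, \<phi>)\<in>\<A>. \<forall>p\<in>U. \<forall>x\<in>\<xi> p.
                 \<omega> (U, \<phi>) (\<phi> p) = - differential G (U, \<phi>) (\<phi> p) / x^2)) \<and>
           (\<forall>p. pole_PSL2 \<A> E p \<longleftrightarrow> G p = Gs p)))
     \<and>
     (\<forall>E G Gs.
        legendrian \<A> E \<and> hyperbolic_gauss_maps \<A> E G Gs \<and>
        \<not> G constant_on UNIV \<and> \<not> Gs constant_on UNIV \<longrightarrow>
        G \<noteq> Gs \<and>
        only_simple_poles \<A> (gauss_form G Gs) \<and>
        periods_in_pi_i_Z \<A> (gauss_form G Gs) \<and>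
        (\<forall>z0. \<not> form_pole \<A> (gauss_form G Gs) z0 \<longrightarrow>
           (\<exists>c. c \<noteq> 0 \<and> (\<forall>\<^sub>\<approx>p. E p = representation_curve \<A> G Gs c z0 p))))"
proof -
  interpret surface \<A> by standard (rule surface)
  show ?thesis
    by (rule conjI; intro allI impI; elim conjE)
      ((rule representation_curve_properties; assumption)
        | (use legendrian_gauss_maps_distinct legendrian_representation in blast))+
qed

end
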